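(* Let $R$ be the ring of integers in a nonarchimedean local field $K$, with residue field $\mathbb{F}_q$. Let $\Lambda$ be an $R$-order in a finite-dimensional semisimple $K$-algebra $A$. Let $L$ and $M$ be full left $\Lambda$-lattices in a finitely generated left $A$-module $V$. Choose a maximal $R$-order $\Lambda'$ in $A$ containing $\Lambda$. Set $L'=\Lambda'L$ and $I=\{a\in A: \Lambda'a\Lambda'\subseteq \Lambda\}$. Let $\mu$ be the Möbius function of the poset (ordered by inclusion) of submodules of the finite left $\Lambda'/I$-module $L'/IL'$. Then $$\frac{\zeta_\Lambda(L,M;s)}{\zeta_{\Lambda'}(L';s)}=\sum_{\substack{X\le_\Lambda L\\ X\simeq M \\ IL'\subseteq \Lambda'X}}|L/X|^{-s}\,Q_{\Lambda'}(\Lambda' X/IL';s),$$ where, for $W=\Lambda'X/IL'$, $$Q_{\Lambda'}(W;s):=\sum_{U\leq_{\Lambda'} W}\mu(U,W)|W/U|^{-s}.$$ The outer sum is finite and each $Q_{\Lambda'}(W;s)$ belongs to $\mathbb{Z}[q^{-s}]$; hence the quotient $\zeta_\Lambda(L,M;s)/\zeta_{\Lambda'}(L';s)$ also belongs to $\mathbb{Z}[q^{-s}]$.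
   Context: An $R$-order in $A$ is an $R$-subalgebra of $A$ that is finitely generated as an $R$-module and spans $A$ over $K$. A full left $\Lambda$-lattice in $V$ is a finitely generated left $\Lambda$-submodule $L$ of $V$ with $KL=V$. $\Lambda'L$ denotes the $\Lambda'$-submodule of $V$ generated by $L$. The notation $X\le_\Lambda L$ means $X$ is a left $\Lambda$-submodule of $L$, and $X\simeq M$ means isomorphic as left $\Lambda$-modules. The Solomon zeta function and the partial Solomon zeta function are the elements of the formal power series ring $\mathbb{Z}\llbracket q^{-s}\rrbracket$ (with $q^{-s}$ regarded as a formal variable and $(q^n)^{-s}=(q^{-s})^n$) $$\zeta_\Lambda(L;s) = \sum_{X\le_\Lambda L} |L/X|^{-s}, \qquad \zeta_\Lambda(L, M;s) = \sum_{\substack{X\le_\Lambda L\\ X\simeq M}} |L/X|^{-s},$$ where the first sum runs over all finite-index $\Lambda$-submodules $X$ of $L$, and the second only over those $X$ isomorphic to $M$. The same definition applies to $\Lambda'$ and $L'$. The series $\zeta_{\Lambda'}(L';s)$ has constant term $1$, so the quotient is taken in $\mathbb{Z}\llbracket q^{-s}\rrbracket$. *)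

theory Defs
  imports
    "HOL-Library.Set_Algebras"
    "HOL-Computational_Algebra.Polynomial_FPS"
begin

section \<open>Submodules, quotients and indices\<close>

text \<open>
  Scalars are a set \<open>S\<close> acting through \<open>act\<close>.  No zero or negation is mentioned, so that the same
  predicate applies to a module (a subset of a type of class \<open>ab_group_add\<close>) and to a quotient
  module (a set of cosets, added by \<open>plus_set\<close>, whose zero is the trivial coset and not the
  zero of the type class).  Whenever some element of \<open>S\<close> acts as \<open>- 1\<close>, which is always so below,
  these are the usual submodules.
\<close>

definition is_submodule :: "'s set \<Rightarrow> ('s \<Rightarrow> 'b::plus \<Rightarrow> 'b) \<Rightarrow> 'b set \<Rightarrow> bool" where
  "is_submodule S act N \<longleftrightarrow>
     N \<noteq> {} \<and> (\<forall>x\<in>N. \<forall>y\<in>N. x + y \<in> N) \<and> (\<forall>s\<in>S. \<forall>x\<in>N. act s x \<in> N)"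

definition gen_submodule :: "'s set \<Rightarrow> ('s \<Rightarrow> 'b::plus \<Rightarrow> 'b) \<Rightarrow> 'b set \<Rightarrow> 'b set" where
  "gen_submodule S act X = is_submodule S act hull X"

definition fin_gen :: "'s set \<Rightarrow> ('s \<Rightarrow> 'b::plus \<Rightarrow> 'b) \<Rightarrow> 'b set \<Rightarrow> bool" where
  "fin_gen S act N \<longleftrightarrow> (\<exists>F. finite F \<and> gen_submodule S act F = N)"

definition is_add_subgroup :: "'b::ab_group_add set \<Rightarrow> bool" where
  "is_add_subgroup N \<longleftrightarrow> 0 \<in> N \<and> (\<forall>x\<in>N. \<forall>y\<in>N. x + y \<in> N) \<and> (\<forall>x\<in>N. - x \<in> N)"

definition ideal_mult :: "('a \<Rightarrow> 'v::ab_group_add \<Rightarrow> 'v) \<Rightarrow> 'a set \<Rightarrow> 'v set \<Rightarrow> 'v set" where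
  "ideal_mult act I N = is_add_subgroup hull {act a x |a x. a \<in> I \<and> x \<in> N}"

definition module_isomorphic :: "'s set \<Rightarrow> ('s \<Rightarrow> 'b::plus \<Rightarrow> 'b) \<Rightarrow> 'b set \<Rightarrow> 'b set \<Rightarrow> bool" where
  "module_isomorphic S act X Y \<longleftrightarrow>
     (\<exists>f. bij_betw f X Y \<and> (\<forall>x\<in>X. \<forall>y\<in>X. f (x + y) = f x + f y) \<and>
          (\<forall>s\<in>S. \<forall>x\<in>X. f (act s x) = act s (f x)))"

definition quot_set :: "'b::plus set \<Rightarrow> 'b set \<Rightarrow> 'b set set" where
  "quot_set N N0 = (\<lambda>x. x +o N0) ` N"

definition quot_index :: "'b::plus set \<Rightarrow> 'b set \<Rightarrow> nat" where
  "quot_index N N0 = card (quot_set N N0)"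

text \<open>
  Action on cosets of \<open>N\<close>: if \<open>A = a + I\<close> with \<open>I\<close> mapping the ambient module into \<open>N\<close>, then
  \<open>coset_act act N A (x + N) = act a x + N\<close>.  With \<open>A = {a}\<close> this is the action of the scalar
  \<open>a\<close> itself.
\<close>

definition coset_act :: "('a \<Rightarrow> 'v::plus \<Rightarrow> 'v) \<Rightarrow> 'v set \<Rightarrow> 'a set \<Rightarrow> 'v set \<Rightarrow> 'v set" where
  "coset_act act N A X = {act a x + n |a x n. a \<in> A \<and> x \<in> X \<and> n \<in> N}"


section \<open>Nonarchimedean local fields\<close>

text \<open>
  A field complete for a discrete (nontrivial) nonarchimedean absolute value, with finite
  residue field.
\<close>

definition val_ring :: "('k::field \<Rightarrow> real) \<Rightarrow> 'k set" where
  "val_ring av = {x. av x \<le> 1}"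

definition val_ideal :: "('k::field \<Rightarrow> real) \<Rightarrow> 'k set" where
  "val_ideal av = {x. av x < 1}"

definition residue_card :: "('k::field \<Rightarrow> real) \<Rightarrow> nat" where
  "residue_card av = quot_index (val_ring av) (val_ideal av)"

locale nonarch_local_field =
  fixes av :: "'k::field \<Rightarrow> real"
  assumes av_nonneg: "av x \<ge> 0"
    and av_eq_0_iff: "av x = 0 \<longleftrightarrow> x = 0"
    and av_mult: "av (x * y) = av x * av y"
    and av_ultrametric: "av (x + y) \<le> max (av x) (av y)"
    and av_discrete: "\<exists>p. 0 < av p \<and> av p < 1 \<and> (\<forall>x. x \<noteq> 0 \<longrightarrow> (\<exists>n::int. av x = av p powi n))"
    and av_complete:
      "(\<forall>e>0. \<exists>N. \<forall>m\<ge>N. \<forall>n\<ge>N. av (X m - X n) < e) \<Longrightarrow> \<exists>l. (\<lambda>n. av (X n - l)) \<longlonglongrightarrow> 0"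
    and finite_residue_field: "finite (quot_set (val_ring av) (val_ideal av))"


section \<open>Semisimple algebras, their modules, orders and lattices\<close>

definition semisimple_ring :: "'a::ring_1 itself \<Rightarrow> bool" where
  "semisimple_ring _ \<longleftrightarrow>
     (\<forall>J::'a set. is_submodule UNIV (*) J \<longrightarrow>
        (\<exists>J'. is_submodule UNIV (*) J' \<and> J \<inter> J' = {0} \<and> J + J' = UNIV))"

locale fd_semisimple_algebra = vector_space scale
  for scale :: "'k::field \<Rightarrow> 'a::ring_1 \<Rightarrow> 'a" +
  assumes scale_mult_left: "scale c x * y = scale c (x * y)"
    and scale_mult_right: "x * scale c y = scale c (x * y)"
    and finite_dim: "\<exists>B. finite_dimensional_vector_space scale B"
    and semisimple: "semisimple_ring TYPE('a)"

locale fg_left_module =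
  fixes act :: "'a::ring_1 \<Rightarrow> 'v::ab_group_add \<Rightarrow> 'v"
  assumes act_add_left: "act (a + b) x = act a x + act b x"
    and act_add_right: "act a (x + y) = act a x + act a y"
    and act_mult: "act (a * b) x = act a (act b x)"
    and act_one: "act 1 x = x"
    and finitely_generated: "fin_gen UNIV act UNIV"

definition is_order :: "'k::field set \<Rightarrow> ('k \<Rightarrow> 'a::ring_1 \<Rightarrow> 'a) \<Rightarrow> 'a set \<Rightarrow> bool" where
  "is_order R scale \<Lambda> \<longleftrightarrow>
     1 \<in> \<Lambda> \<and> (\<forall>x\<in>\<Lambda>. \<forall>y\<in>\<Lambda>. x * y \<in> \<Lambda>) \<and> is_submodule R scale \<Lambda> \<and>
     fin_gen R scale \<Lambda> \<and> gen_submodule UNIV scale \<Lambda> = UNIV"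

definition is_maximal_order :: "'k::field set \<Rightarrow> ('k \<Rightarrow> 'a::ring_1 \<Rightarrow> 'a) \<Rightarrow> 'a set \<Rightarrow> bool" where
  "is_maximal_order R scale \<Lambda> \<longleftrightarrow>
     is_order R scale \<Lambda> \<and> (\<forall>\<Gamma>. is_order R scale \<Gamma> \<and> \<Lambda> \<subseteq> \<Gamma> \<longrightarrow> \<Gamma> = \<Lambda>)"

text \<open>The base field acts on the module through \<open>c \<mapsto> scale c 1\<close>.\<close>

definition is_full_lattice ::
  "('k::field \<Rightarrow> 'a::ring_1 \<Rightarrow> 'a) \<Rightarrow> ('a \<Rightarrow> 'v::ab_group_add \<Rightarrow> 'v) \<Rightarrow> 'a set \<Rightarrow> 'v set \<Rightarrow> bool" where
  "is_full_lattice scale act \<Lambda> L \<longleftrightarrow>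
     is_submodule \<Lambda> act L \<and> fin_gen \<Lambda> act L \<and>
     gen_submodule UNIV (\<lambda>c. act (scale c 1)) L = UNIV"


section \<open>Zeta functions as formal power series\<close>

text \<open>The variable \<open>fps_X\<close> stands for \<open>q\<^sup>-\<^sup>s\<close>.\<close>

definition norm_term :: "nat \<Rightarrow> nat \<Rightarrow> int fps" where
  \<comment> \<open>\<open>N\<^sup>-\<^sup>s\<close>, meaningful only for \<open>N\<close> a power of \<open>q\<close>\<close>
  "norm_term q N = fps_X ^ (THE n. N = q ^ n)"

text \<open>
  Collecting equal terms, the coefficient of \<open>(q\<^sup>-\<^sup>s)\<^sup>n\<close> in the sum of \<open>|L/X|\<^sup>-\<^sup>s\<close> is
  the number of \<open>X\<close> of index \<open>q\<^sup>n\<close>.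
\<close>

definition solomon_zeta ::
  "nat \<Rightarrow> ('a \<Rightarrow> 'v::ab_group_add \<Rightarrow> 'v) \<Rightarrow> 'a set \<Rightarrow> 'v set \<Rightarrow> int fps" where
  "solomon_zeta q act \<Lambda> L = Abs_fps (\<lambda>n. int (card
     {X. is_submodule \<Lambda> act X \<and> X \<subseteq> L \<and> finite (quot_set L X) \<and> quot_index L X = q ^ n}))"

definition partial_solomon_zeta ::
  "nat \<Rightarrow> ('a \<Rightarrow> 'v::ab_group_add \<Rightarrow> 'v) \<Rightarrow> 'a set \<Rightarrow> 'v set \<Rightarrow> 'v set \<Rightarrow> int fps" where
  "partial_solomon_zeta q act \<Lambda> L M = Abs_fps (\<lambda>n. int (card
     {X. is_submodule \<Lambda> act X \<and> X \<subseteq> L \<and> finite (quot_set L X) \<and> quot_index L X = q ^ n \<and>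
         module_isomorphic \<Lambda> act X M}))"

text \<open>
  Quotient by a series with constant term \<open>1\<close>.  The library's \<open>/\<close> on power series needs an
  inverse on the coefficients, which \<open>int\<close> does not have; the second argument of
  \<open>fps_right_inverse\<close> is the constant term of the inverse.
\<close>

definition fps_quotient :: "int fps \<Rightarrow> int fps \<Rightarrow> int fps" where
  "fps_quotient f g = f * fps_right_inverse g 1"


section \<open>The Moebius function and the polynomials Q\<close>

function moebius :: "'b::order set \<Rightarrow> 'b \<Rightarrow> 'b \<Rightarrow> int" where
  "moebius P x y =
     (if finite P \<and> x \<in> P \<and> y \<in> P \<and> x \<le> y
      then if x = y then 1 else - (\<Sum>z\<in>{z\<in>P. x \<le> z \<and> z < y}. moebius P x z)
      else 0)"
  by auto
termination
proof (relation "measure (\<lambda>(P, x, y). card {z\<in>P. z < y})", goal_cases)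
  case (2 P x y z)
  then have "{w\<in>P. w < z} \<subset> {w\<in>P. w < y}" by fastforce
  with 2 show ?case by (simp add: psubset_card_mono)
qed simp

declare moebius.simps [simp del]

definition quot_submodules ::
  "('a::ring_1 \<Rightarrow> 'v::ab_group_add \<Rightarrow> 'v) \<Rightarrow> 'a set \<Rightarrow> 'a set \<Rightarrow> 'v set \<Rightarrow> 'v set set set" where
  \<comment> \<open>the \<open>\<Lambda>'/I\<close>-submodules of \<open>L'/IL'\<close>\<close>
  "quot_submodules act \<Lambda>' I L' =
     {U. U \<subseteq> quot_set L' (ideal_mult act I L') \<and>
         is_submodule (quot_set \<Lambda>' I) (coset_act act (ideal_mult act I L')) U}"

definition Q_poly ::
  "nat \<Rightarrow> ('a::ring_1 \<Rightarrow> 'v::ab_group_add \<Rightarrow> 'v) \<Rightarrow> 'a set \<Rightarrow> 'a set \<Rightarrow> 'v set \<Rightarrow> 'v set set \<Rightarrow> int fps" where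
  "Q_poly q act \<Lambda>' I L' W =
     (\<Sum>U | U \<subseteq> W \<and> is_submodule \<Lambda>' (\<lambda>a. coset_act act (ideal_mult act I L') {a}) U.
        fps_const (moebius (quot_submodules act \<Lambda>' I L') U W) * norm_term q (quot_index W U))"

end

(*
  Every full lattice over the maximal order is a direct sum of lattices cyclic over the maximal order,
  because the sublattices of a simple module form a chain.  If Y + J = N for full lattices, this gives
  an isomorphism from N to Y that is the identity modulo J.  Taking J = I L', which lies in L, such
  isomorphisms match the X' isomorphic to M with \<Lambda>' X' = Y with the X isomorphic to M with
  \<Lambda>' X = Y + I L'.  So the partial zeta function is a sum over the X with I L' inside \<Lambda>' X
  of the generating functions of the Y with Y + I L' = \<Lambda>' X.  Moebius inversion over the
  lattices between I L' and \<Lambda>' X, all of which have the zeta function of L', expresses each of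
  these as Q times the zeta function of L'.
*)
theory Submission
  imports Defs
begin

section \<open>Index arithmetic for subgroups of an abelian group\<close>

section \<open>Cosets and indices\<close>

text \<open>An isomorphism from Y + J to Y is of use only if it respects L, which is why it has to
  be the identity modulo J, a subset of L. An abstract isomorphism of lattices gives no such
  control; the map is therefore built one maximal sublattice at a time, each step altering a single
  cyclic summand by a right multiplication. The chain property rests on an absolute value on the
  division ring e A e of a primitive idempotent e. It is defined as the inverse module index,
  1/[Ge : Gd] for d. Multiplicativity is then immediate; boundedness of the unit ball comes from
  compactness of the order G, and the ultrametric inequality only from maximality. Maximality enters
  through one principle: a bounded set S for which every product s a s', with a in G, lies in S G is
  contained in G. Finiteness is controlled throughout by powers of the uniformizer, a power of which
  multiplies the maximal order into the conductor.\<close>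

lemma add_subgroup_zero: "is_add_subgroup N \<Longrightarrow> 0 \<in> N"
  and add_subgroup_add: "is_add_subgroup N \<Longrightarrow> x \<in> N \<Longrightarrow> y \<in> N \<Longrightarrow> x + y \<in> N"
  and add_subgroup_minus: "is_add_subgroup N \<Longrightarrow> x \<in> N \<Longrightarrow> - x \<in> N"
  by (auto simp: is_add_subgroup_def)

lemma add_subgroup_diff: "is_add_subgroup N \<Longrightarrow> x \<in> N \<Longrightarrow> y \<in> N \<Longrightarrow> x - y \<in> N"
  using add_subgroup_add[of N x "- y"] add_subgroup_minus[of N y] by simp

lemma mem_coset_iff: "x \<in> y +o (N :: 'b::ab_group_add set) \<longleftrightarrow> x - y \<in> N"
  by (simp add: set_minus_plus)

lemma coset_eq_iff:
  assumes "is_add_subgroup N"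
  shows "x +o N = y +o N \<longleftrightarrow> x - y \<in> N"
proof
  assume "x +o N = y +o N"
  moreover have "x \<in> x +o N"
    by (simp add: mem_coset_iff add_subgroup_zero[OF assms])
  ultimately show "x - y \<in> N"
    by (simp add: mem_coset_iff)
next
  assume *: "x - y \<in> N"
  have "z - x \<in> N \<longleftrightarrow> z - y \<in> N" for z
    using add_subgroup_add[OF assms _ *, of "z - x"] add_subgroup_diff[OF assms _ *, of "z - y"]
    by auto
  then show "x +o N = y +o N"
    by (auto simp: mem_coset_iff)
qed

lemma Union_quot_set:
  assumes "is_add_subgroup N" "is_add_subgroup N0" "N0 \<subseteq> N"
  shows "\<Union>(quot_set N N0) = N"
proof -
  have "y \<in> N" if "x \<in> N" "y - x \<in> N0" for x y
    using add_subgroup_add[OF assms(1) that(1), of "y - x"] that assms(3) by auto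
  moreover have "x \<in> x +o N0" for x
    by (simp add: mem_coset_iff add_subgroup_zero[OF assms(2)])
  ultimately show ?thesis
    unfolding quot_set_def using mem_coset_iff by blast
qed

lemma finite_quot_set_iff:
  assumes "is_add_subgroup N0"
  shows "finite (quot_set N N0) \<longleftrightarrow> (\<exists>Q. finite Q \<and> Q \<subseteq> N \<and> (\<forall>x\<in>N. \<exists>y\<in>Q. x - y \<in> N0))"
proof
  assume "finite (quot_set N N0)"
  then obtain Q where "finite Q" "Q \<subseteq> N" "quot_set N N0 = (\<lambda>x. x +o N0) ` Q"
    unfolding quot_set_def by (metis finite_subset_image order_refl)
  then show "\<exists>Q. finite Q \<and> Q \<subseteq> N \<and> (\<forall>x\<in>N. \<exists>y\<in>Q. x - y \<in> N0)"
  proof (intro exI[of _ Q] conjI ballI)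
    fix x assume "x \<in> N"
    then have "x +o N0 \<in> (\<lambda>x. x +o N0) ` Q"
      using \<open>quot_set N N0 = _\<close> by (auto simp: quot_set_def)
    then show "\<exists>y\<in>Q. x - y \<in> N0"
      using coset_eq_iff[OF assms] by blast
  qed
next
  assume "\<exists>Q. finite Q \<and> Q \<subseteq> N \<and> (\<forall>x\<in>N. \<exists>y\<in>Q. x - y \<in> N0)"
  then obtain Q where Q: "finite Q" "Q \<subseteq> N" "\<forall>x\<in>N. \<exists>y\<in>Q. x - y \<in> N0" by blast
  then have "quot_set N N0 \<subseteq> (\<lambda>x. x +o N0) ` Q"
    using coset_eq_iff[OF assms] unfolding quot_set_def by blast
  then show "finite (quot_set N N0)"
    using Q(1) finite_surj by blast
qed

text \<open>A transversal of \<open>N\<close> modulo \<open>N1\<close> splits a coset of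
  \<open>N0\<close> into a pair. A bijection, instead of a product of cardinalities, serves for
  finiteness as well as for the index.\<close>

lemma quot_set_tower_bij:
  assumes N: "is_add_subgroup N" and N1: "is_add_subgroup N1" and N0: "is_add_subgroup N0"
    and sub: "N0 \<subseteq> N1" "N1 \<subseteq> N"
  shows "\<exists>f. bij_betw f (quot_set N N1 \<times> quot_set N1 N0) (quot_set N N0)"
proof -
  define rep where "rep C = (SOME x. x \<in> C)" for C :: "'a set"
  have rep: "rep C \<in> C" if "C \<in> quot_set N N1" for C
    using that add_subgroup_zero[OF N1] unfolding rep_def quot_set_def
    by (metis (no_types, lifting) diff_self imageE mem_coset_iff someI)
  have repN: "rep C \<in> N" if "C \<in> quot_set N N1" for C
    using rep[OF that] Union_quot_set[OF N N1 sub(2)] that by blast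
  have C_eq: "C = rep C +o N1" if "C \<in> quot_set N N1" for C
    using rep[OF that] that coset_eq_iff[OF N1] unfolding quot_set_def
    by (metis (no_types, lifting) imageE mem_coset_iff)
  define f where "f = (\<lambda>(C, D). rep C +o D)"
  have "inj_on f (quot_set N N1 \<times> quot_set N1 N0)"
  proof (rule inj_onI, clarify)
    fix C D C' D'
    assume C: "C \<in> quot_set N N1" "C' \<in> quot_set N N1"
      and D: "D \<in> quot_set N1 N0" "D' \<in> quot_set N1 N0" and eq: "f (C, D) = f (C', D')"
    obtain d d' where d: "d \<in> N1" "d' \<in> N1" "D = d +o N0" "D' = d' +o N0"
      using D unfolding quot_set_def by blast
    have "rep C + d - (rep C' + d') \<in> N0"
      using eq d by (simp add: f_def set_plus_rearrange2 coset_eq_iff[OF N0])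
    then have "rep C + d - (rep C' + d') - d + d' \<in> N1"
      using sub d N1 by (meson add_subgroup_add add_subgroup_diff subsetD)
    then have "rep C - rep C' \<in> N1"
      by (simp add: algebra_simps)
    then have CC: "C = C'"
      using C_eq[OF C(1)] C_eq[OF C(2)] coset_eq_iff[OF N1] by metis
    with \<open>rep C + d - (rep C' + d') \<in> N0\<close> have "d - d' \<in> N0" by simp
    then show "C = C' \<and> D = D'"
      using CC d coset_eq_iff[OF N0] by simp
  qed
  moreover have "f ` (quot_set N N1 \<times> quot_set N1 N0) = quot_set N N0"
  proof (intro equalityI subsetI)
    fix E assume "E \<in> f ` (quot_set N N1 \<times> quot_set N1 N0)"
    then obtain C d where "C \<in> quot_set N N1" "d \<in> N1" "E = rep C +o (d +o N0)"
      by (auto simp: f_def quot_set_def)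
    then show "E \<in> quot_set N N0"
      using repN sub add_subgroup_add[OF N, of "rep C" d]
      by (auto simp: quot_set_def set_plus_rearrange2)
  next
    fix E assume "E \<in> quot_set N N0"
    then obtain x where x: "x \<in> N" "E = x +o N0" by (auto simp: quot_set_def)
    define C where "C = x +o N1"
    have C: "C \<in> quot_set N N1" using x by (auto simp: C_def quot_set_def)
    have "x \<in> C"
      by (simp add: C_def mem_coset_iff add_subgroup_zero[OF N1])
    then have "x - rep C \<in> N1"
      using C_eq[OF C] mem_coset_iff by metis
    then have "(C, (x - rep C) +o N0) \<in> quot_set N N1 \<times> quot_set N1 N0"
      using C by (auto simp: quot_set_def)
    moreover have "E = f (C, (x - rep C) +o N0)"
      using x by (simp add: f_def set_plus_rearrange2)
    ultimately show "E \<in> f ` (quot_set N N1 \<times> quot_set N1 N0)" by blast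
  qed
  ultimately show ?thesis unfolding bij_betw_def by blast
qed

lemma quot_set_nonempty: "is_add_subgroup N \<Longrightarrow> quot_set N N0 \<noteq> {}"
  unfolding quot_set_def using add_subgroup_zero by blast

lemma finite_quot_set_tower:
  assumes "is_add_subgroup N" "is_add_subgroup N1" "is_add_subgroup N0" "N0 \<subseteq> N1" "N1 \<subseteq> N"
  shows "finite (quot_set N N0) \<longleftrightarrow> finite (quot_set N N1) \<and> finite (quot_set N1 N0)"
proof -
  obtain f where "bij_betw f (quot_set N N1 \<times> quot_set N1 N0) (quot_set N N0)"
    using quot_set_tower_bij[OF assms] by blast
  from bij_betw_finite[OF this] show ?thesis
    using quot_set_nonempty[OF assms(1), of N1] quot_set_nonempty[OF assms(2), of N0]
    by (auto simp: finite_cartesian_product_iff)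
qed

text \<open>Infinite quotients fit in because \<open>card\<close> gives them 0: the large quotient
  is infinite exactly when one of the two factors is.\<close>

lemma quot_index_tower:
  assumes "is_add_subgroup N" "is_add_subgroup N1" "is_add_subgroup N0" "N0 \<subseteq> N1" "N1 \<subseteq> N"
  shows "quot_index N N0 = quot_index N N1 * quot_index N1 N0"
proof -
  obtain f where "bij_betw f (quot_set N N1 \<times> quot_set N1 N0) (quot_set N N0)"
    using quot_set_tower_bij[OF assms] by blast
  from bij_betw_same_card[OF this] show ?thesis
    by (simp add: quot_index_def card_cartesian_product)
qed

lemma quot_set_image_bij:
  assumes add: "\<And>x y. x \<in> N \<Longrightarrow> y \<in> N \<Longrightarrow> f (x + y) = f x + f y" and inj: "inj_on f N"
    and N: "is_add_subgroup N" "N0 \<subseteq> N"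
  shows "bij_betw (image f) (quot_set N N0) (quot_set (f ` N) (f ` N0))"
proof -
  have im: "f ` (x +o N0) = f x +o f ` N0" if "x \<in> N" for x
    unfolding elt_set_plus_def using add that N(2) by (auto simp: image_def) (metis subsetD)+
  have sub: "x +o N0 \<subseteq> N" if "x \<in> N" for x
    using that N add_subgroup_add[OF N(1)] by (auto simp: elt_set_plus_def)
  have "inj_on (image f) (quot_set N N0)"
    using inj sub by (auto simp: quot_set_def inj_on_image_eq_iff intro!: inj_onI)
  moreover have "image f ` quot_set N N0 = quot_set (f ` N) (f ` N0)"
    using im by (auto simp: quot_set_def image_iff)
  ultimately show ?thesis by (simp add: bij_betw_def)
qed

lemma finite_quot_set_image:
  assumes "\<And>x y. x \<in> N \<Longrightarrow> y \<in> N \<Longrightarrow> f (x + y) = f x + f y" "inj_on f N"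
    and "is_add_subgroup N" "N0 \<subseteq> N"
  shows "finite (quot_set (f ` N) (f ` N0)) \<longleftrightarrow> finite (quot_set N N0)"
  using bij_betw_finite[OF quot_set_image_bij[of N f N0]] assms by blast

lemma quot_index_image:
  assumes "\<And>x y. x \<in> N \<Longrightarrow> y \<in> N \<Longrightarrow> f (x + y) = f x + f y" "inj_on f N"
    and "is_add_subgroup N" "N0 \<subseteq> N"
  shows "quot_index (f ` N) (f ` N0) = quot_index N N0"
  using bij_betw_same_card[OF quot_set_image_bij[of N f N0]] assms by (simp add: quot_index_def)

lemma quot_set_self:
  assumes "is_add_subgroup N"
  shows "quot_set N N = {N}"
proof -
  have "x +o N = N" if "x \<in> N" for x
    using coset_eq_iff[OF assms, of x 0] that by simp
  then show ?thesis
    using add_subgroup_zero[OF assms] unfolding quot_set_def by fastforce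
qed

lemma quot_index_self: "is_add_subgroup N \<Longrightarrow> quot_index N N = 1"
  by (simp add: quot_index_def quot_set_self)

lemma quot_index_eq_1_iff:
  assumes "is_add_subgroup N" "is_add_subgroup N0" "N0 \<subseteq> N"
  shows "quot_index N N0 = 1 \<longleftrightarrow> N = N0"
proof
  assume "quot_index N N0 = 1"
  then obtain C where C: "quot_set N N0 = {C}"
    by (auto simp: quot_index_def card_1_singleton_iff)
  have "x \<in> N0" if "x \<in> N" for x
  proof -
    have "x +o N0 = 0 +o N0"
      using that C add_subgroup_zero[OF assms(1)] unfolding quot_set_def by blast
    then show ?thesis using coset_eq_iff[OF assms(2), of x 0] by simp
  qed
  then show "N = N0" using assms(3) by blast
qed (use assms quot_index_self in simp)

lemma quot_index_pos:
  "is_add_subgroup N \<Longrightarrow> finite (quot_set N N0) \<Longrightarrow> 0 < quot_index N N0"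
  using quot_set_nonempty[of N N0] by (simp add: quot_index_def card_gt_0_iff)

section \<open>Submodules and finite generation over a subring\<close>

section \<open>Modules over subrings\<close>

locale left_module =
  fixes act :: "'a::ring_1 \<Rightarrow> 'v::ab_group_add \<Rightarrow> 'v"
  assumes act_add_left: "act (a + b) x = act a x + act b x"
    and act_add_right: "act a (x + y) = act a x + act a y"
    and act_mult: "act (a * b) x = act a (act b x)"
    and act_one [simp]: "act 1 x = x"
begin

lemma act_zero_left [simp]: "act 0 x = 0"
  using act_add_left[of 0 0 x] by simp

lemma act_zero_right [simp]: "act a 0 = 0"
  using act_add_right[of a 0 0] by simp

lemma act_minus_left: "act (- a) x = - act a x"
  using act_add_left[of "- a" a x] by (simp add: eq_neg_iff_add_eq_0)

lemma act_minus_right: "act a (- x) = - act a x"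
  using act_add_right[of a "- x" x] by (simp add: eq_neg_iff_add_eq_0)

lemma act_diff_left: "act (a - b) x = act a x - act b x"
  using act_add_left[of a "- b" x] by (simp add: act_minus_left)

lemma act_diff_right: "act a (x - y) = act a x - act a y"
  using act_add_right[of a x "- y"] by (simp add: act_minus_right)

end

sublocale fg_left_module \<subseteq> left_module act
  by unfold_locales (fact act_add_left act_add_right act_mult act_one)+

locale subring_module = left_module act
  for act :: "'a::ring_1 \<Rightarrow> 'v::ab_group_add \<Rightarrow> 'v" +
  fixes S :: "'a set"
  assumes one_closed: "1 \<in> S"
    and add_closed: "a \<in> S \<Longrightarrow> b \<in> S \<Longrightarrow> a + b \<in> S"
    and mult_closed: "a \<in> S \<Longrightarrow> b \<in> S \<Longrightarrow> a * b \<in> S"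
    and minus_closed: "a \<in> S \<Longrightarrow> - a \<in> S"
begin

abbreviation sm :: "'v set \<Rightarrow> bool" where "sm \<equiv> is_submodule S act"

abbreviation gen :: "'v set \<Rightarrow> 'v set" where "gen \<equiv> gen_submodule S act"

lemma zero_closed: "0 \<in> S"
  using add_closed[OF one_closed minus_closed[OF one_closed]] by simp

lemma sm_subgroup:
  assumes "sm N"
  shows "is_add_subgroup N"
proof -
  obtain x where x: "x \<in> N" using assms by (auto simp: is_submodule_def)
  then have "act 0 x \<in> N" using assms zero_closed by (auto simp: is_submodule_def)
  moreover have "- y \<in> N" if "y \<in> N" for y
    using assms that minus_closed[OF one_closed] act_minus_left[of 1 y]
    by (auto simp: is_submodule_def) (metis act_one)
  ultimately show ?thesis using assms by (simp add: is_submodule_def is_add_subgroup_def)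
qed

lemma sm_zero: "sm N \<Longrightarrow> 0 \<in> N"
  and sm_add: "sm N \<Longrightarrow> x \<in> N \<Longrightarrow> y \<in> N \<Longrightarrow> x + y \<in> N"
  and sm_minus: "sm N \<Longrightarrow> x \<in> N \<Longrightarrow> - x \<in> N"
  and sm_diff: "sm N \<Longrightarrow> x \<in> N \<Longrightarrow> y \<in> N \<Longrightarrow> x - y \<in> N"
  using sm_subgroup add_subgroup_zero add_subgroup_add add_subgroup_minus add_subgroup_diff
  by metis+

lemma sm_act: "sm N \<Longrightarrow> a \<in> S \<Longrightarrow> x \<in> N \<Longrightarrow> act a x \<in> N"
  by (simp add: is_submodule_def)

lemma smI:
  assumes "0 \<in> N" "\<And>x y. x \<in> N \<Longrightarrow> y \<in> N \<Longrightarrow> x + y \<in> N"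
    "\<And>a x. a \<in> S \<Longrightarrow> x \<in> N \<Longrightarrow> act a x \<in> N"
  shows "sm N"
  using assms by (auto simp: is_submodule_def)

lemma sm_singleton_zero: "sm {0}"
  by (rule smI) auto

lemma sm_Int: "sm N \<Longrightarrow> sm N' \<Longrightarrow> sm (N \<inter> N')"
  by (rule smI) (auto simp: sm_zero sm_add sm_act)

lemma sm_gen: "sm (gen X)"
  unfolding gen_submodule_def
proof (rule hull_in)
  fix T assume "Ball T sm"
  then show "sm (\<Inter>T)"
    by (intro smI) (auto simp: sm_zero sm_add sm_act)
qed

lemma gen_inc: "X \<subseteq> gen X"
  unfolding gen_submodule_def by (rule hull_subset)

lemma gen_minimal: "X \<subseteq> N \<Longrightarrow> sm N \<Longrightarrow> gen X \<subseteq> N"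
  unfolding gen_submodule_def by (rule hull_minimal)

lemma gen_empty: "gen {} = {0}"
  using gen_minimal[OF _ sm_singleton_zero, of "{}"] sm_zero[OF sm_gen] by auto

lemma sm_sum:
  assumes "sm N" "sm N'"
  shows "sm {x + y |x y. x \<in> N \<and> y \<in> N'}"
proof (rule smI)
  show "0 \<in> {x + y |x y. x \<in> N \<and> y \<in> N'}"
    using sm_zero[OF assms(1)] sm_zero[OF assms(2)] add.right_neutral[of 0] by force
next
  fix u v assume "u \<in> {x + y |x y. x \<in> N \<and> y \<in> N'}" "v \<in> {x + y |x y. x \<in> N \<and> y \<in> N'}"
  then obtain x y x' y' where "u = x + y" "v = x' + y'" "x \<in> N" "x' \<in> N" "y \<in> N'" "y' \<in> N'"
    by blast
  then have "u + v = (x + x') + (y + y')" "x + x' \<in> N" "y + y' \<in> N'"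
    using sm_add assms by (auto simp: algebra_simps)
  then show "u + v \<in> {x + y |x y. x \<in> N \<and> y \<in> N'}" by blast
next
  fix a u assume "a \<in> S" "u \<in> {x + y |x y. x \<in> N \<and> y \<in> N'}"
  then show "act a u \<in> {x + y |x y. x \<in> N \<and> y \<in> N'}"
    using sm_act assms act_add_right by blast
qed

lemma sm_cyclic: "sm ((\<lambda>a. act a x) ` S)"
proof (rule smI)
  show "0 \<in> (\<lambda>a. act a x) ` S" using zero_closed act_zero_left by (metis imageI)
next
  fix u v assume "u \<in> (\<lambda>a. act a x) ` S" "v \<in> (\<lambda>a. act a x) ` S"
  then show "u + v \<in> (\<lambda>a. act a x) ` S"
    by (auto simp: add_closed image_iff act_add_left[symmetric])
next
  fix a u assume "a \<in> S" "u \<in> (\<lambda>a. act a x) ` S"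
  then show "act a u \<in> (\<lambda>a. act a x) ` S"
    by (auto simp: mult_closed image_iff act_mult[symmetric])
qed

lemma gen_insert: "gen (insert x F) = {act a x + y |a y. a \<in> S \<and> y \<in> gen F}"
proof (intro equalityI)
  have eq: "{act a x + y |a y. a \<in> S \<and> y \<in> gen F} =
      {u + y |u y. u \<in> (\<lambda>a. act a x) ` S \<and> y \<in> gen F}"
    by blast
  have "x \<in> {act a x + y |a y. a \<in> S \<and> y \<in> gen F}"
    using one_closed sm_zero[OF sm_gen, of F] act_one[of x] add.right_neutral[of x]
    by (intro CollectI exI[of _ 1] exI[of _ 0]) simp
  moreover have "F \<subseteq> {act a x + y |a y. a \<in> S \<and> y \<in> gen F}"
  proof
    fix y assume "y \<in> F"
    then show "y \<in> {act a x + y |a y. a \<in> S \<and> y \<in> gen F}"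
      using zero_closed gen_inc[of F] by (intro CollectI exI[of _ 0] exI[of _ y]) auto
  qed
  ultimately show "gen (insert x F) \<subseteq> {act a x + y |a y. a \<in> S \<and> y \<in> gen F}"
    using sm_sum[OF sm_cyclic sm_gen] unfolding eq by (intro gen_minimal) auto
next
  have "gen F \<subseteq> gen (insert x F)"
    using gen_inc[of "insert x F"] by (intro gen_minimal sm_gen) auto
  moreover have "x \<in> gen (insert x F)"
    using gen_inc by blast
  ultimately show "{act a x + y |a y. a \<in> S \<and> y \<in> gen F} \<subseteq> gen (insert x F)"
    using sm_add[OF sm_gen] sm_act[OF sm_gen] by blast
qed

lemma gen_singleton: "gen {x} = (\<lambda>a. act a x) ` S"
  by (auto simp: gen_insert gen_empty)

lemma fin_gen_sm: "fin_gen S act N \<Longrightarrow> sm N"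
  unfolding fin_gen_def using sm_gen by blast

text \<open>Induction on generators: modulo \<open>act t\<close>, a vector
  \<open>act a x + y\<close> depends only on the class of \<open>a\<close> modulo t S and the class
  of \<open>y\<close>, so finitely many sums \<open>act b x + q\<close> represent everything. It is
  used with the uniformizer acting on an order over \<open>R\<close> and on a lattice over an
  order.\<close>

lemma fin_gen_quotient_finite:
  assumes comm: "\<And>a x. a \<in> S \<Longrightarrow> act t (act a x) = act a (act t x)"
    and fin: "finite (quot_set S ((*) t ` S))" and t: "t \<in> S" "\<And>a. a \<in> S \<Longrightarrow> t * a = a * t"
    and "fin_gen S act N"
  shows "finite (quot_set N (act t ` N))"
proof -
  have sub: "is_add_subgroup (act t ` N)" if "sm N" for N
  proof -
    have "act t x + act t y \<in> act t ` N" if "x \<in> N" "y \<in> N" for x y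
      using sm_add[OF \<open>sm N\<close> that] by (metis act_add_right imageI)
    moreover have "- act t x \<in> act t ` N" if "x \<in> N" for x
      using sm_minus[OF \<open>sm N\<close> that] by (metis act_minus_right imageI)
    ultimately show ?thesis
      using sm_zero[OF \<open>sm N\<close>] by (auto simp: is_add_subgroup_def image_iff intro: bexI[of _ 0])
  qed
  have "is_add_subgroup ((*) t ` S)"
  proof -
    have "t * x + t * y \<in> (*) t ` S" if "x \<in> S" "y \<in> S" for x y
      using add_closed[OF that] by (metis distrib_left imageI)
    moreover have "- (t * x) \<in> (*) t ` S" if "x \<in> S" for x
      using minus_closed[OF that] by (metis mult_minus_right imageI)
    ultimately show ?thesis
      using zero_closed by (auto simp: is_add_subgroup_def image_iff intro: bexI[of _ 0])
  qed
  with fin obtain P where P: "finite P" "P \<subseteq> S" "\<And>a. a \<in> S \<Longrightarrow> \<exists>b\<in>P. a - b \<in> (*) t ` S"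
    using finite_quot_set_iff by meson
  obtain F where "finite F" "N = gen F"
    using assms(5) by (auto simp: fin_gen_def)
  from \<open>finite F\<close> have "\<exists>Q. finite Q \<and> Q \<subseteq> gen F \<and> (\<forall>x\<in>gen F. \<exists>y\<in>Q. x - y \<in> act t ` gen F)"
  proof (induction F)
    case empty
    then show ?case by (auto simp: gen_empty)
  next
    case (insert x F)
    then obtain Q where Q: "finite Q" "Q \<subseteq> gen F" "\<And>y. y \<in> gen F \<Longrightarrow> \<exists>q\<in>Q. y - q \<in> act t ` gen F"
      by blast
    define Q' where "Q' = (\<lambda>(b, q). act b x + q) ` (P \<times> Q)"
    have "\<exists>y\<in>Q'. z - y \<in> act t ` gen (insert x F)" if z: "z \<in> gen (insert x F)" for z
    proof -
      obtain a y where ay: "a \<in> S" "y \<in> gen F" "z = act a x + y"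
        using z by (auto simp: gen_insert)
      obtain b c where b: "b \<in> P" "c \<in> S" "a - b = t * c" using P(3)[OF ay(1)] by blast
      obtain q y' where q: "q \<in> Q" "y' \<in> gen F" "y - q = act t y'" using Q(3)[OF ay(2)] by blast
      have "z - (act b x + q) = act (a - b) x + (y - q)"
        by (simp add: ay act_diff_left)
      also have "\<dots> = act t (act c x + y')"
        using b q by (simp add: act_mult act_add_right)
      finally show ?thesis
        using b q by (force simp: Q'_def gen_insert)
    qed
    moreover have "finite Q'" "Q' \<subseteq> gen (insert x F)"
      unfolding Q'_def gen_insert using P(1,2) Q(1,2) by auto
    ultimately show ?case by blast
  qed
  then show ?thesis
    using finite_quot_set_iff[OF sub[OF sm_gen]] \<open>N = gen F\<close> by simp
qed

text \<open>Generators of \<open>N0\<close> together with representatives of the finitely many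
  cosets generate \<open>N\<close>. This takes the place of noetherian arguments.\<close>

lemma gen_mono_ext:
  assumes "sm N" "sm N0" "N0 \<subseteq> N" "fin_gen S act N0" "finite (quot_set N N0)"
  shows "fin_gen S act N"
proof -
  obtain F where F: "finite F" "gen F = N0" using assms(4) by (auto simp: fin_gen_def)
  obtain Q where Q: "finite Q" "Q \<subseteq> N" "\<And>x. x \<in> N \<Longrightarrow> \<exists>y\<in>Q. x - y \<in> N0"
    using assms(5) finite_quot_set_iff[OF sm_subgroup[OF assms(2)]] by meson
  have FN: "F \<subseteq> N0" using gen_inc F by blast
  have "gen (F \<union> Q) = N"
  proof
    show "gen (F \<union> Q) \<subseteq> N" using FN Q(2) assms by (intro gen_minimal) auto
    have "N0 \<subseteq> gen (F \<union> Q)"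
      using gen_inc[of "F \<union> Q"] F(2) by (auto intro: gen_minimal[OF _ sm_gen, THEN subsetD])
    show "N \<subseteq> gen (F \<union> Q)"
    proof
      fix x assume "x \<in> N"
      then obtain y where "y \<in> Q" "x - y \<in> N0" using Q(3) by blast
      then have "y \<in> gen (F \<union> Q)" "x - y \<in> gen (F \<union> Q)"
        using gen_inc[of "F \<union> Q"] \<open>N0 \<subseteq> gen (F \<union> Q)\<close> by auto
      then show "x \<in> gen (F \<union> Q)" using sm_add[OF sm_gen] by fastforce
    qed
  qed
  then show ?thesis using F(1) Q(1) by (auto simp: fin_gen_def)
qed

end

section \<open>Uniformizer, residue field and convergence in the valuation ring\<close>

section \<open>Local fields\<close>

context nonarch_local_field
begin

text \<open>A uniformizer, written p in the comments that follow.\<close>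

definition unif :: 'k where
  "unif = (SOME p. 0 < av p \<and> av p < 1 \<and> (\<forall>x. x \<noteq> 0 \<longrightarrow> (\<exists>n::int. av x = av p powi n)))"

lemma unif_pos: "0 < av unif"
  and unif_less_1: "av unif < 1"
  and av_eq_unif_power: "x \<noteq> 0 \<Longrightarrow> \<exists>n::int. av x = av unif powi n"
  using someI_ex[OF av_discrete] unfolding unif_def[symmetric] by auto

lemma unif_nonzero [simp]: "unif \<noteq> 0"
  using unif_pos av_eq_0_iff[of unif] by auto

lemma av_0 [simp]: "av 0 = 0"
  by (simp add: av_eq_0_iff)

lemma av_1 [simp]: "av 1 = 1"
  using av_mult[of 1 1] av_eq_0_iff[of 1] by simp

lemma av_minus [simp]: "av (- x) = av x"
proof -
  have "av (- 1) * av (- 1) = 1"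
    using av_mult[of "- 1" "- 1"] by simp
  then have "av (- 1) = 1"
    using av_nonneg[of "- 1"] by (metis abs_of_nonneg real_sqrt_abs2 real_sqrt_one)
  then show ?thesis using av_mult[of "- 1" x] by simp
qed

lemma av_diff: "av (x - y) \<le> max (av x) (av y)"
  using av_ultrametric[of x "- y"] by simp

lemma av_inverse: "av (inverse x) = inverse (av x)"
proof (cases "x = 0")
  case False
  then have "av x * av (inverse x) = 1"
    by (metis av_1 av_mult right_inverse)
  then show ?thesis by (metis inverse_unique)
qed simp

lemma av_power: "av (x ^ n) = av x ^ n"
  by (induction n) (simp_all add: av_mult)

lemma av_powi: "av (x powi n) = av x powi n"
  by (cases n) (simp_all add: power_int_minus power_int_def av_power av_inverse)

abbreviation R :: "'k set" where "R \<equiv> val_ring av"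

lemma R_one: "1 \<in> R"
  and R_zero: "0 \<in> R"
  and R_add: "x \<in> R \<Longrightarrow> y \<in> R \<Longrightarrow> x + y \<in> R"
  and R_minus: "x \<in> R \<Longrightarrow> - x \<in> R"
  by (auto simp: val_ring_def intro: order_trans[OF av_ultrametric])

lemma R_mult: "x \<in> R \<Longrightarrow> y \<in> R \<Longrightarrow> x * y \<in> R"
  using av_nonneg by (auto simp: val_ring_def av_mult mult_le_one)

lemma R_unit: "av x = 1 \<Longrightarrow> x \<in> R \<and> inverse x \<in> R"
  by (simp add: val_ring_def av_inverse)

lemma unif_powi_in_R: "0 \<le> k \<Longrightarrow> unif powi k \<in> R"
  using unif_pos unif_less_1 by (simp add: val_ring_def av_powi power_int_le_one)

lemma powi_unif_le_iff: "av unif powi m \<le> av unif powi n \<longleftrightarrow> n \<le> m"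
  using power_int_decreasing[of n m "av unif"] power_int_strict_decreasing[of m n "av unif"]
    unif_pos unif_less_1 by (auto simp: not_le[symmetric])

lemma unif_powi_mult_in_R_iff:
  "unif powi k * c \<in> R \<longleftrightarrow> av c \<le> av unif powi (- k)"
  using unif_pos by (simp add: val_ring_def av_mult av_powi power_int_minus field_simps)

lemma R_absorb: "\<exists>k\<ge>0. unif powi k * c \<in> R"
proof (cases "c = 0")
  case True
  then show ?thesis using R_zero by auto
next
  case False
  then obtain n where n: "av c = av unif powi n" using av_eq_unif_power by blast
  then show ?thesis
    by (intro exI[of _ "max 0 (- n)"]) (auto simp: unif_powi_mult_in_R_iff powi_unif_le_iff)
qed

text \<open>Discreteness leaves a gap below 1: a nonzero element of absolute value less than 1 has a
  positive power of p as its absolute value, so dividing it by p stays in \<open>R\<close>.\<close>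

lemma val_ideal_eq: "val_ideal av = (*) unif ` R"
proof (intro equalityI subsetI)
  fix x assume x: "x \<in> val_ideal av"
  have "av (x / unif) \<le> 1"
  proof (cases "x = 0")
    case False
    then obtain n where n: "av x = av unif powi n" using av_eq_unif_power by blast
    with x have "\<not> av unif powi 0 \<le> av unif powi n" by (simp add: val_ideal_def)
    then have "1 \<le> n" unfolding powi_unif_le_iff by simp
    then have "av unif powi n \<le> av unif powi 1" unfolding powi_unif_le_iff .
    then show ?thesis using unif_pos unfolding divide_inverse av_mult av_inverse n
      by (simp add: field_simps)
  qed simp
  then show "x \<in> (*) unif ` R"
    by (intro image_eqI[of _ _ "x / unif"]) (auto simp: val_ring_def)
next
  fix x assume "x \<in> (*) unif ` R"
  then obtain y where "x = unif * y" "av y \<le> 1" by (auto simp: val_ring_def)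
  moreover have "av unif * av y \<le> av unif"
    using \<open>av y \<le> 1\<close> unif_pos by (intro mult_left_le) auto
  ultimately show "x \<in> val_ideal av"
    using unif_less_1 by (simp add: val_ideal_def av_mult)
qed

lemma val_ideal_subgroup: "is_add_subgroup (val_ideal av)"
  by (auto simp: is_add_subgroup_def val_ideal_def intro: le_less_trans[OF av_ultrametric])

lemma residue_card_ge_2: "2 \<le> residue_card av"
proof -
  have "1 +o val_ideal av \<noteq> 0 +o val_ideal av"
    using coset_eq_iff[OF val_ideal_subgroup, of 1 0] by (simp add: val_ideal_def)
  moreover have "{0 +o val_ideal av, 1 +o val_ideal av} \<subseteq> quot_set R (val_ideal av)"
    using R_zero R_one unfolding quot_set_def by blast
  then have "card {0 +o val_ideal av, 1 +o val_ideal av} \<le> residue_card av"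
    unfolding residue_card_def quot_index_def by (intro card_mono finite_residue_field)
  ultimately show ?thesis by simp
qed

text \<open>Partial sums are Cauchy by the ultrametric inequality. The limit is described
  algebraically, by remainders divisible by p^n in \<open>R\<close>, so that orders can be treated
  without a metric.\<close>

lemma R_series_converges:
  assumes "\<And>k. s k \<in> R"
  shows "\<exists>l\<in>R. \<forall>n. \<exists>h\<in>R. l - (\<Sum>k<n. unif ^ k * s k) = unif ^ n * h"
proof -
  define X where "X n = (\<Sum>k<n. unif ^ k * s k)" for n
  have step: "av (X (n + d) - X n) \<le> av unif ^ n" for n d
  proof (induction d)
    case 0
    then show ?case using unif_pos by simp
  next
    case (Suc d)
    have "av (unif ^ (n + d) * s (n + d)) = av unif ^ (n + d) * av (s (n + d))"
      by (simp add: av_mult av_power)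
    also have "\<dots> \<le> av unif ^ (n + d)"
      using assms[of "n + d"] unif_pos by (simp add: val_ring_def mult_left_le)
    also have "\<dots> \<le> av unif ^ n"
      using unif_pos unif_less_1 by (intro power_decreasing) auto
    finally have le: "av (unif ^ (n + d) * s (n + d)) \<le> av unif ^ n" .
    have eq: "X (n + Suc d) - X n = (X (n + d) - X n) + unif ^ (n + d) * s (n + d)"
      by (simp add: X_def)
    show ?case
      unfolding eq by (rule order_trans[OF av_ultrametric max.boundedI[OF Suc le]])
  qed
  have sym: "av (x - y) = av (y - x)" for x y using av_minus[of "x - y"] by simp
  have dist: "av (X m - X n) \<le> av unif ^ N" if "N \<le> m" "N \<le> n" for m n N
  proof -
    have "av (X m - X N) \<le> av unif ^ N" "av (X n - X N) \<le> av unif ^ N"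
      using step[of N "m - N"] step[of N "n - N"] that by auto
    then show ?thesis using av_diff[of "X m - X N" "X n - X N"] by simp
  qed
  have "\<exists>l. (\<lambda>n. av (X n - l)) \<longlonglongrightarrow> 0"
  proof (rule av_complete, intro allI impI)
    fix e :: real assume "e > 0"
    then obtain N where "av unif ^ N < e"
      using unif_less_1 real_arch_pow_inv by blast
    then show "\<exists>N. \<forall>m\<ge>N. \<forall>n\<ge>N. av (X m - X n) < e"
      using dist by (meson le_less_trans)
  qed
  then obtain l where l: "(\<lambda>n. av (X n - l)) \<longlonglongrightarrow> 0" by blast
  have close: "av (l - X n) \<le> av unif ^ n" for n
  proof -
    have "0 < av unif ^ n" using unif_pos by simp
    from order_tendstoD(2)[OF l this] obtain m where m: "n \<le> m" "av (X m - l) < av unif ^ n"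
      unfolding eventually_sequentially by (meson linear order_refl)
    then show ?thesis
      using av_diff[of "X m - X n" "X m - l"] dist[of n m n] by simp
  qed
  have "\<exists>h\<in>R. l - X n = unif ^ n * h" for n
  proof
    show "l - X n = unif ^ n * ((l - X n) / unif ^ n)" by simp
    show "(l - X n) / unif ^ n \<in> R"
      using close[of n] unif_pos
      unfolding val_ring_def mem_Collect_eq divide_inverse av_mult av_inverse av_power
      by (simp add: field_simps)
  qed
  moreover have "l \<in> R" using close[of 0] by (simp add: X_def val_ring_def)
  ultimately show ?thesis unfolding X_def by blast
qed

end

section \<open>Orders as complete, separated and compact modules over the valuation ring\<close>

section \<open>Orders over the valuation ring\<close>

sublocale fd_semisimple_algebra \<subseteq> scalars: left_module scale
  by unfold_locales (simp_all add: scale_left_distrib scale_right_distrib)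

locale local_algebra = nonarch_local_field av + fd_semisimple_algebra scale
  for av :: "'k::field \<Rightarrow> real" and scale :: "'k \<Rightarrow> 'a::ring_1 \<Rightarrow> 'a"

sublocale local_algebra \<subseteq> Rmod: subring_module scale R
  by unfold_locales (simp_all add: R_one R_add R_mult R_minus)

context local_algebra
begin

text \<open>Scaling by p^k with an integer exponent, hence invertible. The condition
  \<open>sh k x \<in> G\<close> says that x lies in p^(-k) G; boundedness and p-adic closeness are
  both expressed in this way.\<close>

definition sh :: "int \<Rightarrow> 'a \<Rightarrow> 'a" where "sh k x = scale (unif powi k) x"

lemma sh_0 [simp]: "sh 0 x = x"
  and sh_sh [simp]: "sh k (sh l x) = sh (k + l) x"
  and sh_zero [simp]: "sh k 0 = 0"
  and sh_add: "sh k (x + y) = sh k x + sh k y"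
  and sh_minus: "sh k (- x) = - sh k x"
  and sh_diff: "sh k (x - y) = sh k x - sh k y"
  and sh_eq_0_iff [simp]: "sh k x = 0 \<longleftrightarrow> x = 0"
  and sh_mult_left: "sh k x * y = sh k (x * y)"
  and sh_mult_right: "x * sh k y = sh k (x * y)"
  by (auto simp: sh_def scale_right_distrib scale_right_diff_distrib scale_mult_left
      scale_mult_right power_int_add)

lemma sh_inj: "sh k x = sh k y \<longleftrightarrow> x = y"
  by (metis sh_0 sh_sh add.left_inverse)

lemma scale_eq_mult: "scale c 1 * x = scale c x"
  by (simp add: scale_mult_left)

end

locale local_order = local_algebra av scale
  for av :: "'k::field \<Rightarrow> real" and scale :: "'k \<Rightarrow> 'a::ring_1 \<Rightarrow> 'a" +
  fixes G :: "'a set"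
  assumes order: "is_order R scale G"
begin

lemma G_Rmod: "Rmod.sm G"
  and G_fin_gen: "fin_gen R scale G"
  and G_one: "1 \<in> G"
  and G_mult: "x \<in> G \<Longrightarrow> y \<in> G \<Longrightarrow> x * y \<in> G"
  using order by (auto simp: is_order_def)

lemma G_zero: "0 \<in> G"
  and G_add: "x \<in> G \<Longrightarrow> y \<in> G \<Longrightarrow> x + y \<in> G"
  and G_minus: "x \<in> G \<Longrightarrow> - x \<in> G"
  and G_diff: "x \<in> G \<Longrightarrow> y \<in> G \<Longrightarrow> x - y \<in> G"
  using G_Rmod Rmod.sm_zero Rmod.sm_add Rmod.sm_minus Rmod.sm_diff by blast+

lemma G_scale: "c \<in> R \<Longrightarrow> x \<in> G \<Longrightarrow> scale c x \<in> G"
  using G_Rmod Rmod.sm_act by blast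

lemma G_sh: "0 \<le> k \<Longrightarrow> x \<in> G \<Longrightarrow> sh k x \<in> G"
  unfolding sh_def by (intro G_scale unif_powi_in_R)

lemma G_sh_mono:
  assumes "sh k x \<in> G" "k \<le> l"
  shows "sh l x \<in> G"
  using G_sh[OF _ assms(1), of "l - k"] assms(2) by simp

lemma G_power: "x \<in> G \<Longrightarrow> x ^ n \<in> G"
  by (induction n) (auto intro: G_one G_mult)

text \<open>Denominators can be cleared: the elements that some power of p moves into
  \<open>G\<close> form a subspace containing \<open>G\<close>, and \<open>G\<close> spans the
  algebra.\<close>

lemma G_absorb: "\<exists>k\<ge>0. sh k a \<in> G"
proof -
  have "a \<in> gen_submodule UNIV scale G" using order by (simp add: is_order_def)
  then show ?thesis unfolding gen_submodule_def
  proof (rule hull_induct)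
    show "\<exists>k\<ge>0. sh k x \<in> G" if "x \<in> G" for x using that by (intro exI[of _ 0]) simp
    show "is_submodule UNIV scale {x. \<exists>k\<ge>0. sh k x \<in> G}"
      unfolding is_submodule_def
    proof (intro conjI ballI)
      show "{x. \<exists>k\<ge>0. sh k x \<in> G} \<noteq> {}" using G_zero by (metis (mono_tags, lifting) CollectI empty_iff order_refl sh_0)
      fix x assume "x \<in> {x. \<exists>k\<ge>0. sh k x \<in> G}"
      then obtain k where k: "0 \<le> k" "sh k x \<in> G" by blast
      show "x + y \<in> {x. \<exists>k\<ge>0. sh k x \<in> G}" if "y \<in> {x. \<exists>k\<ge>0. sh k x \<in> G}" for y
      proof -
        from that obtain l where l: "0 \<le> l" "sh l y \<in> G" unfolding mem_Collect_eq by (elim exE conjE)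
        have "sh (max k l) x \<in> G" "sh (max k l) y \<in> G"
          using G_sh_mono[OF k(2) max.cobounded1] G_sh_mono[OF l(2) max.cobounded2] .
        then have "sh (max k l) (x + y) \<in> G" by (simp add: sh_add G_add)
        then show ?thesis using k(1)
          by (intro CollectI exI[of _ "max k l"] conjI) (rule max.coboundedI1)
      qed
      show "scale c x \<in> {x. \<exists>k\<ge>0. sh k x \<in> G}" for c
      proof -
        obtain l where l: "0 \<le> l" "unif powi l * c \<in> R" using R_absorb by blast
        have "sh (l + k) (scale c x) = scale (unif powi l * c) (sh k x)"
          by (simp add: sh_def power_int_add mult_ac)
        then have "sh (l + k) (scale c x) \<in> G" using l k G_scale by simp
        then show ?thesis using k l by (intro CollectI exI[of _ "l + k"]) auto
      qed
    qed
  qed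
qed

lemma sh_subgroup: "is_add_subgroup N \<Longrightarrow> is_add_subgroup (sh k ` N)"
  unfolding is_add_subgroup_def
  by (auto simp: sh_add[symmetric] sh_minus[symmetric] image_iff intro: bexI[of _ 0])

lemma G_subgroup: "is_add_subgroup G"
  using G_Rmod by (rule Rmod.sm_subgroup)

lemma finite_G_sh_1: "finite (quot_set G (sh 1 ` G))"
proof -
  have "finite (quot_set G (scale unif ` G))"
  proof (rule Rmod.fin_gen_quotient_finite[OF _ _ _ _ G_fin_gen])
    show "finite (quot_set R ((*) unif ` R))"
      using finite_residue_field by (simp add: val_ideal_eq)
    show "unif \<in> R" using unif_powi_in_R[of 1] by simp
  qed (simp_all add: mult_ac)
  then show ?thesis by (simp add: sh_def)
qed

text \<open>Coordinates with respect to finitely many generators, chosen arbitrarily for each term,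
  reduce a p-adic series in \<open>G\<close> to series in \<open>R\<close>.\<close>

lemma G_complete:
  assumes "\<And>k. s k \<in> G"
  shows "\<exists>l\<in>G. \<forall>n. \<exists>h\<in>G. l - (\<Sum>k<n. sh (int k) (s k)) = sh (int n) h"
proof -
  obtain F where F: "finite F" "Rmod.gen F = G" using G_fin_gen by (auto simp: fin_gen_def)
  from F(1) have "\<forall>s. (\<forall>k. s k \<in> Rmod.gen F) \<longrightarrow>
    (\<exists>l\<in>Rmod.gen F. \<forall>n. \<exists>h\<in>Rmod.gen F. l - (\<Sum>k<n. sh (int k) (s k)) = sh (int n) h)"
  proof (induction F)
    case empty
    then show ?case by (auto simp: Rmod.gen_empty)
  next
    case (insert x F)
    show ?case
    proof (intro allI impI)
      fix s :: "nat \<Rightarrow> 'a" assume "\<forall>k. s k \<in> Rmod.gen (insert x F)"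
      then have "\<forall>k. \<exists>a y. a \<in> R \<and> y \<in> Rmod.gen F \<and> s k = scale a x + y"
        unfolding Rmod.gen_insert by blast
      then obtain a y where ay: "\<And>k. a k \<in> R" "\<And>k. y k \<in> Rmod.gen F"
        "\<And>k. s k = scale (a k) x + y k"
        by metis
      obtain l where l: "l \<in> Rmod.gen F"
        "\<And>n. \<exists>h\<in>Rmod.gen F. l - (\<Sum>k<n. sh (int k) (y k)) = sh (int n) h"
        using insert.IH ay(2) by blast
      obtain c where c: "c \<in> R" "\<And>n. \<exists>h\<in>R. c - (\<Sum>k<n. unif ^ k * a k) = unif ^ n * h"
        using R_series_converges[of a] ay(1) by blast
      show "\<exists>l\<in>Rmod.gen (insert x F). \<forall>n. \<exists>h\<in>Rmod.gen (insert x F).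
          l - (\<Sum>k<n. sh (int k) (s k)) = sh (int n) h"
      proof (rule bexI[of _ "scale c x + l"], rule allI)
        fix n
        obtain h where h: "h \<in> Rmod.gen F" "l - (\<Sum>k<n. sh (int k) (y k)) = sh (int n) h"
          using l(2) by blast
        obtain b where b: "b \<in> R" "c - (\<Sum>k<n. unif ^ k * a k) = unif ^ n * b"
          using c(2) by blast
        have "(\<Sum>k<n. sh (int k) (s k)) =
            scale (\<Sum>k<n. unif ^ k * a k) x + (\<Sum>k<n. sh (int k) (y k))"
          by (simp add: ay(3) sh_add sum.distrib scale_sum_left sh_def scale_right_distrib)
        then have "scale c x + l - (\<Sum>k<n. sh (int k) (s k)) =
            scale (c - (\<Sum>k<n. unif ^ k * a k)) x + (l - (\<Sum>k<n. sh (int k) (y k)))"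
          by (simp add: scale_left_diff_distrib)
        also have "\<dots> = sh (int n) (scale b x + h)"
          unfolding b h(2) sh_add by (simp add: sh_def)
        finally show "\<exists>h\<in>Rmod.gen (insert x F).
            scale c x + l - (\<Sum>k<n. sh (int k) (s k)) = sh (int n) h"
          using b h by (auto simp: Rmod.gen_insert)
        show "scale c x + l \<in> Rmod.gen (insert x F)"
          using l(1) c(1) unfolding Rmod.gen_insert by blast
      qed
    qed
  qed
  then show ?thesis using assms unfolding F(2) by blast
qed

text \<open>A coordinate functional with value 1 at \<open>a\<close> is bounded on \<open>G\<close>,
  because it is bounded on finitely many generators; on the elements p^(-k) a it is
  unbounded.\<close>

lemma G_separated:
  assumes "\<And>k. 0 \<le> k \<Longrightarrow> sh (- k) a \<in> G"
  shows "a = 0"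
proof (rule ccontr)
  assume "a \<noteq> 0"
  then have ind: "independent {a}" by simp
  define B where "B = extend_basis {a}"
  have B: "independent B" "span B = UNIV" "a \<in> B"
    using independent_extend_basis[OF ind] span_extend_basis[OF ind] extend_basis_superset[OF ind]
    by (auto simp: B_def)
  define f where "f x = representation B x a" for x
  have f_add: "f (x + y) = f x + f y" for x y
    using B by (simp add: f_def representation_add)
  have f_scale: "f (scale c x) = c * f x" for c x
    using B by (simp add: f_def representation_scale)
  have f_a: "f a = 1"
    using B by (simp add: f_def representation_basis)
  obtain F where F: "finite F" "Rmod.gen F = G" using G_fin_gen by (auto simp: fin_gen_def)
  \<comment> \<open>Inserting 0 keeps \<open>C\<close> nonnegative and the maximum defined when
    \<open>F\<close> is empty.\<close>
  define C where "C = Max (insert 0 ((\<lambda>x. av (f x)) ` F))"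
  have "0 \<le> C" using F(1) by (simp add: C_def)
  have "Rmod.gen F \<subseteq> {x. av (f x) \<le> C}"
  proof (rule Rmod.gen_minimal)
    show "F \<subseteq> {x. av (f x) \<le> C}"
      using F(1) by (auto simp: C_def intro!: Max_ge)
    show "Rmod.sm {x. av (f x) \<le> C}"
    proof (rule Rmod.smI)
      show "0 \<in> {x. av (f x) \<le> C}" using f_scale[of 0 0] \<open>0 \<le> C\<close> by simp
      show "x + y \<in> {x. av (f x) \<le> C}" if "x \<in> {x. av (f x) \<le> C}" "y \<in> {x. av (f x) \<le> C}" for x y
        using that av_ultrametric[of "f x" "f y"] by (simp add: f_add)
      show "scale c x \<in> {x. av (f x) \<le> C}" if "c \<in> R" "x \<in> {x. av (f x) \<le> C}" for c x
        using that mult_left_le_one_le[of "av (f x)" "av c"] av_nonneg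
        by (simp add: f_scale av_mult val_ring_def)
    qed
  qed
  then have bound: "av (f (sh (- int k) a)) \<le> C" for k
    using assms[of "int k"] F(2) by auto
  obtain n where "av unif ^ n < inverse (C + 1)"
    using unif_less_1 real_arch_pow_inv[of "inverse (C + 1)"] \<open>0 \<le> C\<close> by auto
  then have "C + 1 < inverse (av unif ^ n)"
    using unif_pos \<open>0 \<le> C\<close> less_imp_inverse_less by fastforce
  moreover have "av (f (sh (- int n) a)) = inverse (av unif ^ n)"
    by (simp add: sh_def f_scale f_a power_int_minus av_inverse av_power)
  ultimately show False using bound[of n] by simp
qed

end

context local_order
begin

lemma mem_sh_image_iff: "x \<in> sh k ` N \<longleftrightarrow> sh (- k) x \<in> N"
  by (force simp: image_iff)

lemma sh_image_subset: "0 \<le> k \<Longrightarrow> sh k ` G \<subseteq> G"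
  using G_sh by blast

lemma finite_G_sh: "finite (quot_set G (sh (int n) ` G))"
proof (induction n)
  case 0
  then show ?case by (simp add: quot_set_self[OF G_subgroup])
next
  case (Suc n)
  have eq: "sh (int n) ` sh 1 ` G = sh (int (Suc n)) ` G"
    by (auto simp: image_image algebra_simps)
  have "finite (quot_set (sh (int n) ` G) (sh (int n) ` sh 1 ` G))"
    using finite_G_sh_1 sh_image_subset[of 1]
    by (subst finite_quot_set_image) (auto simp: sh_add sh_inj G_subgroup intro!: inj_onI)
  moreover have "sh (int (Suc n)) ` G \<subseteq> sh (int n) ` G"
    unfolding eq[symmetric] using sh_image_subset[of 1] by (intro image_mono) simp
  ultimately show ?case
    using Suc sh_image_subset[of "int n"]
    unfolding eq by (subst finite_quot_set_tower[of _ "sh (int n) ` G"])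
      (auto intro: sh_subgroup G_subgroup)
qed

text \<open>Absorption bounds the level of a nonzero element on one side and separatedness on the
  other; x is p^(-i) times an element of \<open>G\<close> outside p G.\<close>

lemma level_exists:
  assumes "x \<noteq> 0"
  shows "\<exists>i. sh i x \<in> G \<and> sh (i - 1) x \<notin> G"
proof -
  obtain k where k: "0 \<le> k" "sh k x \<in> G" using G_absorb by blast
  obtain l where l: "0 \<le> l" "sh (- l) x \<notin> G" using G_separated assms by blast
  define P where "P n \<longleftrightarrow> sh (int n - l) x \<in> G" for n
  have "P (nat (k + l))" using k l by (simp add: P_def)
  moreover have "\<not> P 0" using l by (simp add: P_def)
  ultimately obtain n where "\<not> P n" "P (Suc n)"
    using ex_least_nat_less[of P "nat (k + l)"] by blast
  then show ?thesis by (intro exI[of _ "int (Suc n) - l"]) (simp add: P_def)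
qed

text \<open>Compactness of pairs in \<open>G\<close>, from completeness and the finiteness of each G
  / p^n G. The conclusion provides a pair every neighbourhood of which contains witnesses of every
  \<open>P j\<close>; passing to the limit in \<open>P\<close> itself is left to the
  application.\<close>

lemma compactness:
  assumes ex: "\<And>j. \<exists>x\<in>G. \<exists>y\<in>G. P j x y"
    and anti: "\<And>j x y. P (Suc j) x y \<Longrightarrow> P j x y"
  shows "\<exists>x\<in>G. \<exists>y\<in>G. \<forall>n j. \<exists>x'\<in>G. \<exists>y'\<in>G.
    sh (- int n) (x' - x) \<in> G \<and> sh (- int n) (y' - y) \<in> G \<and> P j x' y'"
proof -
  have anti': "P j x y" if "P k x y" "j \<le> k" for j k x y
    using that(2,1) by (induction rule: dec_induct) (use anti in blast)+
  define near where "near n x x' \<longleftrightarrow> sh (- int n) (x' - x) \<in> G" for n x x'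
  have near_trans: "near n a c" if "near n a b" "near n b c" for n a b c
    using G_add[OF that[unfolded near_def]] by (simp add: near_def sh_add[symmetric])
  have near_sym: "near n b a" if "near n a b" for n a b
    using G_minus[OF that[unfolded near_def]] by (simp add: near_def sh_minus[symmetric])
  have near_Suc: "near n a b" if "near (Suc n) a b" for n a b
    using that unfolding near_def by (rule G_sh_mono) simp
  \<comment> \<open>A pair is good if its residue class modulo p^n still contains witnesses for all
    \<open>j\<close>.\<close>
  define good where "good n = (\<lambda>(x, y). x \<in> G \<and> y \<in> G \<and>
    (\<forall>j. \<exists>x'\<in>G. \<exists>y'\<in>G. near n x x' \<and> near n y y' \<and> P j x' y'))" for n
  define step where "step n = (\<lambda>(x, y) (x', y'). near n x x' \<and> near n y y')" for n
  have "\<exists>z. good 0 z"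
    using ex G_zero by (intro exI[of _ "(0, 0)"]) (auto simp: good_def near_def)
  moreover have "\<exists>z'. good (Suc n) z' \<and> step n z z'" if good: "good n z" for n z
  proof -
    obtain x y where z: "z = (x, y)" by (cases z)
    have "\<forall>j. \<exists>x'\<in>G. \<exists>y'\<in>G. near n x x' \<and> near n y y' \<and> P j x' y'"
      using good by (simp add: good_def z)
    then obtain xs ys where xy: "\<And>j. xs j \<in> G" "\<And>j. ys j \<in> G" "\<And>j. near n x (xs j)"
      "\<And>j. near n y (ys j)" "\<And>j. P j (xs j) (ys j)"
      by metis
    have "is_add_subgroup (sh (int (Suc n)) ` G)"
      by (intro sh_subgroup G_subgroup)
    from finite_G_sh[of "Suc n", unfolded finite_quot_set_iff[OF this]]
    obtain Q where Q: "finite Q" "\<And>x. x \<in> G \<Longrightarrow> \<exists>q\<in>Q. x - q \<in> sh (int (Suc n)) ` G" by blast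
    have "\<forall>x. \<exists>q. x \<in> G \<longrightarrow> q \<in> Q \<and> near (Suc n) q x"
      using Q(2) unfolding near_def mem_sh_image_iff by blast
    then obtain r where r: "\<And>x. x \<in> G \<Longrightarrow> r x \<in> Q \<and> near (Suc n) (r x) x" by metis
    \<comment> \<open>There are finitely many classes modulo p^(n+1), so one pair of classes occurs
      for infinitely many indices. Since \<open>P\<close> decreases with \<open>j\<close>, this pair
      contains witnesses for all \<open>j\<close>.\<close>
    have "finite (range (\<lambda>j. (r (xs j), r (ys j))))"
      by (rule finite_subset[of _ "Q \<times> Q"]) (use r xy Q(1) in auto)
    then obtain j0 where "infinite {j \<in> UNIV. (r (xs j), r (ys j)) = (r (xs j0), r (ys j0))}"
      using pigeonhole_infinite[of UNIV "\<lambda>j. (r (xs j), r (ys j))"] by auto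
    then have inf: "\<exists>j'\<ge>j. r (xs j') = r (xs j0) \<and> r (ys j') = r (ys j0)" for j
      by (auto simp: infinite_nat_iff_unbounded_le)
    have "\<exists>x'\<in>G. \<exists>y'\<in>G. near (Suc n) (xs j0) x' \<and> near (Suc n) (ys j0) y' \<and> P j x' y'" for j
    proof -
      obtain j' where j': "j \<le> j'" "r (xs j') = r (xs j0)" "r (ys j') = r (ys j0)"
        using inf by blast
      have "near (Suc n) (xs j0) (xs j')" "near (Suc n) (ys j0) (ys j')"
        using r[OF xy(1), of j'] r[OF xy(1), of j0] r[OF xy(2), of j'] r[OF xy(2), of j0] j'
        by (auto intro: near_trans near_sym)
      then show ?thesis using xy j' anti' by blast
    qed
    then show ?thesis
      using xy by (intro exI[of _ "(xs j0, ys j0)"]) (auto simp: good_def step_def z)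
  qed
  ultimately have "\<exists>f. \<forall>n. good n (f n) \<and> step n (f n) (f (Suc n))"
    by (rule dependent_nat_choice)
  then obtain f where f: "\<And>n. good n (f n)" "\<And>n. step n (f n) (f (Suc n))" by blast
  have limit: "\<exists>l\<in>G. \<forall>n. near n l (g n)"
    if g: "\<And>n. g n \<in> G" "\<And>n. near n (g n) (g (Suc n))" for g
  proof -
    \<comment> \<open>The increments, divided by p^k, are the coefficients of a convergent series
      whose partial sums telescope to \<open>g n - g 0\<close>.\<close>
    obtain l where l: "l \<in> G"
      "\<And>n. \<exists>h\<in>G. l - (\<Sum>k<n. sh (int k) (sh (- int k) (g (Suc k) - g k))) = sh (int n) h"
      using G_complete[of "\<lambda>k. sh (- int k) (g (Suc k) - g k)"] g(2) unfolding near_def by blast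
    have "near n (l + g 0) (g n)" for n
    proof -
      obtain h where "h \<in> G" "l - (g n - g 0) = sh (int n) h"
        using l(2)[of n] by (auto simp: sum_lessThan_telescope)
      then have "near n (g n) (l + g 0)" by (simp add: near_def algebra_simps)
      then show ?thesis by (rule near_sym)
    qed
    then show ?thesis using l(1) g(1) G_add by blast
  qed
  have fG: "fst (f n) \<in> G" "snd (f n) \<in> G" for n
    using f(1)[of n] unfolding good_def case_prod_beta by blast+
  have f_near: "near n (fst (f n)) (fst (f (Suc n)))" "near n (snd (f n)) (snd (f (Suc n)))" for n
    using f(2)[of n] unfolding step_def case_prod_beta by blast+
  obtain x where x: "x \<in> G" "\<And>n. near n x (fst (f n))"
    using limit[of "\<lambda>n. fst (f n)", OF fG(1) f_near(1)] by blast
  obtain y where y: "y \<in> G" "\<And>n. near n y (snd (f n))"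
    using limit[of "\<lambda>n. snd (f n)", OF fG(2) f_near(2)] by blast
  have "\<exists>x'\<in>G. \<exists>y'\<in>G. near n x x' \<and> near n y y' \<and> P j x' y'" for n j
  proof -
    obtain x' y' where "x' \<in> G" "y' \<in> G" "near n (fst (f n)) x'" "near n (snd (f n)) y'" "P j x' y'"
      using f(1)[of n] unfolding good_def case_prod_beta by blast
    then show ?thesis using x(2)[of n] y(2)[of n] near_trans by blast
  qed
  then show ?thesis using x(1) y(1) unfolding near_def by blast
qed

end

section \<open>The module index as absolute value on the division ring e A e\<close>

section \<open>Primitive idempotents and the absolute value on their division rings\<close>

text \<open>An idempotent for which A e is a simple left ideal: every nonzero element of A e
  generates \<open>e\<close>.\<close>

definition prim :: "'a::ring_1 \<Rightarrow> bool" where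
  "prim e \<longleftrightarrow> e * e = e \<and> e \<noteq> 0 \<and> (\<forall>a. a * e \<noteq> 0 \<longrightarrow> (\<exists>a'. a' * (a * e) = e))"

locale primitive_idempotent = local_order +
  fixes e :: 'b
  assumes prim: "prim e"
begin

lemma idem: "e * e = e"
  and e_nonzero: "e \<noteq> 0"
  and prim_inverse: "a * e \<noteq> 0 \<Longrightarrow> \<exists>a'. a' * (a * e) = e"
  using prim by (auto simp: prim_def)

definition D :: "'b set" where "D = {d. e * d = d \<and> d * e = d}"

lemma D_left: "d \<in> D \<Longrightarrow> e * d = d"
  and D_right: "d \<in> D \<Longrightarrow> d * e = d"
  and e_D: "e \<in> D"
  and D_mult: "c \<in> D \<Longrightarrow> d \<in> D \<Longrightarrow> c * d \<in> D"
  and D_sh: "d \<in> D \<Longrightarrow> sh k d \<in> D"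
  and D_corner: "e * a * e \<in> D"
  by (auto simp: D_def idem sh_mult_left sh_mult_right mult.assoc)
    (metis idem mult.assoc)+

text \<open>Simplicity of A e gives left inverses, which multiplication by \<open>e\<close> on both
  sides moves into the corner. Since every nonzero element has one, they are two-sided.\<close>

lemma D_inverse:
  assumes "d \<in> D" "d \<noteq> 0"
  shows "\<exists>d'\<in>D. d' \<noteq> 0 \<and> d' * d = e \<and> d * d' = e"
proof -
  have left: "\<exists>d'\<in>D. d' * d = e" if "d \<in> D" "d \<noteq> 0" for d
  proof -
    have "d * e \<noteq> 0" using that D_right by simp
    then obtain a where "a * (d * e) = e" using prim_inverse by blast
    then have "(e * a * e) * d = e"
      using that idem D_left D_right by (simp add: mult.assoc)
    then show ?thesis using D_corner by blast
  qed
  obtain d' where d': "d' \<in> D" "d' * d = e" using left assms by blast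
  then have "d' \<noteq> 0" using e_nonzero by auto
  then obtain d'' where d'': "d'' \<in> D" "d'' * d' = e" using left d' by blast
  have "d'' = d'' * (d' * d)" using d' d'' D_right by simp
  also have "\<dots> = d" using d'' assms D_left by (simp add: mult.assoc[symmetric])
  finally show ?thesis using d' d'' \<open>d' \<noteq> 0\<close> by blast
qed

lemma D_mult_nonzero: "c \<in> D \<Longrightarrow> d \<in> D \<Longrightarrow> c \<noteq> 0 \<Longrightarrow> d \<noteq> 0 \<Longrightarrow> c * d \<noteq> 0"
  using D_inverse[of c] D_left by (metis mult.assoc mult_zero_right)

lemma D_power: "d \<in> D \<Longrightarrow> d ^ Suc n \<in> D"
  by (induction n) (auto intro: D_mult)

text \<open>If the denominators of inverses were unbounded, scaled inverses would yield pairs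
  outside p G whose products are divisible by ever higher powers of p. By compactness there would be
  two nonzero elements of the division ring with product 0.\<close>

lemma unit_inverse_bounded:
  "\<exists>c::nat. \<forall>u\<in>D \<inter> G. sh (- 1) u \<notin> G \<longrightarrow> (\<exists>u'\<in>D \<inter> G. u' * u = sh (int c) e)"
proof (rule ccontr)
  assume neg: "\<not> ?thesis"
  \<comment> \<open>\<open>e\<close> is not assumed to lie in \<open>G\<close>; \<open>m\<close>
    clears its denominator.\<close>
  obtain m where m: "0 \<le> m" "sh m e \<in> G" using G_absorb by blast
  define P where "P j w u \<longleftrightarrow> w \<in> D \<and> u \<in> D \<and> sh (- 1) w \<notin> G \<and> sh (- 1) u \<notin> G \<and>
    sh (- int j) (w * u) \<in> G" for j w u
  have "\<exists>w\<in>G. \<exists>u\<in>G. P j w u" for j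
  proof -
    obtain u where u: "u \<in> D" "u \<in> G" "sh (- 1) u \<notin> G"
      "\<And>u'. u' \<in> D \<Longrightarrow> u' \<in> G \<Longrightarrow> u' * u \<noteq> sh (int (j + nat m)) e"
      using neg by blast
    have "u \<noteq> 0" using u G_zero by auto
    then obtain u' where u': "u' \<in> D" "u' \<noteq> 0" "u' * u = e" using D_inverse u by blast
    obtain i where i: "sh i u' \<in> G" "sh (i - 1) u' \<notin> G" using level_exists u'(2) by blast
    \<comment> \<open>An exponent \<open>i\<close> this small would give \<open>u\<close> an inverse
      of the kind excluded by its choice. So p^i e, the product of the pair, lies in p^j G.\<close>
    have "\<not> i \<le> int (j + nat m)"
    proof
      assume "i \<le> int (j + nat m)"
      from u(4)[OF D_sh[OF u'(1)] G_sh_mono[OF i(1) this]] show False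
        by (simp only: sh_mult_left u'(3) simp_thms)
    qed
    then have "sh (i - int j) e \<in> G" using G_sh_mono[OF m(2)] m(1) by simp
    then have "P j (sh i u') u"
      using u u' i D_sh by (simp add: P_def sh_mult_left)
    then show ?thesis using i(1) u(2) by blast
  qed
  moreover have "P j w u" if "P (Suc j) w u" for j w u
    using that G_sh_mono[of "- int (Suc j)" "w * u" "- int j"] by (simp add: P_def)
  ultimately obtain w u where wu: "w \<in> G" "u \<in> G"
    "\<And>n j. \<exists>w'\<in>G. \<exists>u'\<in>G. sh (- int n) (w' - w) \<in> G \<and> sh (- int n) (u' - u) \<in> G \<and> P j w' u'"
    using compactness[of P] by blast
  have vanish: "x = 0" if x: "\<And>n. sh (m - int n) x \<in> G" for x
  proof (rule G_separated)
    fix k :: int assume "0 \<le> k"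
    then show "sh (- k) x \<in> G" using x[of "nat (k + m)"] m(1) by simp
  qed
  \<comment> \<open>\<open>D\<close> is closed: the equations e x = x = x e pass to limits, as
    multiplication by \<open>e\<close> on either side costs at most a factor p^(-m).\<close>
  have limit_D: "x \<in> D" if x: "\<And>n. \<exists>x'\<in>D. sh (- int n) (x' - x) \<in> G" for x
  proof -
    have "sh (m - int n) (e * x - x) \<in> G \<and> sh (m - int n) (x * e - x) \<in> G" for n
    proof -
      obtain x' where x': "x' \<in> D" "sh (- int n) (x' - x) \<in> G" using x by blast
      have eq: "e * x - x = (x' - x) - e * (x' - x)" "x * e - x = (x' - x) - (x' - x) * e"
        using x' D_left D_right by (auto simp: algebra_simps)
      have "sh (m - int n) (x' - x) \<in> G" using G_sh[OF m(1) x'(2)] by simp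
      moreover have "sh (m - int n) (e * (x' - x)) \<in> G" "sh (m - int n) ((x' - x) * e) \<in> G"
        using G_mult[OF m(2) x'(2)] G_mult[OF x'(2) m(2)]
        by (simp_all add: sh_mult_left sh_mult_right add.commute)
      ultimately show ?thesis unfolding eq by (simp add: sh_diff G_diff)
    qed
    then have "e * x - x = 0" "x * e - x = 0" using vanish by blast+
    then show ?thesis by (simp add: D_def)
  qed
  have "w \<in> D" "u \<in> D"
    using wu(3) unfolding P_def by (meson limit_D)+
  have nonzero: "x \<noteq> 0" if "x' \<in> G" "sh (- 1) (x' - x) \<in> G" "sh (- 1) x' \<notin> G" for x x'
    using that by auto
  have "w \<noteq> 0" "u \<noteq> 0"
    using wu(3)[of 1 1] nonzero unfolding P_def by auto
  have "sh (m - int n) (w * u) \<in> G" for n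
  proof -
    obtain w' u' where *: "u' \<in> G" "sh (- int n) (w' - w) \<in> G" "sh (- int n) (u' - u) \<in> G"
      "sh (- int n) (w' * u') \<in> G"
      using wu(3)[of n n] unfolding P_def by blast
    have eq: "w * u = w' * u' - (w' - w) * u' - w * (u' - u)"
      by (simp add: algebra_simps)
    have "sh (- int n) (w * u) \<in> G"
      unfolding eq sh_diff[of _ _ "w * _"] sh_diff[of _ _ "_ * u'"]
      using * G_mult[OF *(2,1)] G_mult[OF wu(1) *(3)]
      by (intro G_diff) (simp_all add: sh_mult_left sh_mult_right)
    then show ?thesis using G_sh_mono m(1) by auto
  qed
  then have "w * u = 0" by (rule vanish)
  then show False
    using D_mult_nonzero \<open>w \<in> D\<close> \<open>u \<in> D\<close> \<open>w \<noteq> 0\<close> \<open>u \<noteq> 0\<close> by blast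
qed

definition cyc :: "'b \<Rightarrow> 'b set" where "cyc d = (\<lambda>a. a * d) ` G"

text \<open>The nonzero elements of \<open>D\<close> for which G d is a sublattice of G e, so that
  the index is meaningful.\<close>

definition ok :: "'b \<Rightarrow> bool" where "ok d \<longleftrightarrow> d \<in> D \<and> d \<noteq> 0 \<and> d \<in> cyc e"

definition idx :: "'b \<Rightarrow> nat" where "idx d = quot_index (cyc e) (cyc d)"

lemma cyc_subgroup: "is_add_subgroup (cyc d)"
  unfolding is_add_subgroup_def cyc_def
  using G_zero G_add G_minus by (auto simp: distrib_right[symmetric] image_iff
      intro: bexI[of _ 0] bexI[of _ "- _"])

lemma cyc_mono: "d \<in> cyc c \<Longrightarrow> cyc d \<subseteq> cyc c"
  by (auto simp: cyc_def mult.assoc[symmetric] intro: G_mult)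

lemma ok_if_G: "d \<in> D \<Longrightarrow> d \<in> G \<Longrightarrow> d \<noteq> 0 \<Longrightarrow> ok d"
  using D_right by (force simp: ok_def cyc_def)

lemma ok_e: "ok e"
  using G_one e_D e_nonzero by (force simp: ok_def cyc_def)

lemma ok_sh: "0 \<le> k \<Longrightarrow> ok d \<Longrightarrow> ok (sh k d)"
  using G_sh D_sh by (auto simp: ok_def cyc_def sh_mult_left[symmetric])

lemma ok_absorb:
  assumes "d \<in> D" "d \<noteq> 0"
  shows "\<exists>k\<ge>0. ok (sh k d)"
proof -
  obtain k where "0 \<le> k" "sh k d \<in> G" using G_absorb by blast
  then show ?thesis using ok_if_G D_sh assms by (intro exI[of _ k]) simp
qed

lemma cyc_image:
  assumes "d \<in> D"
  shows "(\<lambda>t. t * d) ` cyc c = cyc (c * d)"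
  by (auto simp: cyc_def image_image mult.assoc)

lemma ok_mult:
  assumes "ok c" "ok d"
  shows "ok (c * d)"
proof -
  have "c * d \<in> cyc d"
    using assms(1) cyc_image[of d e] assms(2) D_left by (auto simp: ok_def)
  then show ?thesis
    using assms cyc_mono[of d e] D_mult D_mult_nonzero by (auto simp: ok_def)
qed

text \<open>Right multiplication by \<open>d\<close> is injective and carries G e and G c to G d and
  G c d, so the index of G c d in G d equals that of G c in G e.\<close>

lemma idx_mult:
  assumes "ok c" "ok d"
  shows "idx (c * d) = idx c * idx d"
proof -
  have cD: "c \<in> D" "d \<in> D" and d0: "d \<noteq> 0" and sub: "cyc c \<subseteq> cyc e" "cyc d \<subseteq> cyc e"
    using assms cyc_mono by (auto simp: ok_def)
  have im: "(\<lambda>t. t * d) ` cyc e = cyc d" "(\<lambda>t. t * d) ` cyc c = cyc (c * d)"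
    using cyc_image[OF cD(2)] D_left cD by auto
  have inj: "inj_on (\<lambda>t. t * d) (cyc e)"
  proof (rule inj_onI)
    fix s t assume st: "s \<in> cyc e" "t \<in> cyc e" "s * d = t * d"
    obtain d' where "d * d' = e" using D_inverse cD(2) d0 by blast
    then have "s * e = t * e" using st(3) by (metis mult.assoc)
    then show "s = t" using st idem by (auto simp: cyc_def mult.assoc)
  qed
  have "quot_index (cyc d) (cyc (c * d)) = idx c"
    using quot_index_image[of "cyc e" "\<lambda>t. t * d" "cyc c"] inj sub cyc_subgroup
    by (simp add: im idx_def distrib_right)
  moreover have "cyc (c * d) \<subseteq> cyc d"
    using image_mono[OF sub(1), of "\<lambda>t. t * d"] im by simp
  ultimately show ?thesis
    using quot_index_tower[OF cyc_subgroup cyc_subgroup cyc_subgroup, of "c * d" d e] sub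
    by (simp add: idx_def mult.commute)
qed

text \<open>An inverse of \<open>d\<close>, cleared of its denominator by p^k, shows that G d
  contains p^k G e, which has finite index in G e.\<close>

lemma idx_pos:
  assumes "ok d"
  shows "0 < idx d"
proof -
  obtain d' where d': "d' \<in> D" "d' * d = e" using D_inverse assms by (auto simp: ok_def)
  obtain k where k: "0 \<le> k" "sh k d' \<in> G" using G_absorb by blast
  have sub: "sh k ` cyc e \<subseteq> cyc d"
  proof
    fix x assume "x \<in> sh k ` cyc e"
    then obtain a where a: "a \<in> G" "x = sh k (a * e)" by (auto simp: cyc_def)
    then have "x = (a * sh k d') * d"
      using d' by (simp add: sh_mult_left sh_mult_right mult.assoc)
    then show "x \<in> cyc d" using a k G_mult by (auto simp: cyc_def)
  qed
  have "finite (quot_set (cyc e) (sh k ` cyc e))"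
  proof -
    have "is_add_subgroup (sh k ` G)" by (intro sh_subgroup G_subgroup)
    from finite_G_sh[of "nat k"] k(1) finite_quot_set_iff[OF this]
    obtain Q where Q: "finite Q" "Q \<subseteq> G" "\<And>x. x \<in> G \<Longrightarrow> \<exists>q\<in>Q. x - q \<in> sh k ` G" by auto
    have "\<exists>q\<in>(\<lambda>q. q * e) ` Q. x - q \<in> sh k ` cyc e" if "x \<in> cyc e" for x
    proof -
      from that obtain a where a: "a \<in> G" "x = a * e" unfolding cyc_def by blast
      then obtain q b where "q \<in> Q" "b \<in> G" "a - q = sh k b" using Q(3) by blast
      then have "x - q * e = sh k (b * e)" using a by (metis left_diff_distrib sh_mult_left)
      then show ?thesis using \<open>q \<in> Q\<close> \<open>b \<in> G\<close> by (auto simp: cyc_def)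
    qed
    then show ?thesis
      unfolding finite_quot_set_iff[OF sh_subgroup[OF cyc_subgroup]]
      using Q(1,2) by (intro exI[of _ "(\<lambda>q. q * e) ` Q"]) (auto simp: cyc_def)
  qed
  moreover have "cyc d \<subseteq> cyc e" using assms cyc_mono by (auto simp: ok_def)
  ultimately have "finite (quot_set (cyc e) (cyc d))"
    using finite_quot_set_tower[OF cyc_subgroup cyc_subgroup sh_subgroup[OF cyc_subgroup] sub]
    by blast
  then show ?thesis unfolding idx_def using quot_index_pos cyc_subgroup by blast
qed

lemma idx_e: "idx e = 1"
  unfolding idx_def by (rule quot_index_self[OF cyc_subgroup])

text \<open>The inverse index 1/[Ge : Gd], extended to all of \<open>D\<close> by scaling
  \<open>d\<close> into the range of \<open>ok\<close> and correcting by the index of p^k e.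
  Multiplicativity is inherited from \<open>idx\<close>; the ultrametric inequality is obtained
  later, from maximality.\<close>

definition nrm :: "'b \<Rightarrow> real" where
  "nrm d = (if d = 0 then 0 else
     (let k = (SOME k. 0 \<le> k \<and> ok (sh k d)) in real (idx (sh k e)) / real (idx (sh k d))))"

lemma nrm_eq:
  assumes "d \<in> D" "d \<noteq> 0" "0 \<le> k" "ok (sh k d)"
  shows "nrm d = real (idx (sh k e)) / real (idx (sh k d))"
proof -
  define l where "l = (SOME k. 0 \<le> k \<and> ok (sh k d))"
  have l: "0 \<le> l" "ok (sh l d)"
    using someI_ex[OF ok_absorb[OF assms(1,2)]] by (auto simp: l_def)
  have "idx (sh k e) * idx (sh l d) = idx (sh l e) * idx (sh k d)"
    using idx_mult[OF ok_sh[OF assms(3) ok_e] l(2)] idx_mult[OF ok_sh[OF l(1) ok_e] assms(4)]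
      D_left[OF assms(1)]
    by (simp add: sh_mult_left sh_mult_right add.commute)
  then have "real (idx (sh k e)) * real (idx (sh l d)) = real (idx (sh l e)) * real (idx (sh k d))"
    by (metis of_nat_mult)
  then show ?thesis
    using idx_pos[OF assms(4)] idx_pos[OF l(2)] assms(2)
    by (simp add: nrm_def l_def[symmetric] Let_def field_simps)
qed

lemma nrm_0 [simp]: "nrm 0 = 0"
  by (simp add: nrm_def)

lemma nrm_pos:
  assumes "d \<in> D" "d \<noteq> 0"
  shows "0 < nrm d"
proof -
  obtain k where k: "0 \<le> k" "ok (sh k d)" using ok_absorb[OF assms] by blast
  then show ?thesis
    unfolding nrm_eq[OF assms k] using idx_pos[OF k(2)] idx_pos[OF ok_sh[OF k(1) ok_e]] by simp
qed

lemma nrm_mult: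
  assumes "c \<in> D" "d \<in> D"
  shows "nrm (c * d) = nrm c * nrm d"
proof (cases "c = 0 \<or> d = 0")
  case False
  then have nz: "c \<noteq> 0" "d \<noteq> 0" by auto
  obtain k where k: "0 \<le> k" "ok (sh k c)" using ok_absorb assms(1) nz by blast
  obtain l where l: "0 \<le> l" "ok (sh l d)" using ok_absorb assms(2) nz by blast
  have eq: "sh k c * sh l d = sh (k + l) (c * d)" "sh k e * sh l e = sh (k + l) e"
    by (simp_all add: sh_mult_left sh_mult_right idem add.commute)
  have "nrm (c * d) = real (idx (sh (k + l) e)) / real (idx (sh (k + l) (c * d)))"
    using nrm_eq[of "c * d" "k + l"] D_mult[OF assms] D_mult_nonzero[OF assms nz] k l
      ok_mult[OF k(2) l(2)] unfolding eq by simp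
  also have "\<dots> = nrm c * nrm d"
    unfolding nrm_eq[OF assms(1) nz(1) k] nrm_eq[OF assms(2) nz(2) l] eq[symmetric]
    using idx_mult[OF k(2) l(2)] idx_mult[OF ok_sh[OF k(1) ok_e] ok_sh[OF l(1) ok_e]] by simp
  finally show ?thesis .
qed auto

lemma nrm_ok: "ok d \<Longrightarrow> nrm d = 1 / real (idx d)"
  using nrm_eq[of d 0] by (simp add: ok_def idx_e)

lemma nrm_e: "nrm e = 1"
  by (simp add: nrm_ok ok_e idx_e)

lemma nrm_G_le_1:
  assumes "d \<in> D" "d \<in> G"
  shows "nrm d \<le> 1"
proof (cases "d = 0")
  case False
  then have "ok d" using ok_if_G assms by blast
  then show ?thesis using idx_pos[of d] by (simp add: nrm_ok)
qed simp

lemma nrm_power: "d \<in> D \<Longrightarrow> nrm (d ^ Suc n) = nrm d ^ Suc n"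
proof (induction n)
  case (Suc n)
  then show ?case using nrm_mult[OF Suc.prems D_power[OF Suc.prems, of n]] by simp
qed simp

lemma nrm_sh: "d \<in> D \<Longrightarrow> nrm (sh k d) = nrm (sh k e) * nrm d"
  using nrm_mult[OF D_sh[OF e_D, of k], of d] D_left by (simp add: sh_mult_left)

lemma nrm_sh_add: "nrm (sh (k + l) e) = nrm (sh k e) * nrm (sh l e)"
  using nrm_mult[OF D_sh[OF e_D, of k] D_sh[OF e_D, of l]]
  by (simp add: sh_mult_left sh_mult_right idem add.commute)

text \<open>Index 1 would mean G e = p G e, making \<open>e\<close> divisible by every power of p,
  against separatedness.\<close>

lemma nrm_sh_1: "nrm (sh 1 e) < 1"
proof -
  have "idx (sh 1 e) \<noteq> 1"
  proof
    assume "idx (sh 1 e) = 1"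
    have okse: "ok (sh 1 e)" using ok_sh ok_e by simp
    have "cyc e = cyc (sh 1 e)"
      using \<open>idx (sh 1 e) = 1\<close> quot_index_eq_1_iff[OF cyc_subgroup cyc_subgroup, of "sh 1 e" e]
        okse cyc_mono[of "sh 1 e" e]
      by (simp add: idx_def ok_def)
    also have "\<dots> = sh 1 ` cyc e"
      by (simp add: cyc_def image_image sh_mult_right)
    finally have eq: "cyc e = sh 1 ` cyc e" .
    have e_in: "e \<in> sh (int n) ` cyc e" for n
    proof (induction n)
      case 0
      then show ?case using ok_e by (simp add: ok_def)
    next
      case (Suc n)
      have "sh (int n) ` cyc e = sh (int (Suc n)) ` cyc e"
        by (subst eq) (simp add: image_image algebra_simps)
      then show ?case using Suc by simp
    qed
    obtain m where m: "0 \<le> m" "sh m e \<in> G" using G_absorb by blast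
    have "e = 0"
    proof (rule G_separated)
      fix k :: int assume "0 \<le> k"
      obtain a where a: "a \<in> G" "e = sh (k + m) (a * e)"
        using e_in[of "nat (k + m)"] m(1) \<open>0 \<le> k\<close> by (auto simp: cyc_def)
      have "sh (- k) e = sh (- k) (sh (k + m) (a * e))" using a(2) by (rule arg_cong)
      also have "\<dots> = a * sh m e" by (simp add: sh_mult_right)
      finally show "sh (- k) e \<in> G" using a(1) m(2) G_mult by simp
    qed
    then show False using e_nonzero by blast
  qed
  then have "2 \<le> idx (sh 1 e)" using idx_pos[OF ok_sh[OF _ ok_e], of 1] by simp
  then show ?thesis using nrm_ok[OF ok_sh[OF _ ok_e], of 1] by simp
qed

lemma nrm_sh_less_iff: "nrm (sh k e) \<le> 1 \<longleftrightarrow> 0 \<le> k"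
proof -
  have pow: "nrm (sh (int n) e) = nrm (sh 1 e) ^ n" for n
    by (induction n) (simp_all add: nrm_e nrm_sh_add)
  have pos: "0 < nrm (sh 1 e)" using nrm_pos D_sh e_D e_nonzero by simp
  show ?thesis
  proof
    assume "0 \<le> k"
    then show "nrm (sh k e) \<le> 1"
      using pow[of "nat k"] nrm_sh_1 pos by (simp add: power_le_one)
  next
    assume le: "nrm (sh k e) \<le> 1"
    show "0 \<le> k"
    proof (rule ccontr)
      assume "\<not> 0 \<le> k"
      then obtain n where n: "k = - int (Suc n)" by (metis int_cases not_le of_nat_0_le_iff)
      have "nrm (sh 1 e) ^ Suc n < 1" using nrm_sh_1 pos by (intro power_Suc_less_one) auto
      moreover have "nrm (sh k e) * nrm (sh 1 e) ^ Suc n = 1"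
        using nrm_sh_add[of k "int (Suc n)"] pow[of "Suc n"] n by (simp add: nrm_e)
      ultimately show False
        using mult_right_mono[OF le, of "nrm (sh 1 e) ^ Suc n"] pos by simp
    qed
  qed
qed

text \<open>Scale \<open>d\<close> to u = p^i d in \<open>G\<close> but outside p G. The inverse of
  \<open>u\<close> up to p^c gives |p^c| \<le> |u| \<le> |p^i|, hence i \<le> c, with
  \<open>c\<close> independent of \<open>d\<close>.\<close>

lemma nrm_ball_bounded: "\<exists>c. \<forall>d\<in>D. nrm d \<le> 1 \<longrightarrow> sh c d \<in> G"
proof -
  obtain c :: nat where c: "\<And>u. u \<in> D \<Longrightarrow> u \<in> G \<Longrightarrow> sh (- 1) u \<notin> G \<Longrightarrow>
      \<exists>u'\<in>D \<inter> G. u' * u = sh (int c) e"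
    using unit_inverse_bounded by blast
  have "sh (int c) d \<in> G" if d: "d \<in> D" "nrm d \<le> 1" for d
  proof (cases "d = 0")
    case False
    obtain i where i: "sh i d \<in> G" "sh (i - 1) d \<notin> G" using level_exists[OF False] by blast
    define u where "u = sh i d"
    have u: "u \<in> D" "u \<in> G" "sh (- 1) u \<notin> G" using i D_sh d by (auto simp: u_def)
    then obtain u' where u': "u' \<in> D" "u' \<in> G" "u' * u = sh (int c) e" using c by blast
    have "nrm (sh (int c) e) = nrm u' * nrm u" using nrm_mult u u' by metis
    also have "\<dots> \<le> nrm u"
      using nrm_G_le_1[OF u'(1,2)] nrm_pos[OF u(1)] by (cases "u = 0") (auto simp: mult_left_le_one_le)
    also have "nrm u = nrm (sh i e) * nrm d" by (simp add: u_def nrm_sh d)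
    also have "\<dots> \<le> nrm (sh i e)"
      using d nrm_pos[OF D_sh[OF e_D], of i] e_nonzero by (simp add: mult_left_le)
    finally have "nrm (sh (int c - i) e) * nrm (sh i e) \<le> nrm (sh i e)"
      using nrm_sh_add[of "int c - i" i] by simp
    then have "nrm (sh (int c - i) e) \<le> 1"
      using nrm_pos[OF D_sh[OF e_D], of i] e_nonzero by simp
    then have "i \<le> int c" using nrm_sh_less_iff by simp
    then show ?thesis using G_sh_mono[OF i(1)] by blast
  qed (simp add: G_zero)
  then show ?thesis by blast
qed

text \<open>If |d| exceeded 1, the norms of its powers would grow without bound, whereas the norm is
  bounded on p^(-k) G.\<close>

lemma nrm_le_1_if_powers_bounded:
  assumes d: "d \<in> D" and bdd: "\<And>n. sh k (d ^ Suc n) \<in> G"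
  shows "nrm d \<le> 1"
proof (rule ccontr)
  assume "\<not> nrm d \<le> 1"
  then have gt: "1 < nrm d" by simp
  have pos: "0 < nrm (sh k e)" using nrm_pos D_sh e_D e_nonzero by simp
  obtain n where n: "1 / nrm (sh k e) < nrm d ^ n" using real_arch_pow[OF gt] by blast
  also have "\<dots> \<le> nrm d ^ Suc n" using gt by (simp add: mult_le_cancel_right1)
  also have "\<dots> \<le> 1 / nrm (sh k e)"
    using nrm_G_le_1[OF D_sh[OF D_power[OF d]] bdd, of n] pos
    by (simp add: nrm_sh[OF D_power[OF d]] nrm_power[OF d] field_simps del: power_Suc)
  finally show False by simp
qed

text \<open>After scaling by p^k the nonzero norms are reciprocals of natural numbers, so the
  supremum is attained where the index is least.\<close>

lemma nrm_max_exists: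
  assumes B: "B \<subseteq> D" "\<And>b. b \<in> B \<Longrightarrow> sh k b \<in> G" and b0: "b0 \<in> B" "b0 \<noteq> 0"
  shows "\<exists>b\<in>B. b \<noteq> 0 \<and> (\<forall>b'\<in>B. nrm b' \<le> nrm b)"
proof -
  obtain b where b: "b \<in> B" "b \<noteq> 0"
    and min: "\<And>b'. b' \<in> B \<and> b' \<noteq> 0 \<Longrightarrow> idx (sh k b) \<le> idx (sh k b')"
    using ex_has_least_nat[of "\<lambda>b. b \<in> B \<and> b \<noteq> 0" b0 "\<lambda>b. idx (sh k b)"] b0 by blast
  have pos: "0 < nrm (sh k e)" using nrm_pos D_sh e_D e_nonzero by simp
  have okb: "ok (sh k b')" if "b' \<in> B" "b' \<noteq> 0" for b'
    using that B D_sh by (intro ok_if_G) auto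
  have "nrm b' \<le> nrm b" if b': "b' \<in> B" for b'
  proof (cases "b' = 0")
    case True
    then show ?thesis using nrm_pos b B by fastforce
  next
    case False
    have "nrm (sh k b') \<le> nrm (sh k b)"
      using min[of b'] idx_pos[OF okb[OF b]] b' False
      by (simp add: nrm_ok okb b frac_le)
    then show ?thesis using pos b b' B by (simp add: nrm_sh subset_iff)
  qed
  then show ?thesis using b by blast
qed

end

section \<open>Membership criteria for maximal orders, and sublattices of A e\<close>

section \<open>Maximal orders\<close>

locale maximal_order = local_algebra av scale
  for av :: "'k::field \<Rightarrow> real" and scale :: "'k \<Rightarrow> 'a::ring_1 \<Rightarrow> 'a" +
  fixes G :: "'a set"
  assumes maximal: "is_maximal_order R scale G"

sublocale maximal_order \<subseteq> local_order
  using maximal by unfold_locales (simp add: is_maximal_order_def)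

context maximal_order
begin

text \<open>\<open>H\<close> lies between \<open>G\<close> and p^(-k) G, so it is finitely generated
  and therefore an order. It is closed under scalars in \<open>R\<close> because \<open>G\<close>
  contains their multiples of 1.\<close>

lemma maximal_bounded_ring:
  assumes "G \<subseteq> H" and add: "\<And>x y. x \<in> H \<Longrightarrow> y \<in> H \<Longrightarrow> x + y \<in> H"
    and mult: "\<And>x y. x \<in> H \<Longrightarrow> y \<in> H \<Longrightarrow> x * y \<in> H"
    and bdd: "\<And>x. x \<in> H \<Longrightarrow> sh (int k) x \<in> G"
  shows "H = G"
proof -
  have smH: "Rmod.sm H"
  proof (rule Rmod.smI)
    show "0 \<in> H" using G_zero assms(1) by blast
    show "scale c x \<in> H" if "c \<in> R" "x \<in> H" for c x
      using mult[of "scale c 1" x] G_scale[OF that(1) G_one] assms(1) that(2)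
      by (auto simp: scale_eq_mult)
  qed (rule add)
  have sub: "H \<subseteq> sh (- int k) ` G"
    using bdd by (auto simp: mem_sh_image_iff)
  have eq: "sh (- int k) ` sh (int k) ` G = G" by (simp add: image_image)
  have "finite (quot_set (sh (- int k) ` G) (sh (- int k) ` sh (int k) ` G))"
    using finite_G_sh[of k] sh_image_subset[of "int k"]
    by (subst finite_quot_set_image) (auto simp: sh_add sh_inj G_subgroup intro!: inj_onI)
  then have "finite (quot_set H G)"
    unfolding eq using sub assms(1) Rmod.sm_subgroup[OF smH]
      finite_quot_set_tower[OF sh_subgroup[OF G_subgroup] _ G_subgroup, of H "- int k"] by blast
  then have "fin_gen R scale H"
    using Rmod.gen_mono_ext[OF smH G_Rmod assms(1) G_fin_gen] by blast
  moreover have "gen_submodule UNIV scale H = UNIV"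
    using order hull_mono[OF assms(1), of "is_submodule UNIV scale"]
    by (auto simp: is_order_def gen_submodule_def)
  ultimately have "is_order R scale H"
    using smH mult G_one assms(1) by (auto simp: is_order_def)
  then show ?thesis using maximal assms(1) by (auto simp: is_maximal_order_def)
qed

text \<open>The additive span of \<open>B\<close> is bounded, closed under multiplication and stable
  under \<open>G\<close> on both sides; its sum with \<open>G\<close> is a bounded ring containing
  \<open>G\<close>.\<close>

lemma bounded_ideal_subset:
  assumes bdd: "\<And>x. x \<in> B \<Longrightarrow> sh k x \<in> G"
    and left: "\<And>a x. a \<in> G \<Longrightarrow> x \<in> B \<Longrightarrow> a * x \<in> B"
    and right: "\<And>a x. a \<in> G \<Longrightarrow> x \<in> B \<Longrightarrow> x * a \<in> B"
    and mult: "\<And>x y. x \<in> B \<Longrightarrow> y \<in> B \<Longrightarrow> x * y \<in> B"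
  shows "B \<subseteq> G"
proof -
  define H where "H = is_add_subgroup hull B"
  have H: "is_add_subgroup H"
    unfolding H_def by (rule hull_in) (auto simp: is_add_subgroup_def)
  have H_inc: "x \<in> H" if "x \<in> B" for x using that hull_inc[of x B] by (simp add: H_def)
  have H_ind: "Q x" if "x \<in> H" "\<And>x. x \<in> B \<Longrightarrow> Q x" "is_add_subgroup {x. Q x}" for Q x
    using hull_induct[of x is_add_subgroup B Q] that by (simp add: H_def)
  note Hs = add_subgroup_zero[OF H] add_subgroup_add[OF H] add_subgroup_minus[OF H]
  have H_left: "a * x \<in> H" if "a \<in> G" "x \<in> H" for a x
    by (rule H_ind[OF that(2)])
      (use that(1) in \<open>auto simp: is_add_subgroup_def distrib_left Hs intro: H_inc left\<close>)
  have H_right: "x * a \<in> H" if "a \<in> G" "x \<in> H" for a x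
    by (rule H_ind[OF that(2)])
      (use that(1) in \<open>auto simp: is_add_subgroup_def distrib_right Hs intro: H_inc right\<close>)
  have H_B: "x * y \<in> H" if "x \<in> H" "y \<in> B" for x y
    by (rule H_ind[OF that(1)])
      (use that(2) in \<open>auto simp: is_add_subgroup_def distrib_right Hs intro: H_inc mult\<close>)
  have H_mult: "x * y \<in> H" if "x \<in> H" "y \<in> H" for x y
    by (rule H_ind[OF that(2)])
      (use that(1) in \<open>auto simp: is_add_subgroup_def distrib_left Hs intro: H_B\<close>)
  have H_bdd: "sh k x \<in> G" if "x \<in> H" for x
    by (rule H_ind[OF that])
      (auto simp: is_add_subgroup_def sh_add sh_minus intro: bdd G_zero G_add G_minus)
  define H' where "H' = {x + y |x y. x \<in> G \<and> y \<in> H}"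
  have "H' = G"
  proof (rule maximal_bounded_ring)
    show "G \<subseteq> H'" using Hs(1) by (force simp: H'_def)
    show "u + v \<in> H'" if uv: "u \<in> H'" "v \<in> H'" for u v
    proof -
      obtain x y x' y' where *: "u = x + y" "v = x' + y'" "x \<in> G" "x' \<in> G" "y \<in> H" "y' \<in> H"
        using uv unfolding H'_def by blast
      have "u + v = (x + x') + (y + y')" using * by (simp add: algebra_simps)
      then show ?thesis using G_add[OF *(3,4)] Hs(2)[OF *(5,6)] unfolding H'_def by blast
    qed
    show "u * v \<in> H'" if uv: "u \<in> H'" "v \<in> H'" for u v
    proof -
      obtain x y x' y' where *: "u = x + y" "v = x' + y'" "x \<in> G" "x' \<in> G" "y \<in> H" "y' \<in> H"
        using uv unfolding H'_def by blast
      have "u * v = x * x' + (x * y' + y * x' + y * y')" using * by (simp add: algebra_simps)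
      moreover have "x * y' + y * x' + y * y' \<in> H"
        by (intro Hs(2) H_left[OF *(3,6)] H_right[OF *(4,5)] H_mult[OF *(5,6)])
      ultimately show ?thesis using G_mult[OF *(3,4)] unfolding H'_def by blast
    qed
    show "sh (int (nat k)) u \<in> G" if u: "u \<in> H'" for u
    proof -
      obtain x y where *: "u = x + y" "x \<in> G" "y \<in> H" using u unfolding H'_def by blast
      have "sh (int (nat k)) y \<in> G" by (rule G_sh_mono[OF H_bdd[OF *(3)]]) simp
      then show ?thesis using * by (simp add: sh_add G_add G_sh)
    qed
  qed
  moreover have "B \<subseteq> H'"
    using H_inc G_zero by (force simp: H'_def)
  ultimately show ?thesis by blast
qed

text \<open>G S G is closed under multiplication, because (a s b) (a' s' b') contains s (b a') s',
  which \<open>prod\<close> rewrites as an element of S G. Maximality is used in this form from here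
  on.\<close>

lemma bounded_products_subset:
  assumes bdd: "\<And>s. s \<in> S \<Longrightarrow> sh k s \<in> G"
    and prod: "\<And>s a s'. s \<in> S \<Longrightarrow> a \<in> G \<Longrightarrow> s' \<in> S \<Longrightarrow> \<exists>t\<in>S. \<exists>b\<in>G. s * a * s' = t * b"
  shows "S \<subseteq> G"
proof -
  let ?B = "{a * s * b |a s b. a \<in> G \<and> s \<in> S \<and> b \<in> G}"
  have "?B \<subseteq> G"
  proof (rule bounded_ideal_subset)
    fix x assume "x \<in> ?B"
    then obtain a s b where x: "x = a * s * b" "a \<in> G" "s \<in> S" "b \<in> G" by blast
    have "a * sh k s * b \<in> G" using bdd x G_mult by blast
    then show "sh k x \<in> G" by (simp add: x sh_mult_left sh_mult_right)
    show "g * x \<in> ?B" if "g \<in> G" for g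
    proof -
      have "g * x = (g * a) * s * b" "g * a \<in> G" using x G_mult that by (simp_all add: mult.assoc)
      then show ?thesis using x by blast
    qed
    show "x * g \<in> ?B" if "g \<in> G" for g
    proof -
      have "x * g = a * s * (b * g)" "b * g \<in> G" using x G_mult that by (simp_all add: mult.assoc)
      then show ?thesis using x by blast
    qed
    fix y assume "y \<in> ?B"
    then obtain a' s' b' where y: "y = a' * s' * b'" "a' \<in> G" "s' \<in> S" "b' \<in> G" by blast
    obtain t c where tc: "t \<in> S" "c \<in> G" "s * (b * a') * s' = t * c"
      using prod[OF x(3) G_mult[OF x(4) y(2)] y(3)] by blast
    have "x * y = a * (s * (b * a') * s') * b'" by (simp add: x y mult.assoc)
    then have "x * y = a * t * (c * b')" unfolding tc(3) by (simp add: mult.assoc)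
    then show "x * y \<in> ?B" using tc(1) x(2) G_mult[OF tc(2) y(4)] by blast
  qed
  moreover have "s \<in> ?B" if "s \<in> S" for s
  proof -
    have "1 * s * 1 \<in> ?B" using that G_one by blast
    then show ?thesis by simp
  qed
  ultimately show ?thesis by blast
qed

end

text \<open>The relation b t = e carries A e isomorphically to the left ideal of t b, so simplicity
  is transported. It serves to replace a primitive idempotent by one inside the order.\<close>

lemma prim_conjugate:
  assumes "prim e" "b * t = e" "e * b = b" "t * e = t"
  shows "prim (t * b)"
  unfolding prim_def
proof (intro conjI allI impI)
  show "t * b * (t * b) = t * b"
    using assms by (metis mult.assoc)
  show "t * b \<noteq> 0"
  proof
    assume "t * b = 0"
    have "e * e = (b * t) * (b * t)" using assms(2) by simp
    also have "\<dots> = b * (t * b) * t" by (simp add: mult.assoc)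
    finally have "e * e = 0" using \<open>t * b = 0\<close> by simp
    then show False using assms(1) unfolding prim_def by metis
  qed
  fix a assume "a * (t * b) \<noteq> 0"
  then have "a * t * e \<noteq> 0" using assms(4) by (metis mult.assoc mult_zero_left)
  then obtain c where c: "c * (a * t * e) = e" using assms(1) unfolding prim_def by blast
  have "t * c * (a * (t * b)) = t * (c * (a * t * e)) * b"
    using assms(3) by (simp add: mult.assoc)
  also have "\<dots> = t * b" using c assms(4) by simp
  finally show "\<exists>a'. a' * (a * (t * b)) = t * b" by blast
qed

locale maximal_order_idempotent = maximal_order av scale G + primitive_idempotent av scale G e
  for av :: "'k::field \<Rightarrow> real" and scale :: "'k \<Rightarrow> 'a::ring_1 \<Rightarrow> 'a" and G e
begin

text \<open>
  With \<open>\<Delta>\<close> the unit ball of the division ring \<open>D\<close>, \<open>T = G \<Delta>\<close> and \<open>T'\<close> the set of \<open>b \<in> e A\<close> with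
  \<open>T b \<subseteq> G\<close>, choose \<open>d \<in> T' T\<close> of largest norm.  Then \<open>T d\<^sup>-\<^sup>1 T'\<close> is closed under multiplication,
  so it lies in the maximal order \<open>G\<close>; hence \<open>d\<^sup>-\<^sup>1 T' \<subseteq> T'\<close> and \<open>e \<in> T' T\<close>.
\<close>

lemma conjugate_in_order: "\<exists>b t. b * t = e \<and> e * b = b \<and> t * e = t \<and> t * b \<in> G"
proof -
  obtain c where c: "\<And>d. d \<in> D \<Longrightarrow> nrm d \<le> 1 \<Longrightarrow> sh c d \<in> G" using nrm_ball_bounded by blast
  obtain m where m: "0 \<le> m" "sh m e \<in> G" using G_absorb by blast
  define T where "T = {a * d |a d. a \<in> G \<and> d \<in> D \<and> nrm d \<le> 1}"
  define T' where "T' = {b. e * b = b \<and> (\<forall>t\<in>T. t * b \<in> G)}"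
  have T_e: "t * e = t" if "t \<in> T" for t
    using that by (auto simp: T_def mult.assoc D_right)
  have T_left: "a * t \<in> T" if "a \<in> G" "t \<in> T" for a t
  proof -
    from that(2) obtain a' d where *: "t = a' * d" "a' \<in> G" "d \<in> D" "nrm d \<le> 1"
      unfolding T_def by blast
    have "a * t = (a * a') * d" "a * a' \<in> G" using * that(1) G_mult by (simp_all add: mult.assoc)
    then show ?thesis using * unfolding T_def by blast
  qed
  have T_right: "t * d \<in> T" if "t \<in> T" "d \<in> D" "nrm d \<le> 1" for t d
  proof -
    from that(1) obtain a d' where *: "t = a * d'" "a \<in> G" "d' \<in> D" "nrm d' \<le> 1"
      unfolding T_def by blast
    have "nrm (d' * d) \<le> 1"
      using nrm_mult[OF *(3) that(2)] * that nrm_pos[of d] nrm_pos[of d']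
      by (cases "d = 0"; cases "d' = 0") (auto intro!: mult_le_one)
    then show ?thesis using * D_mult that(2) unfolding T_def by (auto simp: mult.assoc)
  qed
  have T_bdd: "sh c t \<in> G" if "t \<in> T" for t
    using that c G_mult by (auto simp: T_def sh_mult_right[symmetric])
  have eT: "sh m e \<in> T"
    unfolding T_def using m e_D nrm_e idem by (force simp: sh_mult_left)
  have T'_bdd: "sh m b \<in> G" if "b \<in> T'" for b
    using that eT unfolding T'_def by (auto simp: sh_mult_left)
  have T'_T_D: "b * t \<in> D" if "b \<in> T'" "t \<in> T" for b t
    using that T_e unfolding T'_def D_def by (auto simp: mult.assoc) (simp add: mult.assoc[symmetric])
  \<comment> \<open>The powers of b t are bounded because (b t)^(n+1) = b (t b)^n t with t b in
    \<open>G\<close>.\<close>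
  have T'_T_nrm: "nrm (b * t) \<le> 1" if bt: "b \<in> T'" "t \<in> T" for b t
  proof (rule nrm_le_1_if_powers_bounded[OF T'_T_D[OF bt]])
    fix n
    have pow: "(b * t) ^ Suc n = b * (t * b) ^ n * t"
      by (induction n) (simp_all add: mult.assoc power_commutes)
    have "(t * b) ^ n \<in> G" using bt G_power unfolding T'_def by blast
    then have "sh m b * (t * b) ^ n * sh c t \<in> G"
      using T'_bdd[OF bt(1)] T_bdd[OF bt(2)] G_mult by blast
    then show "sh (m + c) ((b * t) ^ Suc n) \<in> G"
      unfolding pow by (simp add: sh_mult_left sh_mult_right add.commute)
  qed
  define B where "B = {b * t |b t. b \<in> T' \<and> t \<in> T}"
  \<comment> \<open>This supplies a nonzero element of \<open>B\<close>, without which the maximal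
    norm would be 0.\<close>
  have "sh c e \<in> T'"
    unfolding T'_def using T_bdd T_e by (auto simp: sh_mult_right idem)
  then have b0: "sh c e * sh m e \<in> B" using eT unfolding B_def by blast
  have "B \<subseteq> D" "\<And>x. x \<in> B \<Longrightarrow> sh c x \<in> G"
    using T'_T_D T'_T_nrm c unfolding B_def by blast+
  moreover have "sh c e * sh m e \<noteq> 0"
    by (simp add: sh_mult_left sh_mult_right idem e_nonzero)
  ultimately obtain d where d: "d \<in> B" "d \<noteq> 0" "\<And>d'. d' \<in> B \<Longrightarrow> nrm d' \<le> nrm d"
    using nrm_max_exists[of B c] b0 by blast
  obtain b t where bt: "b \<in> T'" "t \<in> T" "d = b * t" using d(1) unfolding B_def by blast
  have dD: "d \<in> D" using T'_T_D bt by blast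
  obtain d' where d': "d' \<in> D" "d' \<noteq> 0" "d' * d = e" using D_inverse[OF dD d(2)] by blast
  have nrm_d': "nrm (d' * x) \<le> 1" if "x \<in> B" for x
  proof -
    have "nrm (d' * x) = nrm d' * nrm x" using nrm_mult d'(1) that \<open>B \<subseteq> D\<close> by blast
    also have "\<dots> \<le> nrm d' * nrm d"
      using d(3)[OF that] nrm_pos[OF d'(1,2)] by (simp add: mult_left_mono)
    also have "\<dots> = 1" using nrm_mult[OF d'(1) dD] d'(3) nrm_e by simp
    finally show ?thesis .
  qed
  obtain l where l: "sh l d' \<in> G" using G_absorb by blast
  have "{t * d' * b |t b. t \<in> T \<and> b \<in> T'} \<subseteq> G" (is "?S \<subseteq> G")
  proof (rule bounded_products_subset)
    fix x assume "x \<in> ?S"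
    then obtain t b where x: "x = t * d' * b" "t \<in> T" "b \<in> T'" by blast
    have "sh c t * sh l d' * sh m b \<in> G"
      using T_bdd[OF x(2)] T'_bdd[OF x(3)] l G_mult by blast
    then show "sh (c + l + m) x \<in> G"
      by (simp add: x sh_mult_left sh_mult_right add_ac)
    fix a y assume a: "a \<in> G" and "y \<in> ?S"
    then obtain t2 b2 where y: "y = t2 * d' * b2" "t2 \<in> T" "b2 \<in> T'" by blast
    \<comment> \<open>Since \<open>d\<close> has the largest norm in \<open>B\<close>, multiplying
      this element by the inverse of \<open>d\<close> lands in the unit ball, under which
      \<open>T\<close> is stable from the right.\<close>
    have "b * (a * t2) \<in> B" using x T_left[OF a y(2)] unfolding B_def by blast
    then have "t * (d' * (b * (a * t2))) \<in> T"
      using T_right[OF x(2) _ nrm_d'] D_mult[OF d'(1)] \<open>B \<subseteq> D\<close> by blast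
    moreover have "x * a * y = (t * (d' * (b * (a * t2)))) * d' * b2 * 1"
      by (simp add: x y mult.assoc)
    ultimately show "\<exists>s\<in>?S. \<exists>g\<in>G. x * a * y = s * g" using y(3) G_one by blast
  qed
  \<comment> \<open>The factors d' b and t are the required ones: their product in this order is
    \<open>e\<close>, in the other order it lies in \<open>G\<close>.\<close>
  then have "t * (d' * b) \<in> G" using bt by (force simp: mult.assoc)
  moreover have "d' * b * t = e" using bt d' by (simp add: mult.assoc)
  moreover have "e * (d' * b) = d' * b" using D_left d'(1) by (simp add: mult.assoc[symmetric])
  ultimately show ?thesis using T_e[OF bt(2)] by blast
qed

end

locale order_idempotent = maximal_order_idempotent +
  assumes e_G: "e \<in> G"
begin

text \<open>For x and y in the unit ball, x a y = x (e a e) y, and e a e lies in \<open>D\<close>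
  and \<open>G\<close>; so the product stays in the ball. Being bounded, the ball then lies in the
  maximal order.\<close>

lemma nrm_le_1_iff:
  assumes "d \<in> D"
  shows "nrm d \<le> 1 \<longleftrightarrow> d \<in> G"
proof
  assume d: "nrm d \<le> 1"
  obtain c where c: "\<And>d. d \<in> D \<Longrightarrow> nrm d \<le> 1 \<Longrightarrow> sh c d \<in> G" using nrm_ball_bounded by blast
  have "{d \<in> D. nrm d \<le> 1} \<subseteq> G" (is "?S \<subseteq> G")
  proof (rule bounded_products_subset)
    show "sh c x \<in> G" if "x \<in> ?S" for x using that c by blast
    fix x a y assume "x \<in> ?S" "y \<in> ?S" and a: "a \<in> G"
    then have xy: "x \<in> D" "nrm x \<le> 1" "y \<in> D" "nrm y \<le> 1" by auto
    have mid: "e * a * e \<in> D" "e * a * e \<in> G" using D_corner e_G G_mult a by blast+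
    have nn: "0 \<le> nrm u" if "u \<in> D" for u
      using nrm_pos[OF that] by (cases "u = 0") auto
    have "nrm (x * (e * a * e) * y) = nrm x * nrm (e * a * e) * nrm y"
      using xy mid D_mult nrm_mult by simp
    also have "\<dots> \<le> 1"
      using nrm_G_le_1[OF mid] xy nn[OF mid(1)] nn[OF xy(1)] nn[OF xy(3)]
      by (auto intro!: mult_le_one)
    finally have "x * (e * a * e) * y \<in> ?S" using xy mid D_mult by simp
    moreover have "x * a * y = x * (e * a * e) * y * 1"
    proof -
      have "x * a * y = (x * e) * a * (e * y)" using xy D_left D_right by simp
      then show ?thesis by (simp add: mult.assoc)
    qed
    ultimately show "\<exists>s\<in>?S. \<exists>g\<in>G. x * a * y = s * g" using G_one by blast
  qed
  then show "d \<in> G" using assms d by blast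
qed (use nrm_G_le_1 assms in blast)

text \<open>Division by \<open>d\<close> reduces the claim to the unit ball, which is the
  intersection of \<open>D\<close> with \<open>G\<close> and hence closed under addition.\<close>

lemma nrm_add_le:
  assumes "c \<in> D" "d \<in> D" "nrm c \<le> nrm d"
  shows "nrm (c + d) \<le> nrm d"
proof (cases "d = 0")
  case True
  then show ?thesis using assms nrm_pos[of c] by (cases "c = 0") auto
next
  case False
  obtain d' where d': "d' \<in> D" "d' \<noteq> 0" "d' * d = e" "d * d' = e"
    using D_inverse[OF assms(2) False] by blast
  have inv: "nrm d' * nrm d = 1" using nrm_mult[OF d'(1) assms(2)] d'(3) nrm_e by simp
  have "nrm (c * d') \<le> 1"
    unfolding nrm_mult[OF assms(1) d'(1)] inv[symmetric]
    using assms(3) nrm_pos[OF d'(1,2)] by (simp add: mult.commute)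
  then have "c * d' \<in> G" using nrm_le_1_iff D_mult assms(1) d'(1) by blast
  then have "c * d' + e \<in> G" using e_G G_add by blast
  moreover have sumD: "c * d' + e \<in> D"
    using D_mult[OF assms(1) d'(1)] e_D by (simp add: D_def distrib_left distrib_right)
  ultimately have le: "nrm (c * d' + e) \<le> 1" using nrm_G_le_1 by blast
  have "c + d = (c * d' + e) * d"
    using d' assms D_left D_right by (simp add: distrib_right mult.assoc)
  then have "nrm (c + d) = nrm (c * d' + e) * nrm d" using nrm_mult[OF sumD assms(2)] by simp
  also have "\<dots> \<le> nrm d"
    using le nrm_pos[OF assms(2) False] by simp
  finally show ?thesis .
qed

text \<open>Because y = y e, any y a y equals y (e a y) with e a y in \<open>G\<close>, so the
  product criterion applies to the singleton {y}.\<close>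

lemma saturated:
  assumes y: "y * e = y" and ey: "\<And>a. a \<in> G \<Longrightarrow> e * a * y \<in> G"
  shows "y \<in> G"
proof -
  obtain k where k: "sh k y \<in> G" using G_absorb by blast
  have "{y} \<subseteq> G"
  proof (rule bounded_products_subset)
    show "sh k s \<in> G" if "s \<in> {y}" for s using that k by simp
    fix s a s' assume "s \<in> {y}" "s' \<in> {y}" and a: "a \<in> G"
    then have "s * a * s' = (y * e) * a * y" using y by simp
    then have "s * a * s' = y * (e * a * y)" by (simp add: mult.assoc)
    then show "\<exists>t\<in>{y}. \<exists>b\<in>G. s * a * s' = t * b" using ey[OF a] by blast
  qed
  then show ?thesis by simp
qed

text \<open>The generator \<open>w\<close> is an element of largest norm in the part of
  \<open>U\<close> inside \<open>D\<close>. For u in \<open>U\<close> every e a u w^(-1) has norm at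
  most 1 and so lies in \<open>G\<close>; saturation then puts u w^(-1) itself into
  \<open>G\<close>.\<close>

lemma sublattice_cyclic:
  assumes U: "\<And>u. u \<in> U \<Longrightarrow> u * e = u" and left: "\<And>a u. a \<in> G \<Longrightarrow> u \<in> U \<Longrightarrow> a * u \<in> U"
    and bdd: "\<And>u. u \<in> U \<Longrightarrow> sh k u \<in> G" and u0: "u0 \<in> U" "u0 \<noteq> 0"
  shows "\<exists>w\<in>D. w \<noteq> 0 \<and> U = cyc w"
proof -
  have eU: "e * a * u \<in> U \<inter> D" if "a \<in> G" "u \<in> U" for a u
    using left[OF G_mult[OF e_G that(1)] that(2)] U[OF that(2)] D_corner[of "a * u"]
    by (simp add: mult.assoc)
  have "u0 * e \<noteq> 0" using u0 U by simp
  then obtain a where a: "a * (u0 * e) = e" using prim_inverse by blast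
  obtain l where l: "sh l a \<in> G" using G_absorb by blast
  have "e * sh l a * u0 = sh l e"
    using a U[OF u0(1)] by (simp add: sh_mult_left sh_mult_right mult.assoc idem)
  then have "sh l e \<in> U \<inter> D" using eU[OF l u0(1)] by simp
  then obtain w where w: "w \<in> U \<inter> D" "w \<noteq> 0" "\<And>d. d \<in> U \<inter> D \<Longrightarrow> nrm d \<le> nrm w"
    using nrm_max_exists[of "U \<inter> D" k "sh l e"] bdd e_nonzero by auto
  obtain w' where w': "w' \<in> D" "w' \<noteq> 0" "w' * w = e" using D_inverse w by blast
  have "u \<in> cyc w" if "u \<in> U" for u
  proof -
    have "u * w' \<in> G"
    proof (rule saturated)
      show "u * w' * e = u * w'" using D_right[OF w'(1)] by (simp add: mult.assoc)
      fix a assume "a \<in> G"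
      then have d: "e * a * u \<in> D" "nrm (e * a * u) \<le> nrm w" using eU[OF _ that] w(3) by auto
      have "nrm (e * a * u * w') \<le> nrm w * nrm w'"
        using nrm_mult[OF d(1) w'(1)] d(2) nrm_pos[OF w'(1,2)] by simp
      also have "\<dots> = 1" using nrm_mult[OF w'(1), of w] w w'(3) nrm_e by (simp add: mult.commute)
      finally show "e * a * (u * w') \<in> G"
        using nrm_le_1_iff[OF D_mult[OF d(1) w'(1)]] by (simp add: mult.assoc)
    qed
    moreover have "u = u * w' * w" using w'(3) U[OF that] by (simp add: mult.assoc)
    ultimately show ?thesis by (auto simp: cyc_def)
  qed
  moreover have "cyc w \<subseteq> U" using left w(1) by (auto simp: cyc_def)
  ultimately show ?thesis using w by blast
qed

end

section \<open>Lattices in modules: scaling and finiteness of quotients\<close>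

section \<open>Lattices over orders\<close>

locale algebra_module = local_algebra av scale + left_module act
  for av :: "'k::field \<Rightarrow> real" and scale :: "'k \<Rightarrow> 'a::ring_1 \<Rightarrow> 'a"
    and act :: "'a \<Rightarrow> 'v::ab_group_add \<Rightarrow> 'v"
begin

definition shv :: "int \<Rightarrow> 'v \<Rightarrow> 'v" where "shv k v = act (sh k 1) v"

lemma act_sh: "act (sh k a) v = shv k (act a v)"
  by (simp add: shv_def act_mult[symmetric] sh_mult_left)

lemma act_shv: "act a (shv k v) = shv k (act a v)"
  by (simp add: shv_def act_mult[symmetric] sh_mult_left sh_mult_right)

lemma shv_0 [simp]: "shv 0 v = v"
  and shv_shv [simp]: "shv k (shv l v) = shv (k + l) v"
  and shv_zero [simp]: "shv k 0 = 0"
  and shv_add: "shv k (v + w) = shv k v + shv k w"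
  and shv_minus: "shv k (- v) = - shv k v"
  by (simp_all add: shv_def act_add_right act_minus_right act_mult[symmetric]
      sh_mult_left)

lemma shv_inj: "shv k v = shv k w \<longleftrightarrow> v = w"
  by (metis shv_0 shv_shv add.left_inverse)

lemma mem_shv_image_iff: "v \<in> shv k ` N \<longleftrightarrow> shv (- k) v \<in> N"
  by (force simp: image_iff)

lemma shv_subgroup: "is_add_subgroup N \<Longrightarrow> is_add_subgroup (shv k ` N)"
  unfolding is_add_subgroup_def
  by (auto simp: shv_add[symmetric] shv_minus[symmetric] image_iff intro: bexI[of _ 0])

end

locale order_module = local_order av scale G + left_module act
  for av :: "'k::field \<Rightarrow> real" and scale :: "'k \<Rightarrow> 'a::ring_1 \<Rightarrow> 'a" and G
    and act :: "'a \<Rightarrow> 'v::ab_group_add \<Rightarrow> 'v"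

sublocale order_module \<subseteq> algebra_module av scale act ..

sublocale order_module \<subseteq> Gv: subring_module act G
  by unfold_locales (simp_all add: G_one G_add G_mult G_minus)

context order_module
begin

lemma shv_closed: "Gv.sm N \<Longrightarrow> 0 \<le> k \<Longrightarrow> v \<in> N \<Longrightarrow> shv k v \<in> N"
  unfolding shv_def by (intro Gv.sm_act G_sh G_one)

lemma shv_closed_mono:
  assumes "Gv.sm N" "shv k v \<in> N" "k \<le> l"
  shows "shv l v \<in> N"
  using shv_closed[OF assms(1) _ assms(2), of "l - k"] assms(3) by simp

lemma shv_image_subset: "Gv.sm N \<Longrightarrow> 0 \<le> k \<Longrightarrow> shv k ` N \<subseteq> N"
  using shv_closed by blast

lemma shv_image_sm:
  assumes "Gv.sm N"
  shows "Gv.sm (shv k ` N)"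
proof (rule Gv.smI)
  show "0 \<in> shv k ` N" using Gv.sm_zero[OF assms] by force
  show "x + y \<in> shv k ` N" if "x \<in> shv k ` N" "y \<in> shv k ` N" for x y
    using that Gv.sm_add[OF assms] by (auto simp: shv_add[symmetric])
  show "act a x \<in> shv k ` N" if "a \<in> G" "x \<in> shv k ` N" for a x
    using that Gv.sm_act[OF assms] by (auto simp: act_shv)
qed

lemma finite_quot_shv_1:
  assumes "fin_gen G act N"
  shows "finite (quot_set N (shv 1 ` N))"
proof -
  have "finite (quot_set N (act (sh 1 1) ` N))"
  proof (rule Gv.fin_gen_quotient_finite[OF _ _ _ _ assms])
    show "act (sh 1 1) (act a x) = act a (act (sh 1 1) x)" for a x
      by (simp add: act_sh act_shv)
    show "finite (quot_set G ((*) (sh 1 1) ` G))"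
      using finite_G_sh_1 by (simp add: sh_mult_left)
    show "sh 1 1 \<in> G" by (simp add: G_sh G_one)
  qed (simp add: sh_mult_left sh_mult_right)
  then show ?thesis by (simp add: shv_def)
qed

lemma finite_quot_shv:
  assumes "fin_gen G act N"
  shows "finite (quot_set N (shv (int n) ` N))"
proof (induction n)
  case 0
  then show ?case using Gv.sm_subgroup[OF Gv.fin_gen_sm[OF assms]] by (simp add: quot_set_self)
next
  case (Suc n)
  have sm: "Gv.sm N" using Gv.fin_gen_sm[OF assms] .
  have eq: "shv (int n) ` shv 1 ` N = shv (int (Suc n)) ` N"
    by (auto simp: image_image algebra_simps)
  have "finite (quot_set (shv (int n) ` N) (shv (int n) ` shv 1 ` N))"
    using finite_quot_shv_1[OF assms] shv_image_subset[OF sm, of 1] Gv.sm_subgroup[OF sm]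
    by (subst finite_quot_set_image) (auto simp: shv_add shv_inj intro!: inj_onI)
  moreover have "shv (int (Suc n)) ` N \<subseteq> shv (int n) ` N"
    unfolding eq[symmetric] using shv_image_subset[OF sm, of 1] by (intro image_mono) simp
  ultimately show ?case
    using Suc shv_image_subset[OF sm, of "int n"]
    unfolding eq by (subst finite_quot_set_tower[of _ "shv (int n) ` N"])
      (auto intro: shv_subgroup Gv.sm_subgroup[OF sm])
qed

text \<open>1 - p^d has absolute value 1, so it is a unit of \<open>R\<close> and can be divided
  out.\<close>

lemma unit_multiple_closed:
  assumes sm: "Gv.sm Y" and "0 < d" "v - shv d v \<in> Y"
  shows "v \<in> Y"
proof -
  define u where "u = 1 - unif powi d"
  have lt: "av (unif powi d) < 1"
  proof -
    have "\<not> av unif powi 0 \<le> av unif powi d" unfolding powi_unif_le_iff using assms(2) by simp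
    then show ?thesis by (simp add: av_powi)
  qed
  have "av u \<le> 1" using av_diff[of 1 "unif powi d"] lt by (simp add: u_def)
  moreover have "1 \<le> av u"
    using av_ultrametric[of u "unif powi d"] lt by (simp add: u_def)
  ultimately have u: "av u = 1" by simp
  then have "scale (inverse u) 1 \<in> G" using R_unit G_scale G_one by blast
  then have "act (scale (inverse u) 1) (v - shv d v) \<in> Y"
    using assms by (intro Gv.sm_act)
  moreover have "v - shv d v = act (scale u 1) v"
    by (simp add: u_def scale_left_diff_distrib act_diff_left shv_def sh_def)
  moreover have "u \<noteq> 0" using u by auto
  ultimately show ?thesis by (simp add: act_mult[symmetric] scale_eq_mult)
qed

text \<open>Pigeonhole on v, p v, ..., p^n v with n the index of \<open>Y\<close>: two of them agree
  modulo \<open>Y\<close>, so a unit multiple of some p^i v lies in \<open>Y\<close>. Finite index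
  thus forces a power of p to kill the quotient, with an exponent depending on the index
  alone.\<close>

lemma finite_index_contains_shv:
  assumes N: "Gv.sm N" and Y: "Gv.sm Y" "Y \<subseteq> N" and fin: "finite (quot_set N Y)"
  shows "shv (int (quot_index N Y)) ` N \<subseteq> Y"
proof
  fix w assume "w \<in> shv (int (quot_index N Y)) ` N"
  then obtain v where v: "v \<in> N" "w = shv (int (quot_index N Y)) v" by blast
  define f where "f i = shv (int i) v +o Y" for i
  have "f ` {..quot_index N Y} \<subseteq> quot_set N Y"
    using shv_closed[OF N _ v(1)] by (auto simp: f_def quot_set_def)
  then have "card (f ` {..quot_index N Y}) \<le> quot_index N Y"
    unfolding quot_index_def by (intro card_mono fin)
  then have "\<not> inj_on f {..quot_index N Y}"
    using card_image[of f "{..quot_index N Y}"] by auto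
  then obtain i j where ij: "i < j" "i \<le> quot_index N Y" "f i = f j"
    unfolding inj_on_def by (metis atMost_iff linorder_neqE_nat)
  then have "shv (int i) v - shv (int j - int i) (shv (int i) v) \<in> Y"
    using coset_eq_iff[OF Gv.sm_subgroup[OF Y(1)]] by (simp add: f_def)
  then have "shv (int i) v \<in> Y"
    by (rule unit_multiple_closed[OF Y(1), rotated]) (use ij(1) in simp)
  then show "w \<in> Y" unfolding v(2) by (rule shv_closed_mono[OF Y(1)]) (use ij in simp)
qed

lemma finite_quot_between:
  assumes "fin_gen G act N" "Gv.sm Z" "Z \<subseteq> N" "shv (int k) ` N \<subseteq> Z"
  shows "finite (quot_set N Z)"
proof -
  have N: "Gv.sm N" using Gv.fin_gen_sm[OF assms(1)] .
  show ?thesis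
    using finite_quot_set_tower[of N Z "shv (int k) ` N"] finite_quot_shv[OF assms(1), of k] assms
      Gv.sm_subgroup[OF N] Gv.sm_subgroup[OF assms(2)] Gv.sm_subgroup[OF shv_image_sm[OF N]]
    by blast
qed

lemma image_gen:
  assumes add: "\<And>x y. f (x + y) = f x + f y" and lin: "\<And>a x. a \<in> G \<Longrightarrow> f (act a x) = act a (f x)"
  shows "f ` Gv.gen F = Gv.gen (f ` F)"
proof
  have f0: "f 0 = 0" using add[of 0 0] by simp
  have "Gv.gen F \<subseteq> {v. f v \<in> Gv.gen (f ` F)}"
    using Gv.gen_inc[of "f ` F"] Gv.sm_zero[OF Gv.sm_gen] Gv.sm_add[OF Gv.sm_gen]
      Gv.sm_act[OF Gv.sm_gen]
    by (intro Gv.gen_minimal Gv.smI) (auto simp: add lin f0)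
  then show "f ` Gv.gen F \<subseteq> Gv.gen (f ` F)" by blast
  have "Gv.sm (f ` Gv.gen F)"
  proof (rule Gv.smI)
    show "0 \<in> f ` Gv.gen F" using Gv.sm_zero[OF Gv.sm_gen, of F] f0 by force
    show "x + y \<in> f ` Gv.gen F" if "x \<in> f ` Gv.gen F" "y \<in> f ` Gv.gen F" for x y
      using that Gv.sm_add[OF Gv.sm_gen] by (auto simp: add[symmetric])
    show "act a x \<in> f ` Gv.gen F" if "a \<in> G" "x \<in> f ` Gv.gen F" for a x
      using that Gv.sm_act[OF Gv.sm_gen] by (auto simp: lin[symmetric])
  qed
  then show "Gv.gen (f ` F) \<subseteq> f ` Gv.gen F"
    using Gv.gen_inc[of F] by (intro Gv.gen_minimal) auto
qed

lemma fin_gen_image: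
  assumes "\<And>x y. f (x + y) = f x + f y" "\<And>a x. a \<in> G \<Longrightarrow> f (act a x) = act a (f x)"
    and "fin_gen G act N"
  shows "fin_gen G act (f ` N)"
  using image_gen[of f] assms unfolding fin_gen_def by (metis finite_imageI)

lemma fin_gen_between:
  assumes "fin_gen G act N" "Gv.sm Z" "Z \<subseteq> N" "shv (int k) ` N \<subseteq> Z"
  shows "fin_gen G act Z"
proof (rule Gv.gen_mono_ext[OF assms(2) _ assms(4)])
  have N: "Gv.sm N" using Gv.fin_gen_sm[OF assms(1)] .
  show "Gv.sm (shv (int k) ` N)" by (rule shv_image_sm[OF N])
  show "fin_gen G act (shv (int k) ` N)"
    by (rule fin_gen_image[OF _ _ assms(1)]) (simp_all add: shv_add act_shv)
  show "finite (quot_set Z (shv (int k) ` N))"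
    using finite_quot_set_tower[of N Z "shv (int k) ` N"] finite_quot_shv[OF assms(1), of k] assms
      Gv.sm_subgroup[OF N] Gv.sm_subgroup[OF assms(2)] Gv.sm_subgroup[OF shv_image_sm[OF N]]
    by blast
qed

lemma fin_gen_bounded_image:
  assumes add: "\<And>x y. f (x + y) = f x + f y" and lin: "\<And>a x. a \<in> G \<Longrightarrow> f (act a x) = a * f x"
    and "fin_gen G act N"
  shows "\<exists>k. \<forall>n\<in>N. sh k (f n) \<in> G"
proof -
  obtain F where F: "finite F" "Gv.gen F = N" using assms(3) by (auto simp: fin_gen_def)
  have f0: "f 0 = 0" using add[of 0 0] by simp
  from F(1) have "\<exists>k. \<forall>n\<in>F. sh k (f n) \<in> G"
  proof induction
    case (insert x F)
    then obtain k where k: "\<forall>n\<in>F. sh k (f n) \<in> G" by blast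
    obtain l where l: "sh l (f x) \<in> G" using G_absorb by blast
    have "\<forall>n\<in>insert x F. sh (max k l) (f n) \<in> G"
      using k G_sh_mono[OF _ max.cobounded1] G_sh_mono[OF l max.cobounded2] by blast
    then show ?case by blast
  qed simp
  then obtain k where k: "\<And>n. n \<in> F \<Longrightarrow> sh k (f n) \<in> G" by blast
  have "Gv.gen F \<subseteq> {n. sh k (f n) \<in> G}"
    by (intro Gv.gen_minimal Gv.smI)
      (auto simp: k add lin sh_add f0 sh_mult_right[symmetric] intro: G_zero G_add G_mult)
  then show ?thesis using F(2) by blast
qed

end

section \<open>Primitive idempotents and simple direct summands\<close>

section \<open>Semisimplicity\<close>

text \<open>A complement of a proper left ideal \<open>Q\<close> contains a minimal left ideal, by
  dimension. That ideal is a direct summand, hence A e with \<open>e\<close> primitive, and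
  \<open>e\<close> lies outside \<open>Q\<close>.\<close>

lemma (in fd_semisimple_algebra) prims_generate:
  assumes Q: "is_submodule UNIV (*) Q" and prims: "\<And>e::'a. prim e \<Longrightarrow> e \<in> Q"
  shows "Q = UNIV"
proof (rule ccontr)
  assume "Q \<noteq> UNIV"
  interpret U: subring_module "(*) :: 'a \<Rightarrow> 'a \<Rightarrow> 'a" UNIV
    by unfold_locales (auto simp: algebra_simps)
  obtain Bs where "finite_dimensional_vector_space scale Bs" using finite_dim by blast
  then interpret fd: finite_dimensional_vector_space scale Bs .
  obtain Q' where Q': "U.sm Q'" "Q \<inter> Q' = {0}" "Q + Q' = UNIV"
    using semisimple Q unfolding semisimple_ring_def by blast
  have "Q' \<noteq> {0}" using Q'(3) \<open>Q \<noteq> UNIV\<close> by (auto simp: set_plus_def)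
  define P where "P S \<longleftrightarrow> U.sm S \<and> S \<subseteq> Q' \<and> S \<noteq> {0}" for S
  have "P Q'" using Q'(1) \<open>Q' \<noteq> {0}\<close> by (simp add: P_def)
  then obtain S where S: "P S" "\<And>T. P T \<Longrightarrow> dim S \<le> dim T"
    using ex_has_least_nat[of P Q' dim] by blast
  have span_eq: "span T = T" if "U.sm T" for T
  proof -
    have "subspace T"
    proof (rule subspaceI)
      show "scale c x \<in> T" if "x \<in> T" for c x
        using U.sm_act[OF \<open>U.sm T\<close>, of "scale c 1" x] that by (simp add: scale_mult_left)
    qed (use that U.sm_zero U.sm_add in auto)
    then show ?thesis by simp
  qed
  have min: "T = S" if "P T" "T \<subseteq> S" for T
  proof (rule ccontr)
    assume "T \<noteq> S"
    then have "T \<subset> S" using that(2) by blast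
    then have "span T \<subset> span S" using that(1) S(1) span_eq unfolding P_def by metis
    from fd.dim_psubset[OF this] show False using S(2)[OF that(1)] by simp
  qed
  obtain S' where S': "U.sm S'" "S \<inter> S' = {0}" "S + S' = UNIV"
    using semisimple S(1) unfolding semisimple_ring_def P_def by blast
  \<comment> \<open>The component of 1 in \<open>S\<close> is a right identity on
    \<open>S\<close>.\<close>
  obtain e e' where e: "1 = e + e'" "e \<in> S" "e' \<in> S'"
    using S'(3) by (metis UNIV_I set_plus_elim)
  have smS: "U.sm S" using S(1) by (simp add: P_def)
  have s_e: "s * e = s" if "s \<in> S" for s
  proof -
    have "s = s * e + s * e'" using e(1) by (metis distrib_left mult.right_neutral)
    then have "s - s * e = s * e'" by (simp add: algebra_simps)
    moreover have "s - s * e \<in> S" using U.sm_diff[OF smS that] U.sm_act[OF smS _ e(2)] by simp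
    moreover have "s * e' \<in> S'" using U.sm_act[OF S'(1) _ e(3)] by simp
    ultimately have "s - s * e \<in> S \<inter> S'" by simp
    then show ?thesis using S'(2) by simp
  qed
  have "prim e"
    unfolding prim_def
  proof (intro conjI allI impI)
    show "e * e = e" using s_e e(2) .
    show "e \<noteq> 0"
    proof
      assume "e = 0"
      then have "S = {0}" using s_e U.sm_zero[OF smS] by fastforce
      then show False using S(1) by (simp add: P_def)
    qed
    fix a assume nz: "a * e \<noteq> 0"
    let ?T = "(\<lambda>b. b * (a * e)) ` UNIV"
    have "?T \<subseteq> S" using U.sm_act[OF smS _ e(2)] by (auto simp: mult.assoc[symmetric])
    moreover have "a * e \<in> ?T" by (rule image_eqI[of _ _ 1]) auto
    then have "?T \<noteq> {0}" using nz by blast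
    ultimately have "P ?T" "?T \<subseteq> S"
      using U.sm_cyclic[of "a * e"] S(1) by (auto simp only: P_def)
    then have "?T = S" by (rule min)
    then show "\<exists>a'. a' * (a * e) = e" using e(2) by (metis imageE)
  qed
  then have "e \<in> Q \<inter> Q'" using prims e(2) S(1) by (auto simp: P_def)
  then show False using Q'(2) \<open>prim e\<close> by (simp add: prim_def)
qed

text \<open>The elements carrying \<open>v\<close> into \<open>W\<close> form a left ideal; if it
  contained all primitive idempotents, it would contain 1.\<close>

lemma (in algebra_module) prim_outside_submodule:
  assumes W: "is_submodule UNIV act W" and v: "v \<notin> W"
  shows "\<exists>e. prim e \<and> act e v \<notin> W"
proof (rule ccontr)
  interpret Av: subring_module act UNIV by unfold_locales auto
  assume neg: "\<not> ?thesis"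
  have "{a. act a v \<in> W} = UNIV"
  proof (rule prims_generate)
    show "is_submodule UNIV (*) {a. act a v \<in> W}"
      using Av.sm_zero[OF W] Av.sm_add[OF W] Av.sm_act[OF W]
      by (auto simp: is_submodule_def act_add_left act_mult intro: exI[of _ 0])
  qed (use neg in blast)
  then show False using v act_one[of v] by (metis (mono_tags) UNIV_I mem_Collect_eq)
qed

text \<open>A submodule maximal among those avoiding \<open>x\<close> is a complement of the simple module \<open>A x\<close>.\<close>

lemma (in algebra_module) retraction_onto_simple:
  assumes e: "prim e" and x: "act e x = x" "x \<noteq> 0"
  shows "\<exists>r. (\<forall>u v. r (u + v) = r u + r v) \<and> (\<forall>a v. r (act a v) = a * r v) \<and>
    (\<forall>v. r v * e = r v) \<and> r x = e"
proof -
  interpret Av: subring_module act UNIV by unfold_locales auto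
  define \<A> where "\<A> = {W. Av.sm W \<and> x \<notin> W}"
  have "{0} \<in> \<A>" using Av.sm_singleton_zero x(2) by (simp add: \<A>_def)
  moreover have "\<Union>\<C> \<in> \<A>" if C: "\<C> \<noteq> {}" "subset.chain \<A> \<C>" for \<C>
  proof -
    have sub: "\<And>W. W \<in> \<C> \<Longrightarrow> Av.sm W \<and> x \<notin> W"
      using C(2) by (auto simp: subset.chain_def \<A>_def)
    have "Av.sm (\<Union>\<C>)"
    proof (rule Av.smI)
      show "0 \<in> \<Union>\<C>" using C(1) sub Av.sm_zero by blast
      show "act a v \<in> \<Union>\<C>" if "v \<in> \<Union>\<C>" for a v using that sub Av.sm_act by blast
      fix u v assume "u \<in> \<Union>\<C>" "v \<in> \<Union>\<C>"
      then obtain W1 W2 where W: "W1 \<in> \<C>" "W2 \<in> \<C>" "u \<in> W1" "v \<in> W2" by blast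
      then have "W1 \<subseteq> W2 \<or> W2 \<subseteq> W1" using C(2) by (auto simp: subset.chain_def)
      then show "u + v \<in> \<Union>\<C>" using W sub Av.sm_add by blast
    qed
    then show ?thesis using sub by (auto simp: \<A>_def)
  qed
  ultimately obtain W where W: "W \<in> \<A>" "\<And>X. X \<in> \<A> \<Longrightarrow> W \<subseteq> X \<Longrightarrow> X = W"
    using subset_Zorn_nonempty[of \<A>] by blast
  have smW: "Av.sm W" and xW: "x \<notin> W" using W(1) by (auto simp: \<A>_def)
  define sum where "sum y = {w + u |w u. w \<in> W \<and> u \<in> range (\<lambda>a. act a y)}" for y
  have sm_sum: "Av.sm (sum y)" for y
    unfolding sum_def by (rule Av.sm_sum[OF smW Av.sm_cyclic])
  have sumI: "w + act a y \<in> sum y" if "w \<in> W" for w a y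
    using that unfolding sum_def by blast
  have W_sum: "W \<subseteq> sum y" for y
    using sumI[of _ 0 y] by auto
  have y_sum: "y \<in> sum y" for y
    using sumI[OF Av.sm_zero[OF smW], of 1 y] by simp
  \<comment> \<open>A nonzero difference of two coefficients in A e could be multiplied to
    \<open>e\<close>, which would put x into \<open>W\<close>. Uniqueness makes the coefficient of
    \<open>x\<close> modulo \<open>W\<close> a linear function of the vector.\<close>
  have uniq: "s = s'" if "s * e = s" "s' * e = s'" "v - act s x \<in> W" "v - act s' x \<in> W" for v s s'
  proof (rule ccontr)
    assume "s \<noteq> s'"
    then have "(s - s') * e \<noteq> 0" using that by (simp add: left_diff_distrib)
    then obtain b where b: "b * ((s - s') * e) = e" using e unfolding prim_def by blast
    have "act (s - s') x = (v - act s' x) - (v - act s x)" by (simp add: act_diff_left)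
    then have "act (s - s') x \<in> W" using Av.sm_diff[OF smW that(4,3)] by simp
    then have "act b (act ((s - s') * e) x) \<in> W" using Av.sm_act[OF smW] x(1) by (simp add: act_mult)
    then show False using b x(1) xW by (simp add: act_mult[symmetric])
  qed
  \<comment> \<open>Exchange argument: a vector y = h v outside W + A x generates a simple module;
    maximality of \<open>W\<close> puts x into W + A y, and simplicity reverses this to y in W + A
    x.\<close>
  have "sum x = UNIV"
  proof (rule ccontr)
    assume "sum x \<noteq> UNIV"
    then obtain v h where h: "prim h" "act h v \<notin> sum x"
      using prim_outside_submodule[OF sm_sum[of x]] by blast
    define y where "y = act h v"
    have "y \<notin> W" using h(2) W_sum[of x] by (auto simp: y_def)
    then have "sum y \<notin> \<A>" using W(2)[OF _ W_sum] y_sum by blast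
    then have "x \<in> sum y" using sm_sum by (simp add: \<A>_def)
    then obtain w a where wa: "w \<in> W" "x = w + act a y" by (auto simp: sum_def)
    have hy: "act h y = y" using h(1) by (simp add: y_def act_mult[symmetric] prim_def)
    have "a * h \<noteq> 0"
    proof
      assume "a * h = 0"
      then have "act a y = 0" using hy by (metis act_mult act_zero_left)
      then show False using wa xW by simp
    qed
    then obtain b where b: "b * (a * h) = h" using h(1) unfolding prim_def by blast
    have "y = act (b * (a * h)) y" using b hy by simp
    also have "\<dots> = act b (act a y)" using hy by (simp add: act_mult)
    also have "\<dots> = act b (- w) + act b x" using wa(2) by (simp add: act_add_right[symmetric])
    also have "\<dots> \<in> sum x"
      using Av.sm_act[OF smW _ Av.sm_minus[OF smW wa(1)], of b] unfolding sum_def by blast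
    finally show False using h(2) by (simp add: y_def)
  qed
  have ex: "\<exists>s. s * e = s \<and> v - act s x \<in> W" for v
  proof -
    have "v \<in> sum x" using \<open>sum x = UNIV\<close> by blast
    then obtain w a where "w \<in> W" "v = w + act a x" by (auto simp: sum_def)
    then have "v - act (a * e) x \<in> W" using x(1) by (simp add: act_mult)
    moreover have "a * e * e = a * e" using e by (simp add: prim_def mult.assoc)
    ultimately show ?thesis by blast
  qed
  then obtain r where r: "\<And>v. r v * e = r v" "\<And>v. v - act (r v) x \<in> W" by metis
  have "r (u + v) = r u + r v" for u v
  proof (rule uniq[of _ _ "u + v"])
    have "u + v - act (r u + r v) x = (u - act (r u) x) + (v - act (r v) x)"
      by (simp add: act_add_left)
    then show "u + v - act (r u + r v) x \<in> W" using Av.sm_add[OF smW r(2) r(2)] by metis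
  qed (simp_all add: r distrib_right)
  moreover have "r (act a v) = a * r v" for a v
  proof (rule uniq[of _ _ "act a v"])
    have "act a v - act (a * r v) x = act a (v - act (r v) x)"
      by (simp add: act_mult act_diff_right)
    then show "act a v - act (a * r v) x \<in> W" using Av.sm_act[OF smW _ r(2)] by simp
  qed (simp_all add: r mult.assoc)
  moreover have "r x = e"
    by (rule uniq[of _ _ x]) (use e x r Av.sm_zero[OF smW] in \<open>simp_all add: prim_def\<close>)
  ultimately show ?thesis using r(1) by blast
qed

section \<open>Splitting off cyclic summands, and isomorphisms that are trivial modulo a
  sublattice\<close>

section \<open>Lattices over maximal orders\<close>

locale maximal_order_module = maximal_order av scale G + left_module act
  for av :: "'k::field \<Rightarrow> real" and scale :: "'k \<Rightarrow> 'a::ring_1 \<Rightarrow> 'a" and G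
    and act :: "'a \<Rightarrow> 'v::ab_group_add \<Rightarrow> 'v"

sublocale maximal_order_module \<subseteq> order_module ..

lemma card_image_cong_kernel:
  assumes "\<And>x y. x \<in> A \<Longrightarrow> y \<in> A \<Longrightarrow> f x = f y \<longleftrightarrow> g x = g y"
  shows "card (f ` A) = card (g ` A)"
proof (rule bij_betw_same_card)
  show "bij_betw (\<lambda>c. g (inv_into A f c)) (f ` A) (g ` A)"
  proof (rule bij_betw_imageI)
    have eq: "g (inv_into A f (f x)) = g x" if "x \<in> A" for x
      using that assms[of "inv_into A f (f x)" x] f_inv_into_f[of "f x" f A] inv_into_into[of "f x" f A]
      by auto
    show "inj_on (\<lambda>c. g (inv_into A f c)) (f ` A)"
      using eq assms by (auto intro!: inj_onI)
    show "(\<lambda>c. g (inv_into A f c)) ` f ` A = g ` A"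
      using eq by (auto simp: image_image)
  qed
qed

context maximal_order_module
begin

text \<open>\<open>f\<close> is a linear map into the simple A e, sending \<open>N\<close> onto G e
  and \<open>z\<close> to \<open>e\<close>. So \<open>N\<close> is the direct sum of G z, a copy of
  G e, and the kernel of \<open>f\<close> on \<open>N\<close>. As \<open>f\<close> is defined on the
  whole module, negative powers of p may be inserted.\<close>

definition splitting :: "'v set \<Rightarrow> 'a \<Rightarrow> ('v \<Rightarrow> 'a) \<Rightarrow> 'v \<Rightarrow> bool" where
  "splitting N e f z \<longleftrightarrow> prim e \<and> e \<in> G \<and> z \<in> N \<and> act e z = z \<and> f z = e \<and>
     (\<forall>n\<in>N. f n \<in> G) \<and> (\<forall>v. f v * e = f v) \<and>
     (\<forall>u v. f (u + v) = f u + f v) \<and> (\<forall>a v. f (act a v) = a * f v)"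

text \<open>A nonzero h v generates a simple module. Conjugating \<open>h\<close> into the order
  gives \<open>e\<close> in \<open>G\<close> and a vector x generating the same module. The
  retraction onto A x sends \<open>N\<close> to a sublattice of A e, which is cyclic, and right
  division by its generator \<open>w\<close> turns it into G e.\<close>

lemma splitting_exists:
  assumes fg: "fin_gen G act N" and "N \<noteq> {0}"
  shows "\<exists>e f z. splitting N e f z"
proof -
  have N: "Gv.sm N" using Gv.fin_gen_sm[OF fg] .
  obtain v where v: "v \<in> N" "v \<noteq> 0" using Gv.sm_zero[OF N] assms(2) by blast
  interpret Av: subring_module act UNIV by unfold_locales auto
  obtain h where h: "prim h" "act h v \<noteq> 0"
    using prim_outside_submodule[OF Av.sm_singleton_zero, of v] v(2) by auto
  interpret H: maximal_order_idempotent av scale G h by unfold_locales (rule h(1))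
  obtain b t where bt: "b * t = h" "h * b = b" "t * h = t" "t * b \<in> G"
    using H.conjugate_in_order by blast
  define e where "e = t * b"
  have e: "prim e" "e \<in> G" using prim_conjugate[OF h(1) bt(1-3)] bt(4) by (auto simp: e_def)
  interpret E: order_idempotent av scale G e by unfold_locales (rule e)+
  define x where "x = act t (act h v)"
  have "act e x = act (t * (b * t) * h) v" by (simp add: x_def e_def act_mult mult.assoc)
  also have "\<dots> = act (t * h * h) v" using bt(1) by simp
  also have "\<dots> = x" by (simp add: x_def act_mult[symmetric] bt(3))
  finally have ex: "act e x = x" .
  have "act b x = act (b * t * h) v" by (simp add: x_def act_mult)
  also have "\<dots> = act h v" using bt(1) H.idem by simp
  finally have "x \<noteq> 0" using h(2) by auto
  obtain r where r: "\<And>u v. r (u + v) = r u + r v" "\<And>a v. r (act a v) = a * r v"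
    "\<And>v. r v * e = r v" "r x = e"
    using retraction_onto_simple[OF e(1) ex \<open>x \<noteq> 0\<close>] by blast
  have "r v \<noteq> 0"
  proof
    assume "r v = 0"
    then have "r x = 0" unfolding x_def r(2) by simp
    then show False using r(4) E.e_nonzero by simp
  qed
  obtain k where k: "\<And>n. n \<in> N \<Longrightarrow> sh k (r n) \<in> G"
    using fin_gen_bounded_image[of r N] r fg by blast
  have "\<exists>w\<in>E.D. w \<noteq> 0 \<and> r ` N = E.cyc w"
  proof (rule E.sublattice_cyclic)
    show "a * u \<in> r ` N" if "a \<in> G" "u \<in> r ` N" for a u
      using that Gv.sm_act[OF N] by (auto simp: r(2)[symmetric])
    show "r v \<in> r ` N" using v by blast
  qed (use r k \<open>r v \<noteq> 0\<close> in auto)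
  then obtain w where w: "w \<in> E.D" "w \<noteq> 0" "r ` N = E.cyc w" by blast
  obtain w' where w': "w' \<in> E.D" "w * w' = e" using E.D_inverse w by blast
  define f where "f n = r n * w'" for n
  have "w \<in> r ` N" unfolding w(3) E.cyc_def using G_one by force
  then obtain n0 where n0: "n0 \<in> N" "f n0 = e" using w'(2) by (auto simp: f_def)
  have "f n \<in> G" if "n \<in> N" for n
  proof -
    have "r n \<in> E.cyc w" using that w(3) by blast
    then obtain a where "a \<in> G" "r n = a * w" by (auto simp: E.cyc_def)
    then have "f n = a * e" using w'(2) by (simp add: f_def mult.assoc)
    then show ?thesis using \<open>a \<in> G\<close> e(2) G_mult by simp
  qed
  moreover have "f v * e = f v" for v
    using E.D_right[OF w'(1)] by (simp add: f_def mult.assoc)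
  moreover have lin: "f (act a v) = a * f v" for a v by (simp add: f_def r mult.assoc)
  moreover have "f (u + v) = f u + f v" for u v by (simp add: f_def r distrib_right)
  moreover have "f (act e n0) = e" using lin n0(2) E.idem by simp
  moreover have "act e n0 \<in> N" using Gv.sm_act[OF N e(2) n0(1)] .
  moreover have "act e (act e n0) = act e n0" by (simp add: act_mult[symmetric] E.idem)
  ultimately have "splitting N e f (act e n0)" using e by (simp add: splitting_def)
  then show ?thesis by blast
qed

text \<open>The size of N / p N plays the part of a rank. The quotient for the kernel embeds into it
  and misses the class of \<open>z\<close>: otherwise \<open>f\<close> would send some p^(-1) (z -
  n1) in \<open>N\<close> to p^(-1) e, of norm greater than 1, although it maps \<open>N\<close>
  into \<open>G\<close>.\<close>

lemma splitting_kernel: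
  assumes fg: "fin_gen G act N" and s: "splitting N e f z"
  shows "fin_gen G act {n\<in>N. f n = 0}"
    and "quot_index {n\<in>N. f n = 0} (shv 1 ` {n\<in>N. f n = 0}) < quot_index N (shv 1 ` N)"
proof -
  have N: "Gv.sm N" using Gv.fin_gen_sm[OF fg] .
  have s': "prim e" "e \<in> G" "z \<in> N" "f z = e" "\<And>n. n \<in> N \<Longrightarrow> f n \<in> G" "\<And>v. f v * e = f v"
    "\<And>u v. f (u + v) = f u + f v" "\<And>a v. f (act a v) = a * f v"
    using s by (auto simp: splitting_def)
  interpret E: order_idempotent av scale G e by unfold_locales (rule s')+
  have f_diff: "f (u - v) = f u - f v" for u v
    using s'(7)[of "u - v" v] by simp
  define N1 where "N1 = {n\<in>N. f n = 0}"
  define pr where "pr n = n - act (f n) z" for n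
  have pr_N1: "pr n \<in> N1" if "n \<in> N" for n
    using that s' Gv.sm_diff[OF N] Gv.sm_act[OF N] by (simp add: pr_def N1_def f_diff)
  have "pr ` N = N1"
  proof
    have "pr n = n" if "n \<in> N1" for n using that by (simp add: pr_def N1_def)
    then show "N1 \<subseteq> pr ` N" unfolding N1_def by force
  qed (use pr_N1 in blast)
  moreover have "fin_gen G act (pr ` N)"
    by (rule fin_gen_image[OF _ _ fg])
      (simp_all add: pr_def s' act_add_left act_mult act_diff_right)
  ultimately show "fin_gen G act {n\<in>N. f n = 0}" by (simp add: N1_def)
  then have N1: "Gv.sm N1" using Gv.fin_gen_sm by (simp add: N1_def)
  have f_shv: "f (shv k n) = sh k (f n)" for k n
    by (simp add: shv_def s' sh_mult_left)
  have sub: "is_add_subgroup (shv 1 ` N)" "is_add_subgroup (shv 1 ` N1)"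
    using N N1 Gv.sm_subgroup shv_subgroup by blast+
  have "x +o shv 1 ` N1 = y +o shv 1 ` N1 \<longleftrightarrow> x +o shv 1 ` N = y +o shv 1 ` N"
    if "x \<in> N1" "y \<in> N1" for x y
  proof -
    have "x - y \<in> N1" using Gv.sm_diff[OF N1 that] .
    then have "f (shv (- 1) (x - y)) = 0" by (simp add: f_shv N1_def)
    then show ?thesis
      by (simp only: coset_eq_iff[OF sub(1)] coset_eq_iff[OF sub(2)] mem_shv_image_iff)
        (simp add: N1_def)
  qed
  then have card_eq: "quot_index N1 (shv 1 ` N1) = card ((\<lambda>x. x +o shv 1 ` N) ` N1)"
    unfolding quot_index_def quot_set_def by (rule card_image_cong_kernel)
  have "z +o shv 1 ` N \<notin> (\<lambda>x. x +o shv 1 ` N) ` N1"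
  proof
    assume "z +o shv 1 ` N \<in> (\<lambda>x. x +o shv 1 ` N) ` N1"
    then obtain n1 where n1: "n1 \<in> N1" "z - n1 \<in> shv 1 ` N"
      using coset_eq_iff[OF sub(1)] by blast
    then have "shv (- 1) (z - n1) \<in> N" by (simp only: mem_shv_image_iff)
    then have "f (shv (- 1) (z - n1)) \<in> G" using s'(5) by blast
    moreover have "f (shv (- 1) (z - n1)) = sh (- 1) e"
      using n1(1) s'(4) by (simp add: f_shv f_diff N1_def)
    ultimately have "E.nrm (sh (- 1) e) \<le> 1"
      using E.nrm_G_le_1[OF E.D_sh[OF E.e_D]] by simp
    then show False using E.nrm_sh_less_iff by simp
  qed
  moreover have "N1 \<subseteq> N" by (auto simp: N1_def)
  then have "(\<lambda>x. x +o shv 1 ` N) ` N1 \<subseteq> quot_set N (shv 1 ` N)"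
    unfolding quot_set_def by (rule image_mono)
  moreover have "z +o shv 1 ` N \<in> quot_set N (shv 1 ` N)"
    using s'(3) by (simp add: quot_set_def)
  ultimately have "card ((\<lambda>x. x +o shv 1 ` N) ` N1) < quot_index N (shv 1 ` N)"
    unfolding quot_index_def by (intro psubset_card_mono finite_quot_shv_1[OF fg]) blast
  then show "quot_index {n\<in>N. f n = 0} (shv 1 ` {n\<in>N. f n = 0}) < quot_index N (shv 1 ` N)"
    using card_eq by (simp add: N1_def)
qed

text \<open>Peeling off one cyclic summand at a time, down to 0. The decomposition into cyclic
  lattices is used in this form, without naming the summands.\<close>

lemma lattice_induct [consumes 1, case_names zero split]:
  assumes "fin_gen G act N" and zero: "P {0}"
    and split: "\<And>N e f z. fin_gen G act N \<Longrightarrow> splitting N e f z \<Longrightarrow> P {n\<in>N. f n = 0} \<Longrightarrow> P N"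
  shows "P N"
  using assms(1)
proof (induction "quot_index N (shv 1 ` N)" arbitrary: N rule: less_induct)
  case less
  show ?case
  proof (cases "N = {0}")
    case True
    then show ?thesis using zero by simp
  next
    case False
    obtain e f z where s: "splitting N e f z" using splitting_exists[OF less.prems False] by blast
    show ?thesis
      using split[OF less.prems s less.hyps] splitting_kernel[OF less.prems s] by blast
  qed
qed

lemma splitting_residual:
  assumes "Gv.sm N" "splitting N e f z" "n \<in> N"
  shows "n - act (f n) z \<in> {n\<in>N. f n = 0}"
proof -
  have s: "z \<in> N" "f z = e" "f n \<in> G" "f n * e = f n"
    "\<And>u v. f (u + v) = f u + f v" "\<And>a v. f (act a v) = a * f v"
    using assms by (auto simp: splitting_def)
  have "f (n - act (f n) z) = 0"
    using s(5)[of "n - act (f n) z" "act (f n) z"] s by simp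
  then show ?thesis using Gv.sm_diff[OF assms(1,3)] Gv.sm_act[OF assms(1)] s by simp
qed

text \<open>Integral counterpart of the statement on modules over the algebra: a lattice is spanned
  by vectors z = e z with \<open>e\<close> a primitive idempotent in \<open>G\<close>, so one of
  these in G x must avoid \<open>Y\<close>.\<close>

lemma idempotent_outside_submodule:
  assumes x: "x \<notin> Y" and Y: "Gv.sm Y"
  shows "\<exists>e\<in>G. prim e \<and> (\<exists>a\<in>G. act e (act a x) \<notin> Y)"
proof (rule ccontr)
  assume neg: "\<not> ?thesis"
  have fg: "fin_gen G act (Gv.gen {x})" unfolding fin_gen_def by blast
  have "(\<forall>e\<in>G. \<forall>n\<in>N. prim e \<longrightarrow> act e n \<in> Y) \<longrightarrow> N \<subseteq> Y" if "fin_gen G act N" for N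
    using that
  proof (induction rule: lattice_induct)
    case zero
    then show ?case using Gv.sm_zero[OF Y] by simp
  next
    case (split N e f z)
    show ?case
    proof (intro impI subsetI)
      fix n assume a: "\<forall>e\<in>G. \<forall>n\<in>N. prim e \<longrightarrow> act e n \<in> Y" and n: "n \<in> N"
      have s: "prim e" "e \<in> G" "z \<in> N" "act e z = z" "f n \<in> G"
        using split.hyps(2) n by (auto simp: splitting_def)
      have "{n\<in>N. f n = 0} \<subseteq> Y" using split.IH a by blast
      then have "n - act (f n) z \<in> Y"
        using splitting_residual[OF Gv.fin_gen_sm[OF split.hyps(1)] split.hyps(2) n] by blast
      moreover have "act (f n) z \<in> Y" using a s Gv.sm_act[OF Y] by metis
      ultimately show "n \<in> Y" using Gv.sm_add[OF Y] by fastforce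
    qed
  qed
  from this[OF fg] have "Gv.gen {x} \<subseteq> Y" using neg by (auto simp: Gv.gen_singleton)
  then show False using x Gv.gen_inc by blast
qed

text \<open>Projectivity over a maximal order, in the case needed: the map from \<open>N\<close> to
  its classes modulo \<open>Y\<close> lifts to a map \<open>r\<close> into G e. On a summand G z it
  suffices to choose \<open>b\<close> with b x congruent to \<open>z\<close>; a final factor
  \<open>e\<close> puts the value into G e.\<close>

lemma projective_lift:
  assumes x: "act e x = x" "e \<in> G" "e * e = e" and Y: "Gv.sm Y" and fg: "fin_gen G act N"
    and cover: "\<And>n. n \<in> N \<Longrightarrow> \<exists>a\<in>G. n - act a x \<in> Y"
  shows "\<exists>r. (\<forall>n\<in>N. r n \<in> G \<and> r n * e = r n \<and> act (r n) x - n \<in> Y) \<and>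
    (\<forall>m\<in>N. \<forall>n\<in>N. r (m + n) = r m + r n) \<and> (\<forall>a\<in>G. \<forall>n\<in>N. r (act a n) = a * r n)"
  using fg cover
proof (induction rule: lattice_induct)
  case zero
  then show ?case
    by (intro exI[of _ "\<lambda>_. 0"]) (simp add: G_zero Gv.sm_zero[OF Y])
next
  case (split N h f z)
  have N: "Gv.sm N" using Gv.fin_gen_sm[OF split.hyps(1)] .
  define N1 where "N1 = {n\<in>N. f n = 0}"
  define pr where "pr n = n - act (f n) z" for n
  have s: "z \<in> N" "\<And>n. n \<in> N \<Longrightarrow> f n \<in> G" "\<And>u v. f (u + v) = f u + f v"
    "\<And>a v. f (act a v) = a * f v"
    using split.hyps(2) by (auto simp: splitting_def)
  have pr: "pr n \<in> N1" if "n \<in> N" for n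
    using splitting_residual[OF N split.hyps(2) that] by (simp add: pr_def N1_def)
  have cover: "\<exists>a\<in>G. n - act a x \<in> Y" if "n \<in> N1" for n
    using split.prems that by (simp add: N1_def)
  have "\<exists>r. (\<forall>n\<in>N1. r n \<in> G \<and> r n * e = r n \<and> act (r n) x - n \<in> Y) \<and>
      (\<forall>m\<in>N1. \<forall>n\<in>N1. r (m + n) = r m + r n) \<and> (\<forall>a\<in>G. \<forall>n\<in>N1. r (act a n) = a * r n)"
    by (rule split.IH[folded N1_def]) (rule cover)
  then obtain r
    where "\<forall>n\<in>N1. r n \<in> G \<and> r n * e = r n \<and> act (r n) x - n \<in> Y"
      "\<forall>m\<in>N1. \<forall>n\<in>N1. r (m + n) = r m + r n" "\<forall>a\<in>G. \<forall>n\<in>N1. r (act a n) = a * r n"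
    by (elim exE conjE)
  then have r: "\<And>n. n \<in> N1 \<Longrightarrow> r n \<in> G \<and> r n * e = r n \<and> act (r n) x - n \<in> Y"
    "\<And>m n. m \<in> N1 \<Longrightarrow> n \<in> N1 \<Longrightarrow> r (m + n) = r m + r n"
    "\<And>a n. a \<in> G \<Longrightarrow> n \<in> N1 \<Longrightarrow> r (act a n) = a * r n"
    by blast+
  obtain b where b: "b \<in> G" "z - act b x \<in> Y" using split.prems s(1) by blast
  define r' where "r' n = r (pr n) + f n * b * e" for n
  have "r' n \<in> G \<and> r' n * e = r' n \<and> act (r' n) x - n \<in> Y" if n: "n \<in> N" for n
  proof (intro conjI)
    show "r' n \<in> G" using r(1)[OF pr[OF n]] s(2)[OF n] b(1) x(2) by (simp add: r'_def G_add G_mult)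
    show "r' n * e = r' n"
      using r(1)[OF pr[OF n]] x(3) by (simp add: r'_def distrib_right mult.assoc)
    have "act (r' n) x - n = (act (r (pr n)) x - pr n) - act (f n) (z - act b x)"
      using x(1) by (simp add: r'_def pr_def act_add_left act_mult act_diff_right)
    then show "act (r' n) x - n \<in> Y"
      using Gv.sm_diff[OF Y _ Gv.sm_act[OF Y s(2)[OF n] b(2)]] r(1)[OF pr[OF n]] by metis
  qed
  moreover have "r' (m + n) = r' m + r' n" if "m \<in> N" "n \<in> N" for m n
  proof -
    have "pr (m + n) = pr m + pr n" by (simp add: pr_def s act_add_left)
    then show ?thesis using r(2)[OF pr pr] that by (simp add: r'_def s distrib_right)
  qed
  moreover have "r' (act a n) = a * r' n" if "a \<in> G" "n \<in> N" for a n
  proof -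
    have "pr (act a n) = act a (pr n)" by (simp add: pr_def s act_mult act_diff_right)
    then show ?thesis using r(3)[OF that(1) pr] that by (simp add: r'_def s distrib_left mult.assoc)
  qed
  ultimately show ?case by blast
qed

definition lattice_iso :: "('v \<Rightarrow> 'v) \<Rightarrow> 'v set \<Rightarrow> 'v set \<Rightarrow> bool" where
  "lattice_iso g N Y \<longleftrightarrow> bij_betw g N Y \<and> (\<forall>m\<in>N. \<forall>n\<in>N. g (m + n) = g m + g n) \<and>
     (\<forall>a\<in>G. \<forall>n\<in>N. g (act a n) = act a (g n))"

text \<open>
  For a projective cover \<open>G x\<close> of the simple module \<open>N / Y\<close> with \<open>x \<in> J\<close>, the lattice \<open>N\<close> splits
  as \<open>G x \<oplus> N'\<close> with \<open>N' \<subseteq> Y\<close>, and \<open>G x\<close> is isomorphic to its submodule \<open>G x \<inter> Y\<close>.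
\<close>

lemma maximal_sublattice_iso:
  assumes fg: "fin_gen G act N" and Y: "Gv.sm Y" "Y \<subseteq> N" and k: "shv k ` N \<subseteq> Y"
    and J: "Gv.sm J" "J \<subseteq> N" "\<not> J \<subseteq> Y"
    and max: "\<And>Z. Gv.sm Z \<Longrightarrow> Y \<subseteq> Z \<Longrightarrow> Z \<subseteq> N \<Longrightarrow> Z = Y \<or> Z = N"
  shows "\<exists>g. lattice_iso g N Y \<and> (\<forall>n\<in>N. g n - n \<in> J)"
proof -
  have N: "Gv.sm N" using Gv.fin_gen_sm[OF fg] .
  obtain x0 where x0: "x0 \<in> J" "x0 \<notin> Y" using J(3) by blast
  obtain e a0 where e: "e \<in> G" "prim e" "a0 \<in> G" "act e (act a0 x0) \<notin> Y"
    using idempotent_outside_submodule[OF x0(2) Y(1)] by blast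
  interpret E: order_idempotent av scale G e by unfold_locales (rule e)+
  define x where "x = act e (act a0 x0)"
  have xJ: "x \<in> J" using x0(1) e Gv.sm_act[OF J(1)] by (simp add: x_def)
  have xY: "x \<notin> Y" using e(4) by (simp add: x_def)
  have ex: "act e x = x" by (simp add: x_def act_mult[symmetric] E.idem mult.assoc[symmetric])
  have xN: "x \<in> N" using xJ J(2) by blast
  let ?Z = "{u + y |u y. u \<in> (\<lambda>a. act a x) ` G \<and> y \<in> Y}"
  have "Gv.sm ?Z" by (rule Gv.sm_sum[OF Gv.sm_cyclic Y(1)])
  moreover have "y \<in> ?Z" if "y \<in> Y" for y
  proof -
    have "act 0 x + y \<in> ?Z" using that G_zero by blast
    then show ?thesis by simp
  qed
  moreover have "?Z \<subseteq> N"
    using Gv.sm_add[OF N] Gv.sm_act[OF N _ xN] Y(2) by blast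
  moreover have "x \<in> ?Z"
  proof -
    have "act 1 x + 0 \<in> ?Z" using Gv.sm_zero[OF Y(1)] G_one by blast
    then show ?thesis by simp
  qed
  ultimately have Z: "?Z = N" using max xY by blast
  have cover: "\<exists>a\<in>G. n - act a x \<in> Y" if "n \<in> N" for n
  proof -
    have "n \<in> ?Z" using that Z by simp
    then obtain a y where "a \<in> G" "y \<in> Y" "n = act a x + y" by blast
    then show ?thesis by (intro bexI[of _ a]) auto
  qed
  obtain r where r: "\<And>n. n \<in> N \<Longrightarrow> r n \<in> G" "\<And>n. n \<in> N \<Longrightarrow> r n * e = r n"
    "\<And>n. n \<in> N \<Longrightarrow> act (r n) x - n \<in> Y"
    "\<And>m n. m \<in> N \<Longrightarrow> n \<in> N \<Longrightarrow> r (m + n) = r m + r n"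
    "\<And>a n. a \<in> G \<Longrightarrow> n \<in> N \<Longrightarrow> r (act a n) = a * r n"
    using projective_lift[OF ex e(1) E.idem Y(1) fg cover] by blast
  \<comment> \<open>The preimage of \<open>Y\<close> in G e. As a sublattice of A e it is cyclic,
    and its generator describes how the intersection of G x with \<open>Y\<close> sits in G
    x.\<close>
  define U where "U = {a \<in> G. a * e = a \<and> act a x \<in> Y}"
  obtain w where w: "w \<in> E.D" "w \<noteq> 0" "U = E.cyc w"
  proof -
    have "\<exists>w\<in>E.D. w \<noteq> 0 \<and> U = E.cyc w"
    proof (rule E.sublattice_cyclic)
      show "u * e = u" if "u \<in> U" for u using that by (simp add: U_def)
      show "a * u \<in> U" if "a \<in> G" "u \<in> U" for a u
        using that G_mult Gv.sm_act[OF Y(1)] by (simp add: U_def mult.assoc act_mult)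
      show "sh 0 u \<in> G" if "u \<in> U" for u using that by (simp add: U_def)
      \<comment> \<open>\<open>k\<close> may be negative, whereas membership in \<open>U\<close>
        asks for an element of \<open>G\<close>.\<close>
      have "shv (max k 0) x \<in> Y"
        by (rule shv_closed_mono[OF Y(1), of k]) (use k xN in auto)
      then show "sh (max k 0) e \<in> U"
        using G_sh[OF _ e(1), of "max k 0"] ex E.idem by (simp add: U_def sh_mult_left act_sh)
      show "sh (max k 0) e \<noteq> 0" using E.e_nonzero by simp
    qed
    then show ?thesis using that by blast
  qed
  have eU: "e \<notin> U" using xY ex by (simp add: U_def)
  have U_left: "a * u \<in> U" if "a \<in> G" "u \<in> U" for a u
    using that G_mult Gv.sm_act[OF Y(1)] by (simp add: U_def mult.assoc act_mult)
  have "r x = e * r x" using r(5)[OF e(1) xN] ex by simp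
  then have rxD: "r x \<in> E.D" using r(2)[OF xN] by (simp add: E.D_def)
  \<comment> \<open>\<open>r\<close> fixes x modulo \<open>Y\<close>, so e - r x lies in
    \<open>U\<close>. An element of \<open>D\<close> in \<open>U\<close> of norm at least 1 would
    have its inverse in \<open>G\<close> and put \<open>e\<close> into \<open>U\<close>. By the
    ultrametric inequality r x then has norm at least 1, so its inverse lies in
    \<open>G\<close>.\<close>
  define u where "u = e - r x"
  have uD: "u \<in> E.D" using rxD E.e_D by (simp add: u_def E.D_def left_diff_distrib right_diff_distrib)
  have "act u x = - (act (r x) x - x)" using ex by (simp add: u_def act_diff_left)
  then have uU: "u \<in> U"
    using r(1)[OF xN] r(3)[OF xN] e(1) uD Gv.sm_minus[OF Y(1)]
    by (simp add: U_def u_def G_diff E.D_def del: minus_diff_eq)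
  have u_lt: "E.nrm u < 1"
  proof (rule ccontr)
    assume "\<not> E.nrm u < 1"
    then have ge: "1 \<le> E.nrm u" by simp
    then have "u \<noteq> 0" by auto
    then obtain u' where u': "u' \<in> E.D" "u' * u = e" "u' \<noteq> 0" using E.D_inverse uD by blast
    have "E.nrm u' * E.nrm u = 1" using E.nrm_mult[OF u'(1) uD] u'(2) E.nrm_e by simp
    then have "E.nrm u' \<le> 1"
      using mult_left_mono[OF ge, of "E.nrm u'"] E.nrm_pos[OF u'(1,3)] by simp
    then have "u' \<in> G" using E.nrm_le_1_iff u'(1) by blast
    then show False using U_left uU u'(2) eU by metis
  qed
  have rx_ge: "1 \<le> E.nrm (r x)"
  proof (rule ccontr)
    assume lt: "\<not> 1 \<le> E.nrm (r x)"
    have "E.nrm (u + r x) < 1"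
    proof (cases "E.nrm u \<le> E.nrm (r x)")
      case True
      then show ?thesis using E.nrm_add_le[OF uD rxD] lt by simp
    next
      case False
      then show ?thesis using E.nrm_add_le[OF rxD uD] u_lt by (simp add: add.commute)
    qed
    then show False using E.nrm_e by (simp add: u_def)
  qed
  then have "r x \<noteq> 0" by auto
  then obtain s where s: "s \<in> E.D" "s \<noteq> 0" "s * r x = e" "r x * s = e"
    using E.D_inverse rxD by blast
  have "E.nrm s * E.nrm (r x) = 1" using E.nrm_mult[OF s(1) rxD] s(3) E.nrm_e by simp
  then have "E.nrm s \<le> 1"
    using mult_left_mono[OF rx_ge, of "E.nrm s"] E.nrm_pos[OF s(1,2)] by simp
  then have sG: "s \<in> G" using E.nrm_le_1_iff s(1) by blast
  \<comment> \<open>Normalized so that r' x = e. Now G x is a direct summand of \<open>N\<close>,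
    and its complement, the kernel of \<open>r'\<close>, lies in \<open>Y\<close>.\<close>
  define r' where "r' n = r n * s" for n
  have r'G: "r' n \<in> G" if "n \<in> N" for n using r(1)[OF that] sG G_mult by (simp add: r'_def)
  have r'e: "r' n * e = r' n" for n using E.D_right[OF s(1)] by (simp add: r'_def mult.assoc)
  have r'x: "r' x = e" using s(4) by (simp add: r'_def)
  have r'add: "r' (m + n) = r' m + r' n" if "m \<in> N" "n \<in> N" for m n
    using r(4)[OF that] by (simp add: r'_def distrib_right)
  have r'act: "r' (act a n) = a * r' n" if "a \<in> G" "n \<in> N" for a n
    using r(5)[OF that] by (simp add: r'_def mult.assoc)
  have r'Y: "act (r' n) x - n \<in> Y" if n: "n \<in> N" for n
  proof -
    have "act s (act (r x) x - x) = x - act s x"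
      using s(3) ex by (simp add: act_diff_right act_mult[symmetric])
    then have "x - act s x \<in> Y" using Gv.sm_act[OF Y(1) sG r(3)[OF xN]] by simp
    then have "act (r n) (x - act s x) \<in> Y" using Gv.sm_act[OF Y(1) r(1)[OF n]] by blast
    moreover have "act (r' n) x - n = (act (r n) x - n) - act (r n) (x - act s x)"
      by (simp add: r'_def act_mult act_diff_right)
    ultimately show ?thesis using Gv.sm_diff[OF Y(1) r(3)[OF n]] by metis
  qed
  have wU: "w \<in> U" unfolding w(3) E.cyc_def using G_one by force
  then have wG: "w \<in> G" by (simp add: U_def)
  \<comment> \<open>Right multiplication by \<open>w\<close> on the summand G x and the identity on
    the complement. The change is by a multiple of x, hence by an element of
    \<open>J\<close>.\<close>
  define g where "g n = n - act (r' n) x + act (r' n * w) x" for n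
  have rwG: "r' n * w \<in> G" if "n \<in> N" for n using r'G[OF that] wG G_mult by blast
  have r'diff: "r' (m - n) = r' m - r' n" if "m \<in> N" "n \<in> N" for m n
    using r'add[OF Gv.sm_diff[OF N that] that(2)] by simp
  have r'g: "r' (g n) = r' n * w" if n: "n \<in> N" for n
  proof -
    have mem: "act (r' n) x \<in> N" "act (r' n * w) x \<in> N"
      using Gv.sm_act[OF N _ xN] r'G[OF n] rwG[OF n] by auto
    have "r' (g n) = (r' n - r' n * r' x) + r' n * w * r' x"
      unfolding g_def using mem n Gv.sm_diff[OF N]
      by (simp add: r'add r'diff r'act[OF r'G[OF n] xN] r'act[OF rwG[OF n] xN])
    also have "\<dots> = r' n * w" using r'x r'e[of n] E.D_right[OF w(1)] by (simp add: mult.assoc)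
    finally show ?thesis .
  qed
  have gadd: "g (m + n) = g m + g n" if "m \<in> N" "n \<in> N" for m n
    by (simp add: g_def r'add[OF that] act_add_left distrib_right)
  have gact: "g (act a n) = act a (g n)" if "a \<in> G" "n \<in> N" for a n
    by (simp add: g_def r'act[OF that] act_add_right act_diff_right act_mult)
  have gY: "g n \<in> Y" if n: "n \<in> N" for n
  proof -
    have "act (r' n * w) x \<in> Y" using U_left[OF r'G[OF n] wU] by (simp add: U_def)
    moreover have "g n = act (r' n * w) x - (act (r' n) x - n)" by (simp add: g_def)
    ultimately show ?thesis using Gv.sm_diff[OF Y(1) _ r'Y[OF n]] by simp
  qed
  obtain w' where w': "w' \<in> E.D" "w * w' = e" using E.D_inverse w by blast
  have "inj_on g N"
  proof (rule inj_onI)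
    fix m n assume mn: "m \<in> N" "n \<in> N" "g m = g n"
    then have "r' m * w = r' n * w" using r'g by metis
    then have "r' m * e = r' n * e" using w'(2) by (metis mult.assoc)
    then have "r' m = r' n" using r'e by simp
    then show "m = n" using mn(3) by (simp add: g_def)
  qed
  moreover have "g ` N = Y"
  proof
    show "Y \<subseteq> g ` N"
    proof
      fix y assume y: "y \<in> Y"
      then have yN: "y \<in> N" using Y(2) by blast
      have "act (r' y) x \<in> Y" using Gv.sm_add[OF Y(1) r'Y[OF yN] y] by simp
      then have "r' y \<in> U" using r'G[OF yN] r'e by (simp add: U_def)
      then obtain a where a: "a \<in> G" "r' y = a * w" unfolding w(3) E.cyc_def by blast
      define b where "b = a * e"
      have b: "b \<in> G" "b * e = b" "r' y = b * w"
        using a e(1) G_mult E.idem E.D_left[OF w(1)] by (auto simp: b_def mult.assoc)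
      have bw: "b * w \<in> G" using r'G[OF yN] b(3) by simp
      \<comment> \<open>The component of \<open>y\<close> along x is b w x; replacing it by b x
        gives the preimage.\<close>
      define n where "n = y + act b x - act (b * w) x"
      have mem: "act b x \<in> N" "act (b * w) x \<in> N"
        using Gv.sm_act[OF N _ xN] b(1) bw by auto
      then have nN: "n \<in> N" unfolding n_def by (intro Gv.sm_diff[OF N] Gv.sm_add[OF N] yN)
      have "r' n = r' y + b * r' x - b * w * r' x"
        unfolding n_def using mem yN Gv.sm_add[OF N]
        by (simp add: r'add r'diff r'act[OF b(1) xN] r'act[OF bw xN])
      also have "\<dots> = b" using b r'x E.D_right[OF w(1)] by (simp add: mult.assoc)
      finally have "g n = y" by (simp add: g_def n_def)
      then show "y \<in> g ` N" using nN by blast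
    qed
  qed (use gY in blast)
  ultimately have "bij_betw g N Y" by (simp add: bij_betw_def)
  moreover have "g n - n \<in> J" if n: "n \<in> N" for n
  proof -
    have "g n - n = act (r' n * w) x - act (r' n) x" by (simp add: g_def)
    then show ?thesis
      using Gv.sm_diff[OF J(1) Gv.sm_act[OF J(1) rwG[OF n] xJ] Gv.sm_act[OF J(1) r'G[OF n] xJ]]
      by simp
  qed
  ultimately show ?thesis using gadd gact unfolding lattice_iso_def by blast
qed

text \<open>Induction on the index, through a maximal proper sublattice \<open>Z\<close> of
  \<open>N\<close> containing \<open>Y\<close>. As N = J + Y, \<open>J\<close> is not contained in
  \<open>Z\<close>, so the one-step isomorphism from \<open>N\<close> to \<open>Z\<close> is
  available; for the passage from \<open>Z\<close> to \<open>Y\<close> the modular law gives Z = (J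
  \<inter> Z) + Y.\<close>

theorem sublattice_iso:
  assumes "fin_gen G act N" "Gv.sm Y" "Y \<subseteq> N" "finite (quot_set N Y)"
    and "Gv.sm J" "J \<subseteq> N" "\<And>n. n \<in> N \<Longrightarrow> \<exists>j\<in>J. n - j \<in> Y"
  shows "\<exists>g. lattice_iso g N Y \<and> (\<forall>n\<in>N. g n - n \<in> J)"
  using assms
proof (induction "quot_index N Y" arbitrary: N J rule: less_induct)
  case less
  have N: "Gv.sm N" using Gv.fin_gen_sm[OF less.prems(1)] .
  note Y = less.prems(2,3) and fin = less.prems(4) and J = less.prems(5-7)
  note subgroups = Gv.sm_subgroup[OF N] Gv.sm_subgroup[OF Y(1)]
  show ?case
  proof (cases "N = Y")
    case True
    then have "lattice_iso id N Y" by (simp add: lattice_iso_def)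
    then show ?thesis using Gv.sm_zero[OF J(1)] by force
  next
    case False
    define P where "P Z \<longleftrightarrow> Gv.sm Z \<and> Y \<subseteq> Z \<and> Z \<subseteq> N \<and> Z \<noteq> N" for Z
    have "P Y" using Y False by (simp add: P_def)
    then obtain Z where PZ: "P Z" and minZ: "\<And>Z'. P Z' \<Longrightarrow> quot_index N Z \<le> quot_index N Z'"
      using ex_has_least_nat[of P Y "quot_index N"] by blast
    have Z: "Gv.sm Z" "Y \<subseteq> Z" "Z \<subseteq> N" "Z \<noteq> N" using PZ by (auto simp: P_def)
    have finZ: "finite (quot_set N Z)" "finite (quot_set Z Y)"
      using finite_quot_set_tower[OF subgroups(1) Gv.sm_subgroup[OF Z(1)] subgroups(2) Z(2,3)] fin
      by blast+
    have max: "Z' = Z \<or> Z' = N" if Z': "Gv.sm Z'" "Z \<subseteq> Z'" "Z' \<subseteq> N" for Z'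
    proof (rule disjCI)
      assume "Z' \<noteq> N"
      then have le: "quot_index N Z \<le> quot_index N Z'" using minZ Z' Z(2) by (auto simp: P_def)
      note sg = Gv.sm_subgroup[OF Z'(1)] Gv.sm_subgroup[OF Z(1)]
      have "finite (quot_set N Z')" "finite (quot_set Z' Z)"
        using finite_quot_set_tower[OF subgroups(1) sg Z'(2,3)] finZ(1) by blast+
      then have pos: "0 < quot_index N Z'" "0 < quot_index Z' Z"
        using quot_index_pos subgroups(1) sg(1) by blast+
      have "quot_index N Z' * quot_index Z' Z \<le> quot_index N Z' * 1"
        using le quot_index_tower[OF subgroups(1) sg Z'(2,3)] by simp
      then have "quot_index Z' Z = 1" using pos by simp
      then show "Z' = Z" using quot_index_eq_1_iff[OF sg Z'(2)] by simp
    qed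
    have k: "shv (int (quot_index N Z)) ` N \<subseteq> Z"
      by (rule finite_index_contains_shv[OF N Z(1,3) finZ(1)])
    have "\<not> J \<subseteq> Z"
    proof
      assume "J \<subseteq> Z"
      then have "n \<in> Z" if "n \<in> N" for n
        using J(3)[OF that] Z(2) Gv.sm_add[OF Z(1)] by (metis diff_add_cancel subsetD)
      then show False using Z by blast
    qed
    then obtain g where g: "lattice_iso g N Z" "\<And>n. n \<in> N \<Longrightarrow> g n - n \<in> J"
      using maximal_sublattice_iso[OF less.prems(1) Z(1,3) k J(1,2) _ max] by blast
    have fgZ: "fin_gen G act Z" by (rule fin_gen_between[OF less.prems(1) Z(1,3) k])
    have "quot_index N Z \<noteq> 1"
      using quot_index_eq_1_iff[OF subgroups(1) Gv.sm_subgroup[OF Z(1)] Z(3)] Z(4) by blast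
    then have "1 < quot_index N Z" using quot_index_pos[OF subgroups(1) finZ(1)] by linarith
    moreover have "0 < quot_index Z Y" using quot_index_pos[OF Gv.sm_subgroup[OF Z(1)] finZ(2)] .
    ultimately have less_idx: "quot_index Z Y < quot_index N Y"
      using quot_index_tower[OF subgroups(1) Gv.sm_subgroup[OF Z(1)] subgroups(2) Z(2,3)] by simp
    have "\<exists>j\<in>J \<inter> Z. n - j \<in> Y" if n: "n \<in> Z" for n
    proof -
      obtain j where j: "j \<in> J" "n - j \<in> Y" using J(3) n Z(3) by blast
      have "n - (n - j) \<in> Z" using Gv.sm_diff[OF Z(1) n] j(2) Z(2) by blast
      then show ?thesis using j by auto
    qed
    then obtain h where h: "lattice_iso h Z Y" "\<And>n. n \<in> Z \<Longrightarrow> h n - n \<in> J \<inter> Z"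
      using less.hyps[OF less_idx fgZ Y(1) Z(2) finZ(2) Gv.sm_Int[OF J(1) Z(1)]] by blast
    have gZ: "g n \<in> Z" if "n \<in> N" for n
      using g(1) that unfolding lattice_iso_def bij_betw_def by blast
    have "lattice_iso (h \<circ> g) N Y"
      unfolding lattice_iso_def
    proof (intro conjI ballI)
      show "bij_betw (h \<circ> g) N Y"
        using g(1) h(1) unfolding lattice_iso_def by (blast intro: bij_betw_trans)
    qed (use g(1) h(1) gZ in \<open>auto simp: lattice_iso_def\<close>)
    moreover have "(h \<circ> g) n - n \<in> J" if n: "n \<in> N" for n
    proof -
      have "(h \<circ> g) n - n = (h (g n) - g n) + (g n - n)" by simp
      then show ?thesis using Gv.sm_add[OF J(1)] g(2)[OF n] h(2)[OF gZ[OF n]] by (metis IntD1)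
    qed
    ultimately show ?thesis by blast
  qed
qed

end

section \<open>Two-sidedness of the Moebius inverse\<close>

section \<open>Moebius inversion from above\<close>

lemma moebius_sum_below:
  assumes "finite P" "x \<in> P" "y \<in> P" "x \<le> y"
  shows "(\<Sum>z\<in>{z\<in>P. x \<le> z \<and> z \<le> y}. moebius P x z) = (if x = y then 1 else 0)"
proof (cases "x = y")
  case True
  then have "{z\<in>P. x \<le> z \<and> z \<le> y} = {x}" using assms by auto
  then show ?thesis using True assms by (simp add: moebius.simps)
next
  case False
  have "{z\<in>P. x \<le> z \<and> z \<le> y} = insert y {z\<in>P. x \<le> z \<and> z < y}" using assms by auto
  moreover have "moebius P x y = - (\<Sum>z\<in>{z\<in>P. x \<le> z \<and> z < y}. moebius P x z)"
    using False assms by (subst moebius.simps) simp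
  ultimately show ?thesis using False assms(1) by simp
qed

text \<open>The recursion defining the Moebius function makes it a right inverse of the zeta function of
  the poset; in the incidence algebra of a finite poset it is then also a left inverse.\<close>

lemma moebius_sum_above:
  assumes P: "finite P" and "x \<in> P" "y \<in> P" "x \<le> y"
  shows "(\<Sum>z\<in>{z\<in>P. x \<le> z \<and> z \<le> y}. moebius P z y) = (if x = y then 1 else 0)"
  using assms(2,4)
proof (induction "card {w\<in>P. x \<le> w}" arbitrary: x rule: less_induct)
  case less
  define g where "g x = (\<Sum>z\<in>{z\<in>P. x \<le> z \<and> z \<le> y}. moebius P z y)" for x
  show ?case
  proof (cases "x = y")
    case True
    then have "{z\<in>P. x \<le> z \<and> z \<le> y} = {y}" using assms by auto
    then show ?thesis using True assms by (simp add: moebius.simps)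
  next
    case False
    have IH: "g z = (if z = y then 1 else 0)" if "z \<in> P" "x < z" "z \<le> y" for z
    proof -
      have "x \<notin> {w\<in>P. z \<le> w}" "{w\<in>P. z \<le> w} \<subseteq> {w\<in>P. x \<le> w}" using that by auto
      then have "{w\<in>P. z \<le> w} \<subset> {w\<in>P. x \<le> w}" using less.prems(1) by blast
      then have "card {w\<in>P. z \<le> w} < card {w\<in>P. x \<le> w}"
        using P by (intro psubset_card_mono) auto
      from less.hyps[OF this that(1,3)] show ?thesis by (simp add: g_def)
    qed
    let ?I = "{z\<in>P. x \<le> z \<and> z \<le> y}"
    have fin: "finite ?I" using P by simp
    \<comment> \<open>The sum of \<mu>(x,z) \<mu>(w,y) over x \<le> z \<le> w \<le> y is evaluated
      in two orders: one gives \<mu>(x,y), the other, by induction, g x + \<mu>(x,y).\<close>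
    have "(\<Sum>z\<in>?I. moebius P x z * g z) =
        (\<Sum>z\<in>?I. \<Sum>w\<in>{w\<in>?I. z \<le> w}. moebius P x z * moebius P w y)"
      unfolding g_def sum_distrib_left
      by (intro sum.cong refl) auto
    also have "\<dots> = (\<Sum>w\<in>?I. \<Sum>z\<in>{z\<in>?I. z \<le> w}. moebius P x z * moebius P w y)"
      by (rule sum.swap_restrict[OF fin fin])
    also have "\<dots> = (\<Sum>w\<in>?I. (\<Sum>z\<in>{z\<in>P. x \<le> z \<and> z \<le> w}. moebius P x z) * moebius P w y)"
      unfolding sum_distrib_right
      by (intro sum.cong refl) auto
    also have "\<dots> = (\<Sum>w\<in>?I. if x = w then moebius P w y else 0)"
      using moebius_sum_below[OF P less.prems(1)] by (intro sum.cong refl) auto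
    also have "\<dots> = moebius P x y"
      using fin less.prems by (subst sum.delta') auto
    finally have total: "(\<Sum>z\<in>?I. moebius P x z * g z) = moebius P x y" .
    have "?I = insert x (insert y {z\<in>P. x < z \<and> z < y})" using less.prems assms(3) by auto
    moreover have "x \<notin> insert y {z\<in>P. x < z \<and> z < y}" "y \<notin> {z\<in>P. x < z \<and> z < y}"
      using False by auto
    moreover have "moebius P x z * g z = 0" if "z \<in> {z\<in>P. x < z \<and> z < y}" for z
    proof -
      have "z \<in> P" "x < z" "z \<le> y" "z \<noteq> y" using that by auto
      then show ?thesis using IH by simp
    qed
    then have "(\<Sum>z\<in>{z\<in>P. x < z \<and> z < y}. moebius P x z * g z) = 0"
      by (intro sum.neutral ballI)
    ultimately have "(\<Sum>z\<in>?I. moebius P x z * g z) = moebius P x x * g x + moebius P x y * g y"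
      using P by simp
    moreover have "moebius P x x = 1" using P less.prems by (simp add: moebius.simps)
    moreover have "g y = 1" using IH[of y] assms(3) less.prems(2) False by simp
    ultimately show ?thesis using total False by (simp add: g_def)
  qed
qed

section \<open>Finiteness and possible values of indices\<close>

section \<open>Indices are powers of the residue cardinality\<close>

text \<open>An intermediate subgroup is the union of its cosets, so it is determined by a subset of
  a finite set.\<close>

lemma finite_subgroups_between:
  assumes N: "is_add_subgroup N" and N0: "is_add_subgroup N0" and fin: "finite (quot_set N N0)"
  shows "finite {X. is_add_subgroup X \<and> N0 \<subseteq> X \<and> X \<subseteq> N}"
proof (rule finite_imageD)
  have "quot_set X N0 \<subseteq> quot_set N N0" if "X \<subseteq> N" for X
    using that unfolding quot_set_def by (rule image_mono)
  then have "(\<lambda>X. quot_set X N0) ` {X. is_add_subgroup X \<and> N0 \<subseteq> X \<and> X \<subseteq> N} \<subseteq>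
      Pow (quot_set N N0)"
    by blast
  then show "finite ((\<lambda>X. quot_set X N0) ` {X. is_add_subgroup X \<and> N0 \<subseteq> X \<and> X \<subseteq> N})"
    using fin finite_subset by blast
  show "inj_on (\<lambda>X. quot_set X N0) {X. is_add_subgroup X \<and> N0 \<subseteq> X \<and> X \<subseteq> N}"
  proof (rule inj_onI)
    fix X X' assume XX: "X \<in> {X. is_add_subgroup X \<and> N0 \<subseteq> X \<and> X \<subseteq> N}"
      "X' \<in> {X. is_add_subgroup X \<and> N0 \<subseteq> X \<and> X \<subseteq> N}" "quot_set X N0 = quot_set X' N0"
    have "X = \<Union>(quot_set X N0)" using Union_quot_set[OF _ N0, of X] XX(1) by simp
    also have "\<dots> = X'" using Union_quot_set[OF _ N0, of X'] XX(2,3) by simp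
    finally show "X = X'" .
  qed
qed

sublocale algebra_module \<subseteq> Rv: subring_module "\<lambda>c. act (scale c 1)" R
proof unfold_locales
  fix c d :: 'k and v w
  show "act (scale (c + d) 1) v = act (scale c 1) v + act (scale d 1) v"
    by (simp add: scale_left_distrib act_add_left)
  show "act (scale (c * d) 1) v = act (scale c 1) (act (scale d 1) v)"
    by (simp add: act_mult[symmetric] scale_mult_left)
qed (simp_all add: act_add_right R_one R_add R_mult R_minus)

context algebra_module
begin

text \<open>A vector outside \<open>Y\<close> that p moves into \<open>Y\<close> generates with
  \<open>Y\<close> an extension with quotient R / p R, which has q elements. It is found by
  multiplying a vector outside \<open>Y\<close> by p until just before it enters \<open>Y\<close>.
  Working over \<open>R\<close> covers every order at once.\<close>

lemma index_power_residue_card: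
  assumes "Rv.sm N" "Rv.sm Y" "Y \<subseteq> N" "finite (quot_set N Y)" "shv (int m) ` N \<subseteq> Y"
  shows "\<exists>n. quot_index N Y = residue_card av ^ n"
  using assms
proof (induction "quot_index N Y" arbitrary: Y rule: less_induct)
  case less
  note sg = Rv.sm_subgroup[OF less.prems(1)] Rv.sm_subgroup[OF less.prems(2)]
  show ?case
  proof (cases "N = Y")
    case True
    then show ?thesis using quot_index_self[OF sg(1)] by (intro exI[of _ 0]) simp
  next
    case False
    then obtain u where u: "u \<in> N" "u \<notin> Y" using less.prems(3) by blast
    have "shv (int m) u \<in> Y" using u less.prems(5) by blast
    then obtain i where i: "shv (int i) u \<notin> Y" "shv (int (Suc i)) u \<in> Y"
      using ex_least_nat_less[of "\<lambda>i. shv (int i) u \<in> Y" m] u(2) by auto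
    define v where "v = shv (int i) u"
    have vN: "v \<in> N"
      unfolding v_def shv_def sh_def
      by (rule Rv.sm_act[OF less.prems(1) unif_powi_in_R u(1)]) simp
    have vY: "v \<notin> Y" using i(1) by (simp add: v_def)
    have pv: "act (scale unif 1) v \<in> Y"
    proof -
      have "act (scale unif 1) v = shv 1 v" by (simp add: shv_def sh_def)
      then show ?thesis using i(2) by (simp add: v_def)
    qed
    define Z where "Z = {act (scale c 1) v + y |c y. c \<in> R \<and> y \<in> Y}"
    have Z_eq: "Z = {a + y |a y. a \<in> (\<lambda>c. act (scale c 1) v) ` R \<and> y \<in> Y}"
      unfolding Z_def by blast
    have Z: "Rv.sm Z" unfolding Z_eq by (rule Rv.sm_sum[OF Rv.sm_cyclic less.prems(2)])
    have ZI: "act (scale c 1) v + y \<in> Z" if "c \<in> R" "y \<in> Y" for c y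
      using that unfolding Z_def by blast
    have YZ: "Y \<subseteq> Z" using ZI[OF R_zero] by auto
    have ZN: "Z \<subseteq> N"
      unfolding Z_def using Rv.sm_add[OF less.prems(1)] Rv.sm_act[OF less.prems(1) _ vN] less.prems(3)
      by blast
    have kernel: "act (scale c 1) v \<in> Y \<longleftrightarrow> c \<in> val_ideal av" if c: "c \<in> R" for c
    proof
      assume cv: "act (scale c 1) v \<in> Y"
      show "c \<in> val_ideal av"
      proof (rule ccontr)
        assume "c \<notin> val_ideal av"
        then have "av c = 1" using c by (simp add: val_ideal_def val_ring_def)
        then have "inverse c \<in> R" "c \<noteq> 0" using R_unit by auto
        then have "act (scale (inverse c) 1) (act (scale c 1) v) \<in> Y" "c \<noteq> 0"
          using Rv.sm_act[OF less.prems(2) _ cv] by auto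
        then show False using vY by (simp add: act_mult[symmetric] scale_mult_left)
      qed
    next
      assume "c \<in> val_ideal av"
      then obtain d where "d \<in> R" "c = unif * d" unfolding val_ideal_eq by blast
      then have "act (scale c 1) v = act (scale d 1) (act (scale unif 1) v)"
        by (simp add: act_mult[symmetric] scale_mult_left mult.commute)
      then show "act (scale c 1) v \<in> Y" using Rv.sm_act[OF less.prems(2) \<open>d \<in> R\<close> pv] by simp
    qed
    have "quot_set Z Y = (\<lambda>c. act (scale c 1) v +o Y) ` R"
    proof (intro equalityI subsetI)
      fix C assume "C \<in> quot_set Z Y"
      then obtain c y where "c \<in> R" "y \<in> Y" "C = (act (scale c 1) v + y) +o Y"
        unfolding quot_set_def Z_def by blast
      then show "C \<in> (\<lambda>c. act (scale c 1) v +o Y) ` R"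
        using coset_eq_iff[OF sg(2), of "act (scale c 1) v + y" "act (scale c 1) v"] by auto
    next
      fix C assume "C \<in> (\<lambda>c. act (scale c 1) v +o Y) ` R"
      then show "C \<in> quot_set Z Y"
        unfolding quot_set_def using ZI[OF _ Rv.sm_zero[OF less.prems(2)]] by fastforce
    qed
    moreover have "card ((\<lambda>c. act (scale c 1) v +o Y) ` R) = card ((\<lambda>c. c +o val_ideal av) ` R)"
    proof (rule card_image_cong_kernel)
      fix c d assume cd: "c \<in> R" "d \<in> R"
      have "c - d \<in> R" using R_add[OF cd(1) R_minus[OF cd(2)]] by simp
      then show "(act (scale c 1) v +o Y = act (scale d 1) v +o Y) =
          (c +o val_ideal av = d +o val_ideal av)"
        using kernel[of "c - d"] coset_eq_iff[OF sg(2)] coset_eq_iff[OF val_ideal_subgroup]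
        by (simp add: scale_left_diff_distrib act_diff_left)
    qed
    ultimately have idx: "quot_index Z Y = residue_card av"
      by (simp add: quot_index_def residue_card_def quot_set_def)
    note sgZ = Rv.sm_subgroup[OF Z]
    have tower: "quot_index N Y = quot_index N Z * residue_card av"
      using quot_index_tower[OF sg(1) sgZ sg(2) YZ ZN] idx by simp
    have finZ: "finite (quot_set N Z)"
      using finite_quot_set_tower[OF sg(1) sgZ sg(2) YZ ZN] less.prems(4) by blast
    have "quot_index N Z < quot_index N Y"
      using quot_index_pos[OF sg(1) finZ] residue_card_ge_2 tower by simp
    then obtain n where "quot_index N Z = residue_card av ^ n"
      using less.hyps[OF _ less.prems(1) Z ZN finZ] less.prems(5) YZ by blast
    then show ?thesis using tower by (intro exI[of _ "Suc n"]) simp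
  qed
qed

end

context order_module
begin

lemma sm_Rv:
  assumes "Gv.sm N"
  shows "Rv.sm N"
proof (rule Rv.smI)
  show "act (scale c 1) x \<in> N" if "c \<in> R" "x \<in> N" for c x
    by (rule Gv.sm_act[OF assms G_scale[OF that(1) G_one] that(2)])
qed (use assms Gv.sm_zero Gv.sm_add in blast)+

lemma index_power:
  assumes "Gv.sm N" "Gv.sm Y" "Y \<subseteq> N" "finite (quot_set N Y)"
  shows "\<exists>n. quot_index N Y = residue_card av ^ n"
  using index_power_residue_card[OF sm_Rv sm_Rv assms(3,4) finite_index_contains_shv] assms by blast

text \<open>Every sublattice of index m contains p^m N, and between p^m N and \<open>N\<close> there
  are finitely many subgroups.\<close>

lemma finite_sublattices:
  assumes "fin_gen G act N"
  shows "finite {Y. Gv.sm Y \<and> Y \<subseteq> N \<and> finite (quot_set N Y) \<and> quot_index N Y = m}"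
proof (rule finite_subset)
  have N: "Gv.sm N" using Gv.fin_gen_sm[OF assms] .
  show "{Y. Gv.sm Y \<and> Y \<subseteq> N \<and> finite (quot_set N Y) \<and> quot_index N Y = m} \<subseteq>
      {X. is_add_subgroup X \<and> shv (int m) ` N \<subseteq> X \<and> X \<subseteq> N}"
    using finite_index_contains_shv[OF N] Gv.sm_subgroup by blast
  show "finite {X. is_add_subgroup X \<and> shv (int m) ` N \<subseteq> X \<and> X \<subseteq> N}"
    using finite_subgroups_between[OF Gv.sm_subgroup[OF N] shv_subgroup[OF Gv.sm_subgroup[OF N]]
        finite_quot_shv[OF assms]] .
qed

end

section \<open>Polynomiality and division of power series\<close>

section \<open>Polynomials among power series\<close>

lemma range_fps_of_poly_sum:
  "(\<And>x. x \<in> F \<Longrightarrow> f x \<in> range fps_of_poly) \<Longrightarrow> sum f F \<in> range fps_of_poly"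
proof (induction F rule: infinite_finite_induct)
  case (insert x F)
  then obtain p p' where "f x = fps_of_poly p" "sum f F = fps_of_poly p'" by blast
  then have "sum f (insert x F) = fps_of_poly (p + p')"
    using insert by (simp add: fps_of_poly_add)
  then show ?case by blast
qed (auto intro: range_eqI[of _ _ 0])

lemma range_fps_of_poly_mult:
  fixes f g :: "int fps"
  assumes "f \<in> range fps_of_poly" "g \<in> range fps_of_poly"
  shows "f * g \<in> range fps_of_poly"
proof -
  obtain p p' where "f = fps_of_poly p" "g = fps_of_poly p'" using assms by blast
  then have "f * g = fps_of_poly (p * p')" by (simp add: fps_of_poly_mult)
  then show ?thesis by blast
qed

lemma fps_const_in_range_fps_of_poly: "fps_const c \<in> range fps_of_poly"
  by (metis fps_of_poly_const rangeI)

lemma norm_term_in_range_fps_of_poly: "norm_term q n \<in> range fps_of_poly"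
  unfolding norm_term_def by (metis fps_of_poly_monom' rangeI)

lemma Q_poly_in_range_fps_of_poly: "Q_poly q act H I L' W \<in> range fps_of_poly"
  unfolding Q_poly_def
  by (intro range_fps_of_poly_sum range_fps_of_poly_mult fps_const_in_range_fps_of_poly
      norm_term_in_range_fps_of_poly)

text \<open>The bound on \<open>q\<close> makes the exponent unique, so that \<open>THE\<close>
  denotes it.\<close>

lemma norm_term_power: "2 \<le> q \<Longrightarrow> norm_term q (q ^ n) = fps_X ^ n"
  unfolding norm_term_def by (subst power_inject_exp) auto

lemma fps_quotient_eqI:
  assumes "f = h * g" "fps_nth g 0 = 1"
  shows "fps_quotient f g = h"
proof -
  have "g * fps_right_inverse g 1 = 1"
    by (rule fps_right_inverse) (use assms(2) in simp)
  then show ?thesis using assms(1) by (simp add: fps_quotient_def mult.assoc)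
qed

section \<open>Transport of sublattices and their indices along isomorphisms\<close>

section \<open>Sublattices and isomorphisms\<close>

context maximal_order_module
begin

lemma lattice_isoD:
  assumes "lattice_iso g N Z"
  shows "bij_betw g N Z" "inj_on g N" "g ` N = Z"
    "\<And>m n. m \<in> N \<Longrightarrow> n \<in> N \<Longrightarrow> g (m + n) = g m + g n"
    "\<And>a n. a \<in> G \<Longrightarrow> n \<in> N \<Longrightarrow> g (act a n) = act a (g n)"
  using assms by (auto simp: lattice_iso_def bij_betw_def)

lemma lattice_iso_image_submodule:
  assumes "lattice_iso g N Z" "S \<subseteq> G" "is_submodule S act X" "X \<subseteq> N"
  shows "is_submodule S act (g ` X)"
proof -
  note g = lattice_isoD[OF assms(1)]
  have "g x + g y \<in> g ` X" if "x \<in> X" "y \<in> X" for x y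
  proof -
    have "x + y \<in> X" using that assms(3) by (simp add: is_submodule_def)
    moreover have "g (x + y) = g x + g y" using g(4) that assms(4) by blast
    ultimately show ?thesis by (metis imageI)
  qed
  moreover have "act a (g x) \<in> g ` X" if "a \<in> S" "x \<in> X" for a x
  proof -
    have "act a x \<in> X" using that assms(3) by (simp add: is_submodule_def)
    moreover have "g (act a x) = act a (g x)" using g(5) that assms(2,4) by blast
    ultimately show ?thesis by (metis imageI)
  qed
  ultimately show ?thesis using assms(3) by (auto simp: is_submodule_def)
qed

lemma lattice_iso_vimage_submodule:
  assumes "lattice_iso g N Z" "S \<subseteq> G" "is_submodule S act X" "X \<subseteq> Z" "Gv.sm N"
  shows "is_submodule S act {n\<in>N. g n \<in> X}" "g ` {n\<in>N. g n \<in> X} = X"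
proof -
  note g = lattice_isoD[OF assms(1)]
  show im: "g ` {n\<in>N. g n \<in> X} = X" using g(3) assms(4) by auto
  have "{n\<in>N. g n \<in> X} \<noteq> {}" using im assms(3) by (auto simp: is_submodule_def)
  then show "is_submodule S act {n\<in>N. g n \<in> X}"
    using assms(2,3) g(4,5) Gv.sm_add[OF assms(5)] Gv.sm_act[OF assms(5)]
    unfolding is_submodule_def by (auto simp: subset_iff)
qed

lemma lattice_iso_index:
  assumes "lattice_iso g N Z" "is_add_subgroup A" "A \<subseteq> N" "B \<subseteq> A"
  shows "quot_index (g ` A) (g ` B) = quot_index A B"
    and "finite (quot_set (g ` A) (g ` B)) \<longleftrightarrow> finite (quot_set A B)"
proof -
  note g = lattice_isoD[OF assms(1)]
  have *: "\<And>x y. x \<in> A \<Longrightarrow> y \<in> A \<Longrightarrow> g (x + y) = g x + g y" "inj_on g A"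
    using g(2,4) assms(3) by (auto intro: inj_on_subset)
  show "quot_index (g ` A) (g ` B) = quot_index A B"
    using quot_index_image[of A g B, OF *] assms by blast
  show "finite (quot_set (g ` A) (g ` B)) \<longleftrightarrow> finite (quot_set A B)"
    using finite_quot_set_image[of A g B, OF *] assms by blast
qed

lemma lattice_iso_gen:
  assumes iso: "lattice_iso g N Z" and "Gv.sm N" "X \<subseteq> N"
  shows "Gv.gen (g ` X) = g ` Gv.gen X"
proof
  note g = lattice_isoD[OF iso]
  have genN: "Gv.gen X \<subseteq> N" using Gv.gen_minimal assms by blast
  show "Gv.gen (g ` X) \<subseteq> g ` Gv.gen X"
    using lattice_iso_image_submodule[OF iso order_refl Gv.sm_gen genN] Gv.gen_inc[of X]
    by (intro Gv.gen_minimal) auto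
  have "Gv.gen (g ` X) \<subseteq> Z"
    using \<open>Gv.gen (g ` X) \<subseteq> g ` Gv.gen X\<close> genN g(3) by blast
  from lattice_iso_vimage_submodule(1)[OF iso order_refl Gv.sm_gen this assms(2)]
  have "Gv.gen X \<subseteq> {n\<in>N. g n \<in> Gv.gen (g ` X)}"
    using assms(3) Gv.gen_inc[of "g ` X"] by (intro Gv.gen_minimal) auto
  then show "g ` Gv.gen X \<subseteq> Gv.gen (g ` X)" by blast
qed

definition sublattices :: "'v set \<Rightarrow> nat \<Rightarrow> 'v set set" where
  "sublattices N m = {Y. Gv.sm Y \<and> Y \<subseteq> N \<and> finite (quot_set N Y) \<and> quot_index N Y = m}"

text \<open>Any two full lattices in the same module over the maximal order are isomorphic.\<close>

lemma card_sublattices_eq: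
  assumes fg: "fin_gen G act N" and Z: "Gv.sm Z" "Z \<subseteq> N" "finite (quot_set N Z)"
  shows "card (sublattices Z m) = card (sublattices N m)"
proof -
  have N: "Gv.sm N" using Gv.fin_gen_sm[OF fg] .
  \<comment> \<open>No congruence is wanted here, so the whole of \<open>N\<close> takes the place
    of \<open>J\<close> in the isomorphism theorem.\<close>
  have "\<exists>j\<in>N. n - j \<in> Z" if "n \<in> N" for n
    using that Gv.sm_zero[OF Z(1)] by (intro bexI[of _ n]) auto
  then obtain g where g: "lattice_iso g N Z"
    using sublattice_iso[OF fg Z N order_refl] by blast
  note gD = lattice_isoD[OF g]
  have "bij_betw (image g) (sublattices N m) (sublattices Z m)"
  proof (rule bij_betw_imageI)
    show "inj_on (image g) (sublattices N m)"
      using gD(2) by (intro inj_onI) (auto simp: sublattices_def inj_on_image_eq_iff)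
    show "image g ` sublattices N m = sublattices Z m"
    proof (intro equalityI subsetI)
      fix Y' assume "Y' \<in> image g ` sublattices N m"
      then obtain Y where Y: "Y' = g ` Y" "Gv.sm Y" "Y \<subseteq> N" "finite (quot_set N Y)"
        "quot_index N Y = m"
        by (auto simp: sublattices_def)
      then show "Y' \<in> sublattices Z m"
        using lattice_iso_image_submodule[OF g order_refl Y(2,3)]
          lattice_iso_index[OF g Gv.sm_subgroup[OF N] order_refl Y(3)] gD(3)
        by (auto simp: sublattices_def)
    next
      fix Y' assume "Y' \<in> sublattices Z m"
      then have Y': "Gv.sm Y'" "Y' \<subseteq> Z" "finite (quot_set Z Y')" "quot_index Z Y' = m"
        by (auto simp: sublattices_def)
      define Y where "Y = {n\<in>N. g n \<in> Y'}"
      have Y: "Gv.sm Y" "g ` Y = Y'" "Y \<subseteq> N"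
        using lattice_iso_vimage_submodule[OF g order_refl Y'(1,2) N] by (auto simp: Y_def)
      have "Y \<in> sublattices N m"
        using lattice_iso_index[OF g Gv.sm_subgroup[OF N] order_refl Y(3)] Y Y' gD(3)
        by (simp add: sublattices_def)
      then show "Y' \<in> image g ` sublattices N m" using Y(2) by blast
    qed
  qed
  then show ?thesis using bij_betw_same_card by fastforce
qed

text \<open>The index in \<open>N\<close> is q^b times the index in \<open>Z\<close>, so passing to
  \<open>Z\<close> lowers the exponent by \<open>b\<close>, and exponents below \<open>b\<close> do
  not occur.\<close>

lemma sublattices_below:
  assumes N: "Gv.sm N" and Z: "Gv.sm Z" "Z \<subseteq> N" "finite (quot_set N Z)"
    and idx: "quot_index N Z = q ^ b" and q: "2 \<le> q"
  shows "{Y \<in> sublattices N (q ^ j). Y \<subseteq> Z} = (if j < b then {} else sublattices Z (q ^ (j - b)))"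
proof -
  note sg = Gv.sm_subgroup[OF N] Gv.sm_subgroup[OF Z(1)]
  have tower: "quot_index N Y = q ^ b * quot_index Z Y"
    "finite (quot_set N Y) \<longleftrightarrow> finite (quot_set Z Y)" if "Gv.sm Y" "Y \<subseteq> Z" for Y
    using quot_index_tower[OF sg Gv.sm_subgroup[OF that(1)] that(2) Z(2)] idx
      finite_quot_set_tower[OF sg Gv.sm_subgroup[OF that(1)] that(2) Z(2)] Z(3) by auto
  show ?thesis
  proof (cases "j < b")
    case True
    have False if Y: "Y \<in> sublattices N (q ^ j)" "Y \<subseteq> Z" for Y
    proof -
      have "q ^ j = q ^ b * quot_index Z Y" "0 < quot_index Z Y"
        using Y tower[of Y] quot_index_pos[OF sg(2)] by (auto simp: sublattices_def)
      then have "q ^ b \<le> q ^ j" by simp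
      then show False using True q by (simp add: power_le_imp_le_exp leD)
    qed
    then show ?thesis using True by auto
  next
    case False
    then have "q ^ j = q ^ b * q ^ (j - b)" by (simp add: power_add[symmetric])
    then have "quot_index N Y = q ^ j \<longleftrightarrow> quot_index Z Y = q ^ (j - b)" if "Gv.sm Y" "Y \<subseteq> Z" for Y
      using tower[OF that] q by simp
    then show ?thesis using False tower(2) Z(2) by (auto simp: sublattices_def)
  qed
qed

end

section \<open>Comparing lattices over the two orders modulo the conductor\<close>

section \<open>The conductor of an order in a maximal order\<close>

locale order_extension =
  M: maximal_order_module av scale H act + O: order_module av scale G act
  for av :: "'k::field \<Rightarrow> real" and scale :: "'k \<Rightarrow> 'a::ring_1 \<Rightarrow> 'a" and H G
    and act :: "'a \<Rightarrow> 'v::ab_group_add \<Rightarrow> 'v" +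
  assumes G_subset_H: "G \<subseteq> H"
begin

text \<open>The largest two-sided ideal of \<open>H\<close> contained in \<open>G\<close>.\<close>

definition conductor :: "'a set" where
  "conductor = {a. \<forall>x\<in>H. \<forall>y\<in>H. x * a * y \<in> G}"

lemma sm_restrict: "M.Gv.sm N \<Longrightarrow> O.Gv.sm N"
  using G_subset_H by (auto simp: is_submodule_def)

lemma conductor_subset: "conductor \<subseteq> G"
  using M.G_one by (fastforce simp: conductor_def)

lemma conductor_left: "h \<in> H \<Longrightarrow> a \<in> conductor \<Longrightarrow> h * a \<in> conductor"
  and conductor_right: "h \<in> H \<Longrightarrow> a \<in> conductor \<Longrightarrow> a * h \<in> conductor"
  using M.G_mult unfolding conductor_def by (auto simp: mult.assoc) (simp add: mult.assoc[symmetric])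

lemma conductor_zero: "0 \<in> conductor"
  by (simp add: conductor_def O.G_zero)

text \<open>A power of p clears the denominators of finitely many generators of \<open>H\<close>
  relative to \<open>G\<close>; p^k H is then a two-sided ideal of \<open>H\<close> inside
  \<open>G\<close>.\<close>

lemma conductor_absorbs: "\<exists>k. \<forall>h\<in>H. M.sh (int k) h \<in> conductor"
proof -
  obtain F where F: "finite F" "M.Rmod.gen F = H"
    using M.G_fin_gen by (auto simp: fin_gen_def)
  from F(1) have "\<exists>k. \<forall>h\<in>F. M.sh (int k) h \<in> G"
  proof induction
    case (insert x F)
    then obtain k where k: "\<forall>h\<in>F. M.sh (int k) h \<in> G" by blast
    obtain l where "0 \<le> l" "M.sh l x \<in> G" using O.G_absorb by blast
    then have l: "M.sh (int (nat l)) x \<in> G" by simp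
    have "M.sh (int (max k (nat l))) x \<in> G" by (rule O.G_sh_mono[OF l]) linarith
    moreover have "M.sh (int (max k (nat l))) h \<in> G" if "h \<in> F" for h
      by (rule O.G_sh_mono[OF k[rule_format, OF that]]) simp
    ultimately show ?case by blast
  qed simp
  then obtain k where k: "\<And>h. h \<in> F \<Longrightarrow> M.sh (int k) h \<in> G" by blast
  have "M.Rmod.gen F \<subseteq> {h. M.sh (int k) h \<in> G}"
  proof (intro M.Rmod.gen_minimal M.Rmod.smI)
    show "scale c h \<in> {h. M.sh (int k) h \<in> G}" if "c \<in> M.R" "h \<in> {h. M.sh (int k) h \<in> G}" for c h
    proof -
      have "M.sh (int k) (scale c h) = scale c (M.sh (int k) h)"
        by (simp add: M.sh_def mult.commute)
      then show ?thesis using O.G_scale that by simp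
    qed
  qed (auto simp: k M.sh_add O.G_zero O.G_add)
  then have "\<forall>h\<in>H. M.sh (int k) h \<in> conductor"
    using F(2) M.G_mult by (auto simp: conductor_def M.sh_mult_left M.sh_mult_right)
  then show ?thesis by blast
qed

abbreviation cmult :: "'v set \<Rightarrow> 'v set" where "cmult \<equiv> ideal_mult act conductor"

lemma cmult_subgroup: "is_add_subgroup (cmult N)"
  unfolding ideal_mult_def by (rule hull_in) (auto simp: is_add_subgroup_def)

lemma cmult_inc: "a \<in> conductor \<Longrightarrow> x \<in> N \<Longrightarrow> act a x \<in> cmult N"
  unfolding ideal_mult_def by (rule hull_inc) blast

lemma cmult_minimal:
  assumes "\<And>a x. a \<in> conductor \<Longrightarrow> x \<in> N \<Longrightarrow> act a x \<in> X" "is_add_subgroup X"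
  shows "cmult N \<subseteq> X"
  unfolding ideal_mult_def using assms by (intro hull_minimal) auto

lemma cmult_sm: "M.Gv.sm (cmult N)"
proof (rule M.Gv.smI)
  show "act h v \<in> cmult N" if h: "h \<in> H" and v: "v \<in> cmult N" for h v
  proof -
    have "cmult N \<subseteq> {v. act h v \<in> cmult N}"
    proof (rule cmult_minimal)
      show "act a x \<in> {v. act h v \<in> cmult N}" if "a \<in> conductor" "x \<in> N" for a x
        using cmult_inc[OF conductor_left[OF h that(1)] that(2)] by (simp add: M.act_mult)
      show "is_add_subgroup {v. act h v \<in> cmult N}"
        using cmult_subgroup[of N]
        by (auto simp: is_add_subgroup_def M.act_add_right M.act_minus_right)
    qed
    then show ?thesis using v by blast
  qed
qed (use cmult_subgroup add_subgroup_zero add_subgroup_add in blast)+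

text \<open>For a in the conductor and h in \<open>H\<close>, a h is again in the conductor, hence
  in \<open>G\<close>, and maps \<open>X\<close> into itself. With X = L this puts \<open>J\<close>
  inside \<open>L\<close>.\<close>

lemma cmult_gen_subset:
  assumes X: "O.Gv.sm X"
  shows "cmult (M.Gv.gen X) \<subseteq> X"
proof (rule cmult_minimal)
  have "M.Gv.gen X \<subseteq> {y. \<forall>a\<in>conductor. act a y \<in> X}"
  proof (intro M.Gv.gen_minimal M.Gv.smI)
    show "X \<subseteq> {y. \<forall>a\<in>conductor. act a y \<in> X}"
      using O.Gv.sm_act[OF X] conductor_subset by blast
    show "act h y \<in> {y. \<forall>a\<in>conductor. act a y \<in> X}"
      if "h \<in> H" "y \<in> {y. \<forall>a\<in>conductor. act a y \<in> X}" for h y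
      using that conductor_right by (auto simp: M.act_mult[symmetric])
  qed (use O.Gv.sm_zero[OF X] O.Gv.sm_add[OF X] in \<open>auto simp: M.act_add_right\<close>)
  then show "act a y \<in> X" if "a \<in> conductor" "y \<in> M.Gv.gen X" for a y using that by blast
qed (rule O.Gv.sm_subgroup[OF X])

end

locale lattice_extension = order_extension av scale H G act
  for av :: "'k::field \<Rightarrow> real" and scale :: "'k \<Rightarrow> 'a::ring_1 \<Rightarrow> 'a" and H G
    and act :: "'a \<Rightarrow> 'v::ab_group_add \<Rightarrow> 'v" +
  fixes L :: "'v set"
  assumes L_fg: "fin_gen G act L"
begin

definition L' :: "'v set" where "L' = M.Gv.gen L"

definition J :: "'v set" where "J = cmult L'"

definition k0 :: nat where "k0 = (SOME k. \<forall>h\<in>H. M.sh (int k) h \<in> conductor)"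

lemma k0: "h \<in> H \<Longrightarrow> M.sh (int k0) h \<in> conductor"
  using someI_ex[OF conductor_absorbs] by (auto simp: k0_def)

lemma L_sm: "O.Gv.sm L"
  using O.Gv.fin_gen_sm[OF L_fg] .

lemma L'_sm: "M.Gv.sm L'"
  by (simp add: L'_def M.Gv.sm_gen)

lemma L_subset: "L \<subseteq> L'"
  by (simp add: L'_def M.Gv.gen_inc)

lemma L'_fg: "fin_gen H act L'"
proof -
  obtain F where F: "finite F" "O.Gv.gen F = L" using L_fg by (auto simp: fin_gen_def)
  have "F \<subseteq> L'" using F(2) O.Gv.gen_inc L_subset by blast
  moreover have "L \<subseteq> M.Gv.gen F"
    unfolding F(2)[symmetric] by (intro O.Gv.gen_minimal M.Gv.gen_inc sm_restrict M.Gv.sm_gen)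
  ultimately have "M.Gv.gen F = L'"
    using L'_sm by (intro equalityI M.Gv.gen_minimal) (auto simp: L'_def M.Gv.gen_minimal M.Gv.sm_gen)
  then show ?thesis using F(1) by (auto simp: fin_gen_def)
qed

lemma J_sm: "M.Gv.sm J"
  by (simp add: J_def cmult_sm)

lemma J_subset_L: "J \<subseteq> L"
  unfolding J_def L'_def by (rule cmult_gen_subset[OF L_sm])

lemma J_subset_L': "J \<subseteq> L'"
  using J_subset_L L_subset by blast

lemma shv_cmult: "M.shv (int k0) ` N \<subseteq> cmult N"
  using cmult_inc[OF k0[OF M.G_one]] by (auto simp: M.shv_def)

lemma finite_L'_between: "M.Gv.sm Z \<Longrightarrow> J \<subseteq> Z \<Longrightarrow> Z \<subseteq> L' \<Longrightarrow> finite (quot_set L' Z)"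
  using M.finite_quot_between[OF L'_fg, of Z k0] shv_cmult[of L'] by (auto simp: J_def)

lemma finite_L'_J: "finite (quot_set L' J)"
  using finite_L'_between[OF J_sm order_refl J_subset_L'] .

lemmas sg = M.Gv.sm_subgroup[OF L'_sm] O.Gv.sm_subgroup[OF L_sm] M.Gv.sm_subgroup[OF J_sm]

lemma finite_L'_L: "finite (quot_set L' L)"
  using finite_quot_set_tower[OF sg(1,2,3) J_subset_L L_subset] finite_L'_J by blast

definition outer :: "'v set \<Rightarrow> 'v set set" where
  "outer M' = {X. O.Gv.sm X \<and> X \<subseteq> L \<and> module_isomorphic G act X M' \<and> J \<subseteq> M.Gv.gen X}"

lemma gen_subset_L': "X \<subseteq> L \<Longrightarrow> M.Gv.gen X \<subseteq> L'"
  using L_subset by (intro M.Gv.gen_minimal L'_sm) auto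

text \<open>One factor p^k0 takes \<open>L'\<close> into \<open>J\<close>, thus into H X; a second
  takes H X into its product with the conductor, thus into \<open>X\<close>. The bound is the same
  for all \<open>X\<close>, which makes \<open>outer\<close> finite.\<close>

lemma outer_contains:
  assumes "X \<in> outer M'"
  shows "M.shv (int (2 * k0)) ` L' \<subseteq> X"
proof -
  have X: "O.Gv.sm X" "J \<subseteq> M.Gv.gen X" using assms by (auto simp: outer_def)
  have "M.shv (int k0) ` L' \<subseteq> M.Gv.gen X" using X(2) shv_cmult[of L'] by (auto simp: J_def)
  then have "M.shv (int k0) ` M.shv (int k0) ` L' \<subseteq> M.shv (int k0) ` M.Gv.gen X"
    by (rule image_mono)
  also have "\<dots> \<subseteq> X" using shv_cmult[of "M.Gv.gen X"] cmult_gen_subset[OF X(1)] by blast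
  finally show ?thesis by (simp add: image_image)
qed

lemma finite_outer: "finite (outer M')"
proof (rule finite_subset)
  show "outer M' \<subseteq> {X. is_add_subgroup X \<and> M.shv (int (2 * k0)) ` L' \<subseteq> X \<and> X \<subseteq> L'}"
    using outer_contains[of _ M'] L_subset O.Gv.sm_subgroup unfolding outer_def by blast
  show "finite {X. is_add_subgroup X \<and> M.shv (int (2 * k0)) ` L' \<subseteq> X \<and> X \<subseteq> L'}"
    by (rule finite_subgroups_between[OF sg(1) M.shv_subgroup[OF sg(1)]
          M.finite_quot_shv[OF L'_fg]])
qed

lemma finite_L_outer:
  assumes "X \<in> outer M'"
  shows "finite (quot_set L X)"
proof -
  have X: "O.Gv.sm X" "X \<subseteq> L" using assms by (auto simp: outer_def)
  note sgX = O.Gv.sm_subgroup[OF X(1)]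
  have "finite (quot_set L' X)"
    using finite_quot_set_tower[OF sg(1) sgX M.shv_subgroup[OF sg(1)] outer_contains[OF assms]]
      X(2) L_subset M.finite_quot_shv[OF L'_fg] by blast
  then show ?thesis using finite_quot_set_tower[OF sg(1,2) sgX X(2) L_subset] by blast
qed

subsection \<open>Submodules of the quotient by the conductor\<close>

definition between :: "'v set \<Rightarrow> bool" where
  "between Z \<longleftrightarrow> M.Gv.sm Z \<and> J \<subseteq> Z \<and> Z \<subseteq> L'"

abbreviation quo :: "'v set \<Rightarrow> 'v set set" where "quo Z \<equiv> quot_set Z J"

lemma coset_act_singleton:
  assumes "a \<in> H"
  shows "coset_act act J {a} (x +o J) = act a x +o J"
proof (intro equalityI subsetI)
  fix v assume "v \<in> coset_act act J {a} (x +o J)"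
  then obtain y n where v: "v = act a y + n" "y - x \<in> J" "n \<in> J"
    by (auto simp: coset_act_def mem_coset_iff)
  have "v - act a x = act a (y - x) + n" by (simp add: v M.act_diff_right)
  then show "v \<in> act a x +o J"
    using M.Gv.sm_add[OF J_sm M.Gv.sm_act[OF J_sm assms v(2)] v(3)] by (simp add: mem_coset_iff)
next
  fix v assume "v \<in> act a x +o J"
  then have "v = act a x + (v - act a x)" "v - act a x \<in> J" "x \<in> x +o J"
    using M.Gv.sm_zero[OF J_sm] by (auto simp: mem_coset_iff)
  then show "v \<in> coset_act act J {a} (x +o J)" unfolding coset_act_def by blast
qed

text \<open>Elements of the conductor send \<open>L'\<close> into \<open>J\<close>, so the whole
  coset of \<open>a\<close> acts on a class from \<open>L'\<close> as \<open>a\<close> does.\<close>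

lemma coset_act_coset:
  assumes a: "a \<in> H" and x: "x \<in> L'"
  shows "coset_act act J (a +o conductor) (x +o J) = act a x +o J"
proof
  have "a \<in> a +o conductor" using conductor_zero by (simp add: mem_coset_iff)
  then have "coset_act act J {a} (x +o J) \<subseteq> coset_act act J (a +o conductor) (x +o J)"
    unfolding coset_act_def by blast
  then show "act a x +o J \<subseteq> coset_act act J (a +o conductor) (x +o J)"
    by (simp add: coset_act_singleton[OF a])
  show "coset_act act J (a +o conductor) (x +o J) \<subseteq> act a x +o J"
  proof
    fix v assume "v \<in> coset_act act J (a +o conductor) (x +o J)"
    then obtain b y n where v: "v = act b y + n" "b - a \<in> conductor" "y - x \<in> J" "n \<in> J"
      by (auto simp: coset_act_def mem_coset_iff)
    have "y \<in> L'" using M.Gv.sm_add[OF L'_sm _ x, of "y - x"] v(3) J_subset_L' by auto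
    then have "act (b - a) y \<in> J" using cmult_inc[OF v(2)] by (simp add: J_def)
    moreover have "v - act a x = act (b - a) y + act a (y - x) + n"
      by (simp add: v M.act_diff_left M.act_diff_right)
    ultimately show "v \<in> act a x +o J"
      using M.Gv.sm_add[OF J_sm M.Gv.sm_add[OF J_sm _ M.Gv.sm_act[OF J_sm a v(3)]] v(4)]
      by (simp add: mem_coset_iff)
  qed
qed

lemma coset_add: "(x +o J) + (y +o J) = (x + y) +o J"
proof -
  have "J + J = J"
    using M.Gv.sm_add[OF J_sm] M.Gv.sm_zero[OF J_sm] by (force simp: set_plus_def)
  then show ?thesis by (simp add: set_plus_rearrange)
qed

lemma quo_Union: "between Z \<Longrightarrow> \<Union>(quo Z) = Z"
  using Union_quot_set[OF M.Gv.sm_subgroup sg(3)] by (simp add: between_def)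

lemma quo_subset_iff:
  assumes "between Z" "between Z'"
  shows "quo Z \<subseteq> quo Z' \<longleftrightarrow> Z \<subseteq> Z'"
proof
  assume "quo Z \<subseteq> quo Z'"
  then have "\<Union>(quo Z) \<subseteq> \<Union>(quo Z')" by (rule Union_mono)
  then show "Z \<subseteq> Z'" using assms quo_Union by simp
qed (simp add: quot_set_def image_mono)

text \<open>The correspondence theorem for lattices between \<open>J\<close> and \<open>L'\<close>,
  fitted to a submodule predicate without a zero.\<close>

lemma quotient_submodule_iff:
  assumes U: "U \<subseteq> quo L'"
  shows "is_submodule H (\<lambda>a. coset_act act J {a}) U \<longleftrightarrow> (\<exists>Z. between Z \<and> U = quo Z)"
proof
  assume sm: "is_submodule H (\<lambda>a. coset_act act J {a}) U"
  define Z where "Z = {x \<in> L'. x +o J \<in> U}"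
  have act_U: "act a x +o J \<in> U" if "a \<in> H" "x +o J \<in> U" for a x
  proof -
    have "coset_act act J {a} (x +o J) \<in> U" using sm that unfolding is_submodule_def by blast
    then show ?thesis by (simp add: coset_act_singleton[OF that(1)])
  qed
  have add_U: "(x + y) +o J \<in> U" if "x +o J \<in> U" "y +o J \<in> U" for x y
  proof -
    have "(x +o J) + (y +o J) \<in> U" using sm that unfolding is_submodule_def by blast
    then show ?thesis by (simp add: coset_add)
  qed
  have "U \<noteq> {}" using sm by (simp add: is_submodule_def)
  \<comment> \<open>The trivial coset is reached by letting 0 act on some member, as
    \<open>is_submodule\<close> only guarantees that there is one.\<close>
  then obtain x0 where "x0 +o J \<in> U" using U by (auto simp: quot_set_def)
  then have zero: "0 +o J \<in> U" using act_U[OF M.G_zero] by fastforce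
  have "M.Gv.sm Z"
    using zero act_U add_U M.Gv.sm_zero[OF L'_sm] M.Gv.sm_add[OF L'_sm] M.Gv.sm_act[OF L'_sm]
    by (intro M.Gv.smI) (auto simp: Z_def)
  moreover have "J \<subseteq> Z"
  proof
    fix x assume "x \<in> J"
    then have "x +o J = 0 +o J" using coset_eq_iff[OF sg(3), of x 0] by simp
    then show "x \<in> Z" using zero \<open>x \<in> J\<close> J_subset_L' by (auto simp: Z_def)
  qed
  moreover have "U = quo Z"
    using U by (auto simp: quot_set_def Z_def)
  ultimately show "\<exists>Z. between Z \<and> U = quo Z"
    unfolding between_def by (metis (no_types, lifting) Z_def mem_Collect_eq subsetI)
next
  assume "\<exists>Z. between Z \<and> U = quo Z"
  then obtain Z where Z: "M.Gv.sm Z" "U = quo Z" by (auto simp: between_def)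
  show "is_submodule H (\<lambda>a. coset_act act J {a}) U"
    unfolding is_submodule_def
  proof (intro conjI ballI)
    show "U \<noteq> {}" using Z M.Gv.sm_zero[OF Z(1)] by (auto simp: quot_set_def)
    fix C assume "C \<in> U"
    then obtain x where x: "x \<in> Z" "C = x +o J" using Z(2) by (auto simp: quot_set_def)
    show "C + C' \<in> U" if "C' \<in> U" for C'
    proof -
      from that obtain y where "y \<in> Z" "C' = y +o J" using Z(2) by (auto simp: quot_set_def)
      then show ?thesis
        using x M.Gv.sm_add[OF Z(1)] Z(2) by (auto simp: quot_set_def coset_add)
    qed
    show "coset_act act J {a} C \<in> U" if "a \<in> H" for a
      using x M.Gv.sm_act[OF Z(1) that] Z(2)
      by (auto simp: quot_set_def coset_act_singleton[OF that])
  qed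
qed

lemma quot_submodules_eq: "quot_submodules act H conductor L' = quo ` {Z. between Z}"
proof -
  have eq: "is_submodule (quot_set H conductor) (coset_act act J) U \<longleftrightarrow>
      is_submodule H (\<lambda>a. coset_act act J {a}) U" if U: "U \<subseteq> quo L'" for U
  proof -
    have "coset_act act J (a +o conductor) C = coset_act act J {a} C" if "a \<in> H" "C \<in> U" for a C
    proof -
      obtain x where "x \<in> L'" "C = x +o J" using \<open>C \<in> U\<close> U by (auto simp: quot_set_def)
      then show ?thesis using coset_act_coset coset_act_singleton that(1) by simp
    qed
    then show ?thesis unfolding is_submodule_def quot_set_def by auto
  qed
  have sub: "quo Z \<subseteq> quo L'" if "between Z" for Z
    using that by (auto simp: quot_set_def between_def)
  show ?thesis
    unfolding quot_submodules_def J_def[symmetric]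
  proof (intro equalityI subsetI)
    fix U assume "U \<in> {U. U \<subseteq> quo L' \<and> is_submodule (quot_set H conductor) (coset_act act J) U}"
    then have "U \<subseteq> quo L'" "is_submodule H (\<lambda>a. coset_act act J {a}) U" using eq by auto
    then show "U \<in> quo ` {Z. between Z}" using quotient_submodule_iff by auto
  next
    fix U assume "U \<in> quo ` {Z. between Z}"
    then obtain Z where Z: "between Z" "U = quo Z" by blast
    then have "is_submodule H (\<lambda>a. coset_act act J {a}) U" "U \<subseteq> quo L'"
      using quotient_submodule_iff[of U] sub by auto
    then show "U \<in> {U. U \<subseteq> quo L' \<and> is_submodule (quot_set H conductor) (coset_act act J) U}"
      using eq by simp
  qed
qed

lemma quot_submodules_below:
  assumes "between N"
  shows "{U. U \<subseteq> quo N \<and> is_submodule H (\<lambda>a. coset_act act J {a}) U} =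
    quo ` {Z. between Z \<and> Z \<subseteq> N}"
proof -
  have "between L'" using L'_sm J_subset_L' by (simp add: between_def)
  then have "quo N \<subseteq> quo L'" using assms quo_subset_iff by (simp add: between_def)
  show ?thesis
  proof (intro equalityI subsetI)
    fix U assume "U \<in> {U. U \<subseteq> quo N \<and> is_submodule H (\<lambda>a. coset_act act J {a}) U}"
    then have U: "U \<subseteq> quo N" "is_submodule H (\<lambda>a. coset_act act J {a}) U" by auto
    then obtain Z where "between Z" "U = quo Z"
      using quotient_submodule_iff[of U] \<open>quo N \<subseteq> quo L'\<close> by auto
    then show "U \<in> quo ` {Z. between Z \<and> Z \<subseteq> N}"
      using U(1) quo_subset_iff[OF _ assms] by blast
  next
    fix U assume "U \<in> quo ` {Z. between Z \<and> Z \<subseteq> N}"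
    then obtain Z where Z: "between Z" "Z \<subseteq> N" "U = quo Z" by blast
    then have "U \<subseteq> quo N" using quo_subset_iff[OF _ assms] by blast
    moreover have "is_submodule H (\<lambda>a. coset_act act J {a}) U"
      using quotient_submodule_iff[of U] Z calculation \<open>quo N \<subseteq> quo L'\<close> by auto
    ultimately show "U \<in> {U. U \<subseteq> quo N \<and> is_submodule H (\<lambda>a. coset_act act J {a}) U}" by simp
  qed
qed

text \<open>Third isomorphism theorem with cosets of cosets: both sides count \<open>N\<close>
  modulo the same equivalence relation.\<close>

lemma quo_index:
  assumes N: "between N" and Z: "between Z" "Z \<subseteq> N"
  shows "quot_index (quo N) (quo Z) = quot_index N Z"
proof -
  have sm: "M.Gv.sm Z" "J \<subseteq> Z" using Z by (auto simp: between_def)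
  have coset: "(x +o J) +o quo Z = (\<lambda>v. v +o J) ` (x +o Z)" for x
    by (auto simp: elt_set_plus_def[of "x +o J"] elt_set_plus_def[of x Z] quot_set_def coset_add)
  have "quot_set (quo N) (quo Z) = (\<lambda>x. (x +o J) +o quo Z) ` N"
    by (auto simp: quot_set_def)
  moreover have "card ((\<lambda>x. (x +o J) +o quo Z) ` N) = card ((\<lambda>x. x +o Z) ` N)"
  proof (rule card_image_cong_kernel)
    fix x y
    show "((x +o J) +o quo Z = (y +o J) +o quo Z) = (x +o Z = y +o Z)"
    proof
      assume eq: "(x +o J) +o quo Z = (y +o J) +o quo Z"
      have "x +o J \<in> (x +o J) +o quo Z"
        unfolding coset using M.Gv.sm_zero[OF sm(1)] by (auto simp: mem_coset_iff)
      then obtain v where v: "v - y \<in> Z" "x +o J = v +o J"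
        unfolding eq unfolding coset by (auto simp: mem_coset_iff)
      then have "x - v \<in> Z" using coset_eq_iff[OF sg(3)] sm(2) by blast
      then have "x - y \<in> Z" using M.Gv.sm_add[OF sm(1) _ v(1)] by fastforce
      then show "x +o Z = y +o Z" using coset_eq_iff[OF M.Gv.sm_subgroup[OF sm(1)]] by blast
    qed (simp add: coset)
  qed
  ultimately show ?thesis by (simp add: quot_index_def quot_set_def)
qed

lemma finite_between: "finite {Z. between Z}"
  using finite_subset[OF _ finite_subgroups_between[OF sg(1,3) finite_L'_J], of "{Z. between Z}"]
    M.Gv.sm_subgroup by (auto simp: between_def)

lemma moebius_between:
  assumes Y: "between Y" and N: "between N" "Y \<subseteq> N"
  shows "(\<Sum>Z\<in>{Z. between Z \<and> Y \<subseteq> Z \<and> Z \<subseteq> N}.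
    moebius (quot_submodules act H conductor L') (quo Z) (quo N)) = (if Y = N then 1 else 0)"
proof -
  let ?P = "quot_submodules act H conductor L'"
  have inj: "inj_on quo {Z. between Z}"
    by (rule inj_on_inverseI[of _ Union]) (simp add: quo_Union)
  have fin: "finite ?P" unfolding quot_submodules_eq using finite_between by simp
  have eq: "{U\<in>?P. quo Y \<le> U \<and> U \<le> quo N} = quo ` {Z. between Z \<and> Y \<subseteq> Z \<and> Z \<subseteq> N}"
    unfolding quot_submodules_eq using quo_subset_iff Y N(1) by auto
  have "(\<Sum>U\<in>{U\<in>?P. quo Y \<le> U \<and> U \<le> quo N}. moebius ?P U (quo N)) = (if quo Y = quo N then 1 else 0)"
    by (rule moebius_sum_above[OF fin])
      (use Y N quo_subset_iff in \<open>auto simp: quot_submodules_eq\<close>)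
  moreover have "quo Y = quo N \<longleftrightarrow> Y = N" using quo_Union Y N by metis
  moreover have "inj_on quo {Z. between Z \<and> Y \<subseteq> Z \<and> Z \<subseteq> N}"
    by (rule inj_on_subset[OF inj]) auto
  ultimately show ?thesis unfolding eq by (simp add: sum.reindex)
qed

end

section \<open>Moebius inversion, the matching of sublattices, and the quotient formula\<close>

section \<open>The quotient of zeta functions\<close>

context lattice_extension
begin

definition plus_J :: "'v set \<Rightarrow> 'v set" where "plus_J Y = {y + j |y j. y \<in> Y \<and> j \<in> J}"

lemma plus_J_sm: "M.Gv.sm Y \<Longrightarrow> M.Gv.sm (plus_J Y)"
  unfolding plus_J_def by (rule M.Gv.sm_sum[OF _ J_sm])

lemma plus_J_least:
  assumes "M.Gv.sm Y" "M.Gv.sm Z"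
  shows "plus_J Y \<subseteq> Z \<longleftrightarrow> Y \<subseteq> Z \<and> J \<subseteq> Z"
proof
  have "y + j \<in> plus_J Y" if "y \<in> Y" "j \<in> J" for y j using that unfolding plus_J_def by blast
  from this[OF _ M.Gv.sm_zero[OF J_sm]] this[OF M.Gv.sm_zero[OF assms(1)]]
  have "Y \<subseteq> plus_J Y" "J \<subseteq> plus_J Y" by auto
  then show "Y \<subseteq> Z \<and> J \<subseteq> Z" if "plus_J Y \<subseteq> Z" using that by blast
  show "plus_J Y \<subseteq> Z" if "Y \<subseteq> Z \<and> J \<subseteq> Z"
    using that M.Gv.sm_add[OF assms(2)] unfolding plus_J_def by blast
qed

lemma plus_J_between: "M.Gv.sm Y \<Longrightarrow> Y \<subseteq> L' \<Longrightarrow> between (plus_J Y)"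
  using plus_J_sm plus_J_least[OF _ plus_J_sm, of Y Y] plus_J_least[OF _ L'_sm, of Y] J_subset_L'
  by (auto simp: between_def)

lemma between_fg: "between N \<Longrightarrow> fin_gen H act N"
  using M.fin_gen_between[OF L'_fg, of N k0] shv_cmult[of L'] by (auto simp: between_def J_def)

lemma finite_quot_below:
  assumes "between N" "M.Gv.sm Z" "J \<subseteq> Z" "Z \<subseteq> N"
  shows "finite (quot_set N Z)"
proof -
  have N: "M.Gv.sm N" "N \<subseteq> L'" using assms(1) by (auto simp: between_def)
  have "finite (quot_set L' Z)" using finite_L'_between assms N(2) by blast
  then show ?thesis
    using finite_quot_set_tower[OF sg(1) M.Gv.sm_subgroup[OF N(1)] M.Gv.sm_subgroup[OF assms(2)]]
      assms(4) N(2) by blast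
qed

abbreviation q :: nat where "q \<equiv> residue_card av"

lemma zeta_nth: "fps_nth (solomon_zeta q act H N) n = int (card (M.sublattices N (q ^ n)))"
  by (simp add: solomon_zeta_def M.sublattices_def)

lemma zeta_constant_term:
  assumes "M.Gv.sm N"
  shows "fps_nth (solomon_zeta q act H N) 0 = 1"
proof -
  have "M.sublattices N 1 = {N}"
  proof (intro equalityI subsetI)
    fix Y assume "Y \<in> M.sublattices N 1"
    then have "M.Gv.sm Y" "Y \<subseteq> N" "quot_index N Y = 1" by (auto simp: M.sublattices_def)
    then show "Y \<in> {N}"
      using quot_index_eq_1_iff[OF M.Gv.sm_subgroup[OF assms] M.Gv.sm_subgroup] by auto
  next
    fix Y assume "Y \<in> {N}"
    then show "Y \<in> M.sublattices N 1"
      using quot_index_self[OF M.Gv.sm_subgroup[OF assms]] assms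
        quot_set_self[OF M.Gv.sm_subgroup[OF assms]]
      by (simp add: M.sublattices_def)
  qed
  then show ?thesis by (simp add: zeta_nth)
qed

text \<open>
  All full lattices have the same zeta function, so a term \<open>|N/Z|\<^sup>-\<^sup>s \<zeta>(L')\<close> counts the
  sublattices of \<open>Z\<close> by their index in \<open>N\<close>, and Moebius inversion leaves those that together
  with \<open>J\<close> generate \<open>N\<close>.
\<close>

lemma Q_poly_mult_zeta:
  assumes N: "between N"
  shows "Q_poly q act H conductor L' (quo N) * solomon_zeta q act H L' =
    Abs_fps (\<lambda>j. int (card {Y \<in> M.sublattices N (q ^ j). plus_J Y = N}))"
proof (rule fps_ext)
  fix j
  have smN: "M.Gv.sm N" "N \<subseteq> L'" using N by (auto simp: between_def)
  define B where "B = {Z. between Z \<and> Z \<subseteq> N}"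
  define c where "c Z = moebius (quot_submodules act H conductor L') (quo Z) (quo N)" for Z
  define F where "F = M.sublattices N (q ^ j)"
  have finB: "finite B" using finite_subset[OF _ finite_between] by (auto simp: B_def)
  have finF: "finite F"
    unfolding F_def M.sublattices_def by (rule M.finite_sublattices[OF between_fg[OF N]])
  have B: "M.Gv.sm Z" "Z \<subseteq> N" "finite (quot_set N Z)" "finite (quot_set L' Z)" if "Z \<in> B" for Z
    using that finite_quot_below[OF N] finite_L'_between by (auto simp: B_def between_def)
  have "\<forall>Z\<in>B. \<exists>b. quot_index N Z = q ^ b"
    using M.index_power[OF smN(1) B(1-3)] by blast
  then obtain b where b: "\<And>Z. Z \<in> B \<Longrightarrow> quot_index N Z = q ^ b Z" by metis
  have inj: "inj_on quo B"
    by (rule inj_on_inverseI[of _ Union]) (simp add: quo_Union B_def)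
  have "Q_poly q act H conductor L' (quo N) =
      (\<Sum>U\<in>quo ` B. fps_const (moebius (quot_submodules act H conductor L') U (quo N)) *
        norm_term q (quot_index (quo N) U))"
    unfolding Q_poly_def J_def[symmetric] quot_submodules_below[OF N] B_def ..
  also have "\<dots> = (\<Sum>Z\<in>B. fps_const (c Z) * norm_term q (quot_index (quo N) (quo Z)))"
    by (simp add: sum.reindex[OF inj] c_def)
  also have "\<dots> = (\<Sum>Z\<in>B. fps_const (c Z) * fps_X ^ b Z)"
    using quo_index[OF N] b norm_term_power[OF M.residue_card_ge_2]
    by (intro sum.cong refl) (simp add: B_def)
  finally have "fps_nth (Q_poly q act H conductor L' (quo N) * solomon_zeta q act H L') j =
      (\<Sum>Z\<in>B. c Z * (if j < b Z then 0 else int (card (M.sublattices L' (q ^ (j - b Z))))))"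
    by (simp add: sum_distrib_right fps_sum_nth mult.assoc fps_X_power_mult_nth zeta_nth
        cong: if_cong)
  \<comment> \<open>\<open>L'\<close> has as many sublattices of index q^(j - b Z) as
    \<open>Z\<close>, and in \<open>Z\<close> these are the members of \<open>F\<close> contained in
    \<open>Z\<close>.\<close>
  also have "\<dots> = (\<Sum>Z\<in>B. c Z * int (card {Y \<in> F. Y \<subseteq> Z}))"
  proof (intro sum.cong refl)
    fix Z assume Z: "Z \<in> B"
    then show "c Z * (if j < b Z then 0 else int (card (M.sublattices L' (q ^ (j - b Z))))) =
        c Z * int (card {Y \<in> F. Y \<subseteq> Z})"
      unfolding F_def M.sublattices_below[OF smN(1) B(1-3)[OF Z] b[OF Z] M.residue_card_ge_2]
      using M.card_sublattices_eq[OF L'_fg B(1)[OF Z] _ B(4)[OF Z]] B(2)[OF Z] smN(2) by auto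
  qed
  also have "\<dots> = (\<Sum>Z\<in>B. \<Sum>Y\<in>{Y\<in>F. Y \<subseteq> Z}. c Z)" by (simp add: mult.commute)
  also have "\<dots> = (\<Sum>Y\<in>F. \<Sum>Z\<in>{Z\<in>B. Y \<subseteq> Z}. c Z)"
    by (rule sum.swap_restrict[OF finB finF])
  also have "\<dots> = (\<Sum>Y\<in>F. if plus_J Y = N then 1 else 0)"
  proof (intro sum.cong refl)
    fix Y assume "Y \<in> F"
    then have Y: "M.Gv.sm Y" "Y \<subseteq> N" by (auto simp: F_def M.sublattices_def)
    \<comment> \<open>Members of \<open>B\<close> contain \<open>J\<close>, so containing
      \<open>Y\<close> amounts to containing Y + J, and the inner sum runs over an interval.\<close>
    have "{Z\<in>B. Y \<subseteq> Z} = {Z. between Z \<and> plus_J Y \<subseteq> Z \<and> Z \<subseteq> N}"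
      using plus_J_least[OF Y(1)] by (auto simp: B_def between_def)
    moreover have "between (plus_J Y)" "plus_J Y \<subseteq> N"
      using plus_J_between[OF Y(1)] plus_J_least[OF Y(1) smN(1)] Y(2) N smN(2)
      by (auto simp: between_def)
    ultimately show "(\<Sum>Z\<in>{Z\<in>B. Y \<subseteq> Z}. c Z) = (if plus_J Y = N then 1 else 0)"
      using moebius_between[OF _ N] unfolding c_def by simp
  qed
  also have "\<dots> = int (card {Y \<in> F. plus_J Y = N})"
    using finF by (simp add: sum.If_cases Int_def)
  finally show "fps_nth (Q_poly q act H conductor L' (quo N) * solomon_zeta q act H L') j =
      fps_nth (Abs_fps (\<lambda>j. int (card {Y \<in> M.sublattices N (q ^ j). plus_J Y = N}))) j"
    by (simp add: F_def)
qed

text \<open>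
  For \<open>Y = H X'\<close> there is an isomorphism of \<open>Y + J\<close> with \<open>Y\<close> that is the identity modulo
  \<open>J \<subseteq> L\<close>; it carries the sublattices \<open>X\<close> of \<open>L\<close> with \<open>H X = Y + J\<close> to those with \<open>H X = Y\<close>.
\<close>

lemma card_isomorphic_sublattices:
  "card {X. O.Gv.sm X \<and> X \<subseteq> L \<and> finite (quot_set L X) \<and> quot_index L X = m \<and>
      module_isomorphic G act X M'} =
   card (SIGMA X:outer M'. {Y. M.Gv.sm Y \<and> Y \<subseteq> M.Gv.gen X \<and> finite (quot_set (M.Gv.gen X) Y) \<and>
      quot_index L X * quot_index (M.Gv.gen X) Y = m \<and> plus_J Y = M.Gv.gen X})"
    (is "card ?S = card ?P")
proof -
  have "\<exists>g. M.lattice_iso g (plus_J Y) Y \<and> (\<forall>n\<in>plus_J Y. g n - n \<in> J)"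
    if Y: "M.Gv.sm Y" "Y \<subseteq> L'" "finite (quot_set L' Y)" for Y
  proof -
    have N: "between (plus_J Y)" by (rule plus_J_between[OF Y(1,2)])
    then have sub: "M.Gv.sm (plus_J Y)" "Y \<subseteq> plus_J Y" "J \<subseteq> plus_J Y" "plus_J Y \<subseteq> L'"
      using plus_J_least[OF Y(1) plus_J_sm[OF Y(1)]] by (auto simp: between_def)
    have "finite (quot_set (plus_J Y) Y)"
      using finite_quot_set_tower[OF sg(1) M.Gv.sm_subgroup[OF sub(1)] M.Gv.sm_subgroup[OF Y(1)]
          sub(2,4)] Y(3) by blast
    moreover have "\<exists>j\<in>J. n - j \<in> Y" if "n \<in> plus_J Y" for n
      using that unfolding plus_J_def by force
    ultimately show ?thesis
      using M.sublattice_iso[OF between_fg[OF N] Y(1) sub(2) _ J_sm sub(3)] by blast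
  qed
  \<comment> \<open>One isomorphism is fixed for each \<open>Y\<close>, so that the correspondence
    can be undone once \<open>Y\<close> is known.\<close>
  then obtain g where g: "\<And>Y. M.Gv.sm Y \<Longrightarrow> Y \<subseteq> L' \<Longrightarrow> finite (quot_set L' Y) \<Longrightarrow>
      M.lattice_iso (g Y) (plus_J Y) Y \<and> (\<forall>n\<in>plus_J Y. g Y n - n \<in> J)"
    by metis
  \<comment> \<open>Indices in \<open>L\<close> are compared through \<open>L'\<close>, which
    contains both \<open>Y\<close> and Y + J; the common factor [L' : L] is finite and nonzero and
    cancels.\<close>
  have index: "quot_index L X' = quot_index L X * quot_index (plus_J Y) Y \<and>
      (finite (quot_set L X') \<longleftrightarrow> finite (quot_set L X))"
    if Y: "M.Gv.sm Y" "Y \<subseteq> L'" "finite (quot_set L' Y)"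
      and X: "O.Gv.sm X" "X \<subseteq> L" "X \<subseteq> plus_J Y"
      and X': "O.Gv.sm X'" "X' \<subseteq> L" "X' = g Y ` X" for X X' Y
  proof -
    note iso = conjunct1[OF g[OF Y]]
    have N: "M.Gv.sm (plus_J Y)" "Y \<subseteq> plus_J Y" "plus_J Y \<subseteq> L'"
      using plus_J_between[OF Y(1,2)] plus_J_least[OF Y(1) plus_J_sm[OF Y(1)]]
      by (auto simp: between_def)
    note sgs = M.Gv.sm_subgroup[OF N(1)] M.Gv.sm_subgroup[OF Y(1)] O.Gv.sm_subgroup[OF X(1)]
      O.Gv.sm_subgroup[OF X'(1)]
    have im: "g Y ` plus_J Y = Y" using M.lattice_isoD(3)[OF iso] .
    have X'Y: "X' \<subseteq> Y" using X(3) im X'(3) by blast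
    have idx: "quot_index Y X' = quot_index (plus_J Y) X"
      "finite (quot_set Y X') \<longleftrightarrow> finite (quot_set (plus_J Y) X)"
      using M.lattice_iso_index[OF iso sgs(1) order_refl X(3)] im X'(3) by auto
    have finN: "finite (quot_set L' (plus_J Y))" "finite (quot_set (plus_J Y) Y)"
      using finite_quot_set_tower[OF sg(1) sgs(1,2) N(2,3)] Y(3) by blast+
    have "quot_index L' X' = quot_index L' (plus_J Y) * quot_index (plus_J Y) Y * quot_index Y X'"
      using quot_index_tower[OF sg(1) sgs(1,2) N(2,3)] quot_index_tower[OF sg(1) sgs(2,4) X'Y Y(2)]
      by simp
    also have "\<dots> = quot_index L' X * quot_index (plus_J Y) Y"
      using quot_index_tower[OF sg(1) sgs(1,3) X(3) N(3)] idx(1) by simp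
    finally have "quot_index L' L * quot_index L X' =
        quot_index L' L * (quot_index L X * quot_index (plus_J Y) Y)"
      unfolding quot_index_tower[OF sg(1,2) sgs(3) X(2) L_subset]
        quot_index_tower[OF sg(1,2) sgs(4) X'(2) L_subset] mult.assoc .
    moreover have "quot_index L' L \<noteq> 0" using quot_index_pos[OF sg(1) finite_L'_L] by simp
    moreover have "finite (quot_set L X') \<longleftrightarrow> finite (quot_set L' X')"
      "finite (quot_set L X) \<longleftrightarrow> finite (quot_set L' X)"
      "finite (quot_set L' X') \<longleftrightarrow> finite (quot_set Y X')"
      "finite (quot_set L' X) \<longleftrightarrow> finite (quot_set (plus_J Y) X)"
      using finite_quot_set_tower[OF sg(1,2) sgs(4) X'(2) L_subset]
        finite_quot_set_tower[OF sg(1,2) sgs(3) X(2) L_subset]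
        finite_quot_set_tower[OF sg(1) sgs(2,4) X'Y Y(2)]
        finite_quot_set_tower[OF sg(1) sgs(1,3) X(3) N(3)] finite_L'_L Y(3) finN by auto
    ultimately show ?thesis using idx(2) by simp
  qed
  have restrict: "module_isomorphic G act X M' \<longleftrightarrow> module_isomorphic G act X' M'"
    if iso: "M.lattice_iso h N Y" and X: "X \<subseteq> N" "X' = h ` X" "O.Gv.sm X" "O.Gv.sm X'" for h N Y X X'
  proof
    note h = M.lattice_isoD[OF iso]
    have bij: "bij_betw h X X'" using h(2) X by (auto simp: bij_betw_def intro: inj_on_subset)
    have hX: "h (x + y) = h x + h y" "h (act a x) = act a (h x)"
      if "x \<in> X" "y \<in> X" "a \<in> G" for x y a
      using h(4,5) that X(1) G_subset_H by blast+
    show "module_isomorphic G act X' M'" if "module_isomorphic G act X M'"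
    proof -
      from that obtain f where f: "bij_betw f X M'" "\<forall>x\<in>X. \<forall>y\<in>X. f (x + y) = f x + f y"
        "\<forall>a\<in>G. \<forall>x\<in>X. f (act a x) = act a (f x)"
        unfolding module_isomorphic_def by blast
      define k where "k = inv_into X h"
      have k: "bij_betw k X' X" using bij by (simp add: k_def bij_betw_inv_into)
      have kh: "k (h x) = x" if "x \<in> X" for x
        using that bij by (simp add: k_def bij_betw_def)
      have "(f \<circ> k) (x + y) = (f \<circ> k) x + (f \<circ> k) y" if "x \<in> X'" "y \<in> X'" for x y
      proof -
        from that X(2) obtain u v where uv: "x = h u" "y = h v" "u \<in> X" "v \<in> X" by blast
        then have "x + y = h (u + v)" "u + v \<in> X"
          using hX(1)[OF _ _ O.G_one] O.Gv.sm_add[OF X(3)] by auto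
        then show ?thesis using uv f(2) kh by simp
      qed
      moreover have "(f \<circ> k) (act a x) = act a ((f \<circ> k) x)" if "a \<in> G" "x \<in> X'" for a x
      proof -
        from that X(2) obtain u where u: "x = h u" "u \<in> X" by blast
        then have "act a x = h (act a u)" "act a u \<in> X"
          using hX(2)[OF u(2) u(2) that(1)] O.Gv.sm_act[OF X(3) that(1)] by auto
        then show ?thesis using u f(3) kh that by simp
      qed
      ultimately show ?thesis
        unfolding module_isomorphic_def using bij_betw_trans[OF k f(1)] by blast
    qed
    show "module_isomorphic G act X M'" if "module_isomorphic G act X' M'"
    proof -
      from that obtain f where f: "bij_betw f X' M'" "\<forall>x\<in>X'. \<forall>y\<in>X'. f (x + y) = f x + f y"
        "\<forall>a\<in>G. \<forall>x\<in>X'. f (act a x) = act a (f x)"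
        unfolding module_isomorphic_def by blast
      have "h x \<in> X'" if "x \<in> X" for x using that X(2) by blast
      then have "(f \<circ> h) (x + y) = (f \<circ> h) x + (f \<circ> h) y" if "x \<in> X" "y \<in> X" for x y
        using that f(2) hX(1)[OF that O.G_one] by simp
      moreover have "(f \<circ> h) (act a x) = act a ((f \<circ> h) x)" if "a \<in> G" "x \<in> X" for a x
        using that f(3) hX(2)[OF that(2,2,1)] \<open>\<And>x. x \<in> X \<Longrightarrow> h x \<in> X'\<close> by simp
      ultimately show ?thesis
        unfolding module_isomorphic_def using bij_betw_trans[OF bij f(1)] by blast
    qed
  qed
  have P: "M.Gv.sm Y \<and> Y \<subseteq> L' \<and> finite (quot_set L' Y) \<and> O.Gv.sm X \<and> X \<subseteq> L \<and> X \<subseteq> plus_J Y \<and>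
      plus_J Y = M.Gv.gen X"
    if "(X, Y) \<in> ?P" for X Y
  proof -
    have X: "O.Gv.sm X" "X \<subseteq> L" "J \<subseteq> M.Gv.gen X" and Y: "M.Gv.sm Y" "Y \<subseteq> M.Gv.gen X"
      "finite (quot_set (M.Gv.gen X) Y)" "plus_J Y = M.Gv.gen X"
      using that by (auto simp: outer_def)
    have sub: "M.Gv.gen X \<subseteq> L'" by (rule gen_subset_L'[OF X(2)])
    have "finite (quot_set L' Y)"
      using finite_quot_set_tower[OF sg(1) M.Gv.sm_subgroup[OF M.Gv.sm_gen]
          M.Gv.sm_subgroup[OF Y(1)] Y(2) sub] Y(3)
        finite_L'_between[OF M.Gv.sm_gen X(3) sub] by blast
    then show ?thesis using X Y sub M.Gv.gen_inc by auto
  qed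
  have gen_image: "M.Gv.gen (g Y ` X) = Y" if "(X, Y) \<in> ?P" for X Y
  proof -
    note * = P[OF that]
    have iso: "M.lattice_iso (g Y) (plus_J Y) Y" using g * by blast
    have "M.Gv.gen (g Y ` X) = g Y ` M.Gv.gen X"
      using M.lattice_iso_gen[OF iso plus_J_sm] * by blast
    also have "M.Gv.gen X = plus_J Y" using * by blast
    also have "g Y ` plus_J Y = Y" by (rule M.lattice_isoD(3)[OF iso])
    finally show ?thesis .
  qed
  have "bij_betw (\<lambda>(X, Y). g Y ` X) ?P ?S"
  proof (rule bij_betw_imageI)
    show "inj_on (\<lambda>(X, Y). g Y ` X) ?P"
    proof (rule inj_onI)
      fix u v assume u: "u \<in> ?P" and v: "v \<in> ?P"
        and eq: "(case u of (X, Y) \<Rightarrow> g Y ` X) = (case v of (X, Y) \<Rightarrow> g Y ` X)"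
      obtain X Y X2 Y2 where uv: "u = (X, Y)" "v = (X2, Y2)" by (cases u, cases v)
      note u' = u[unfolded uv] and v' = v[unfolded uv]
      have eq': "g Y ` X = g Y2 ` X2" using eq by (simp add: uv)
      \<comment> \<open>\<open>Y\<close> is recovered from the image as the lattice it generates
        over \<open>H\<close>.\<close>
      have YY: "Y = Y2" using gen_image[OF u'] gen_image[OF v'] unfolding eq' by (rule trans[OF sym])
      have iso: "M.lattice_iso (g Y) (plus_J Y) Y" using g P[OF u'] by blast
      have "X = X2"
      proof (rule inj_on_image_eq_iff[OF M.lattice_isoD(2)[OF iso], THEN iffD1])
        show "g Y ` X = g Y ` X2" using eq' by (simp add: YY)
        show "X \<subseteq> plus_J Y" using P[OF u'] by blast
        show "X2 \<subseteq> plus_J Y" unfolding YY using P[OF v'] by blast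
      qed
      then show "u = v" using uv YY by simp
    qed
    show "(\<lambda>(X, Y). g Y ` X) ` ?P = ?S"
    proof (intro equalityI subsetI)
      fix X' assume "X' \<in> (\<lambda>(X, Y). g Y ` X) ` ?P"
      then obtain X Y where XY: "(X, Y) \<in> ?P" "X' = g Y ` X" by auto
      note * = P[OF XY(1)]
      have iso: "M.lattice_iso (g Y) (plus_J Y) Y" and near: "\<forall>n\<in>plus_J Y. g Y n - n \<in> J"
        using g * by blast+
      have sm': "O.Gv.sm X'"
        unfolding XY(2) using M.lattice_iso_image_submodule[OF iso G_subset_H] * by blast
      have "X' \<subseteq> L"
      proof
        fix w assume "w \<in> X'"
        then obtain x where x: "x \<in> X" "w = g Y x" using XY(2) by blast
        then have "g Y x - x \<in> L" "x \<in> L" using near * J_subset_L by blast+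
        then have "(g Y x - x) + x \<in> L" using O.Gv.sm_add[OF L_sm] by blast
        then show "w \<in> L" using x(2) by simp
      qed
      moreover have "quot_index L X' = m" "finite (quot_set L X')"
        using index[of Y X X'] * sm' \<open>X' \<subseteq> L\<close> XY finite_L_outer by auto
      moreover have "module_isomorphic G act X' M'"
        using restrict[OF iso _ XY(2) _ sm'] * XY(1) by (auto simp: outer_def)
      ultimately show "X' \<in> ?S" using sm' by blast
    next
      fix X' assume "X' \<in> ?S"
      then have X': "O.Gv.sm X'" "X' \<subseteq> L" "finite (quot_set L X')" "quot_index L X' = m"
        "module_isomorphic G act X' M'" by auto
      define Y where "Y = M.Gv.gen X'"
      have Y: "M.Gv.sm Y" "Y \<subseteq> L'" "X' \<subseteq> Y"
        using M.Gv.sm_gen gen_subset_L'[OF X'(2)] M.Gv.gen_inc by (auto simp: Y_def)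
      have "finite (quot_set L' X')"
        using finite_quot_set_tower[OF sg(1,2) O.Gv.sm_subgroup[OF X'(1)] X'(2) L_subset]
          X'(3) finite_L'_L by blast
      then have finY: "finite (quot_set L' Y)"
        using finite_quot_set_tower[OF sg(1) M.Gv.sm_subgroup[OF Y(1)] O.Gv.sm_subgroup[OF X'(1)]
            Y(3,2)] by blast
      have iso: "M.lattice_iso (g Y) (plus_J Y) Y" and near: "\<forall>n\<in>plus_J Y. g Y n - n \<in> J"
        using g[OF Y(1,2) finY] by blast+
      have N: "M.Gv.sm (plus_J Y)" "J \<subseteq> plus_J Y" "Y \<subseteq> plus_J Y" "plus_J Y \<subseteq> L'"
        using plus_J_between[OF Y(1,2)] plus_J_least[OF Y(1) plus_J_sm[OF Y(1)]]
        by (auto simp: between_def)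
      define X where "X = {n\<in>plus_J Y. g Y n \<in> X'}"
      have X: "O.Gv.sm X" "g Y ` X = X'" "X \<subseteq> plus_J Y"
        using M.lattice_iso_vimage_submodule[OF iso G_subset_H X'(1) Y(3) N(1)]
        by (auto simp: X_def)
      have XL: "X \<subseteq> L"
      proof
        fix x assume "x \<in> X"
        then have "g Y x \<in> L" "g Y x - x \<in> L" using X'(2) near J_subset_L by (auto simp: X_def)
        then have "g Y x - (g Y x - x) \<in> L" using O.Gv.sm_diff[OF L_sm] by blast
        then show "x \<in> L" by simp
      qed
      \<comment> \<open>Generation over \<open>H\<close> commutes with the isomorphism, so both
        sides have image \<open>Y\<close>, and injectivity identifies H X with Y + J.\<close>
      have "g Y ` M.Gv.gen X = g Y ` plus_J Y"
        using M.lattice_iso_gen[OF iso N(1) X(3)] X(2) M.lattice_isoD(3)[OF iso]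
        by (simp add: Y_def)
      then have gen: "M.Gv.gen X = plus_J Y"
        using inj_on_image_eq_iff[OF M.lattice_isoD(2)[OF iso]] M.Gv.gen_minimal[OF X(3) N(1)]
        by blast
      have "finite (quot_set (plus_J Y) Y)"
        using finite_quot_set_tower[OF sg(1) M.Gv.sm_subgroup[OF N(1)] M.Gv.sm_subgroup[OF Y(1)]
            N(3,4)] finY by blast
      moreover have "X \<in> outer M'"
        using X(1) XL restrict[OF iso X(3) X(2)[symmetric] X(1) X'(1)] X'(5) gen N(2)
        by (simp add: outer_def)
      moreover have "quot_index L X * quot_index (plus_J Y) Y = m"
        using index[OF Y(1,2) finY X(1) XL X(3) X'(1,2) X(2)[symmetric]] X'(4) by simp
      ultimately have "(X, Y) \<in> ?P" using Y(1) N(3) gen by simp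
      then show "X' \<in> (\<lambda>(X, Y). g Y ` X) ` ?P" using X(2) by force
    qed
  qed
  then show ?thesis using bij_betw_same_card by fastforce
qed

text \<open>The pairs (X, Y) are grouped by X, and the index of \<open>X\<close> in \<open>L\<close>
  shifts the exponents of the series that counts the Y.\<close>

lemma partial_zeta_eq:
  "partial_solomon_zeta q act G L M' =
    (\<Sum>X\<in>outer M'. norm_term q (quot_index L X) *
      Abs_fps (\<lambda>j. int (card {Y \<in> M.sublattices (M.Gv.gen X) (q ^ j). plus_J Y = M.Gv.gen X})))"
proof (rule fps_ext)
  fix n
  define E where "E X j = {Y \<in> M.sublattices (M.Gv.gen X) (q ^ j). plus_J Y = M.Gv.gen X}" for X j
  define P where "P X = {Y. M.Gv.sm Y \<and> Y \<subseteq> M.Gv.gen X \<and> finite (quot_set (M.Gv.gen X) Y) \<and>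
      quot_index L X * quot_index (M.Gv.gen X) Y = q ^ n \<and> plus_J Y = M.Gv.gen X}" for X
  have "\<forall>X\<in>outer M'. \<exists>a. quot_index L X = q ^ a"
    using O.index_power[OF L_sm] finite_L_outer by (auto simp: outer_def)
  then obtain a where a: "\<And>X. X \<in> outer M' \<Longrightarrow> quot_index L X = q ^ a X" by metis
  have PE: "P X = (if n < a X then {} else E X (n - a X))" if X: "X \<in> outer M'" for X
  proof (cases "n < a X")
    case True
    have False if "Y \<in> P X" for Y
    proof -
      have "q ^ a X * quot_index (M.Gv.gen X) Y = q ^ n" "0 < quot_index (M.Gv.gen X) Y"
        using that a[OF X] quot_index_pos[OF M.Gv.sm_subgroup[OF M.Gv.sm_gen]]
        by (auto simp: P_def)
      then have "q ^ a X \<le> q ^ n" by (metis le_square mult_le_mono2 mult.right_neutral Suc_leI One_nat_def)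
      then show False using True M.residue_card_ge_2 by (simp add: power_le_imp_le_exp leD)
    qed
    then show ?thesis using True by auto
  next
    case False
    then have "q ^ n = q ^ a X * q ^ (n - a X)" by (simp add: power_add[symmetric])
    then have "quot_index L X * quot_index (M.Gv.gen X) Y = q ^ n \<longleftrightarrow>
        quot_index (M.Gv.gen X) Y = q ^ (n - a X)" for Y
      using a[OF X] M.residue_card_ge_2 by simp
    then show ?thesis using False by (auto simp: P_def E_def M.sublattices_def)
  qed
  have finE: "finite (E X j)" if X: "X \<in> outer M'" for X j
  proof -
    have "between (M.Gv.gen X)"
      using X gen_subset_L' M.Gv.sm_gen by (auto simp: between_def outer_def)
    then have "finite (M.sublattices (M.Gv.gen X) (q ^ j))"
      unfolding M.sublattices_def by (rule M.finite_sublattices[OF between_fg])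
    then show ?thesis by (simp add: E_def)
  qed
  have "fps_nth (partial_solomon_zeta q act G L M') n = int (card (SIGMA X:outer M'. P X))"
    unfolding partial_solomon_zeta_def fps_nth_Abs_fps P_def
    by (simp only: card_isomorphic_sublattices)
  also have "card (SIGMA X:outer M'. P X) = (\<Sum>X\<in>outer M'. card (P X))"
    using finE PE by (intro card_SigmaI finite_outer) auto
  also have "int \<dots> = (\<Sum>X\<in>outer M'. if n < a X then 0 else int (card (E X (n - a X))))"
    using PE by (simp add: if_distrib[of card] if_distrib[of int] cong: if_cong)
  also have "\<dots> = fps_nth (\<Sum>X\<in>outer M'. norm_term q (quot_index L X) *
      Abs_fps (\<lambda>j. int (card (E X j)))) n"
    using a norm_term_power[OF M.residue_card_ge_2]
    by (simp add: fps_sum_nth fps_X_power_mult_nth cong: if_cong)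
  finally show "fps_nth (partial_solomon_zeta q act G L M') n =
      fps_nth (\<Sum>X\<in>outer M'. norm_term q (quot_index L X) *
      Abs_fps (\<lambda>j. int (card {Y \<in> M.sublattices (M.Gv.gen X) (q ^ j). plus_J Y = M.Gv.gen X}))) n"
    by (simp add: E_def)
qed

theorem zeta_quotient:
  "fps_quotient (partial_solomon_zeta q act G L M') (solomon_zeta q act H L') =
    (\<Sum>X\<in>outer M'. norm_term q (quot_index L X) *
      Q_poly q act H conductor L' (quo (M.Gv.gen X)))"
proof (rule fps_quotient_eqI)
  have "between (M.Gv.gen X)" if "X \<in> outer M'" for X
    using that gen_subset_L' M.Gv.sm_gen by (auto simp: between_def outer_def)
  then show "partial_solomon_zeta q act G L M' =
      (\<Sum>X\<in>outer M'. norm_term q (quot_index L X) *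
        Q_poly q act H conductor L' (quo (M.Gv.gen X))) * solomon_zeta q act H L'"
    unfolding partial_zeta_eq sum_distrib_right mult.assoc
    by (intro sum.cong refl) (simp add: Q_poly_mult_zeta)
qed (rule zeta_constant_term[OF L'_sm])

end

theorem theorem1p1:
  fixes av :: "'k::field \<Rightarrow> real"
    and scale :: "'k \<Rightarrow> 'a::ring_1 \<Rightarrow> 'a"
    and act :: "'a \<Rightarrow> 'v::ab_group_add \<Rightarrow> 'v"
    and R :: "'k set" and q :: nat
    and \<Lambda> \<Lambda>' I :: "'a set"
    and L M L' :: "'v set"
    and outer :: "'v set set"
  assumes K: "nonarch_local_field av"
    and R: "R = val_ring av"
    and q: "q = residue_card av"
    and A: "fd_semisimple_algebra scale"
    and V: "fg_left_module act"
    and \<Lambda>: "is_order R scale \<Lambda>"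
    and L: "is_full_lattice scale act \<Lambda> L"
    and M: "is_full_lattice scale act \<Lambda> M"
    and \<Lambda>': "is_maximal_order R scale \<Lambda>'" "\<Lambda> \<subseteq> \<Lambda>'"
    and L': "L' = gen_submodule \<Lambda>' act L"
    and I: "I = {a. \<forall>x\<in>\<Lambda>'. \<forall>y\<in>\<Lambda>'. x * a * y \<in> \<Lambda>}"
    and outer: "outer = {X. is_submodule \<Lambda> act X \<and> X \<subseteq> L \<and> module_isomorphic \<Lambda> act X M \<and>
                           ideal_mult act I L' \<subseteq> gen_submodule \<Lambda>' act X}"
  shows
    "finite (quot_set L' (ideal_mult act I L')) \<and>
     fps_nth (solomon_zeta q act \<Lambda>' L') 0 = 1 \<and>
     (fps_quotient (partial_solomon_zeta q act \<Lambda> L M) (solomon_zeta q act \<Lambda>' L') =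
           (\<Sum>X\<in>outer. norm_term q (quot_index L X) *
              Q_poly q act \<Lambda>' I L' (quot_set (gen_submodule \<Lambda>' act X) (ideal_mult act I L')))) \<and>
     finite outer \<and>
     (\<forall>X\<in>outer. Q_poly q act \<Lambda>' I L'
           (quot_set (gen_submodule \<Lambda>' act X) (ideal_mult act I L')) \<in> range fps_of_poly) \<and>
     fps_quotient (partial_solomon_zeta q act \<Lambda> L M) (solomon_zeta q act \<Lambda>' L')
           \<in> range fps_of_poly"
proof -
  interpret K: nonarch_local_field av by (rule K)
  interpret A: fd_semisimple_algebra scale by (rule A)
  interpret V: fg_left_module act by (rule V)
  have "local_order_axioms av scale \<Lambda>" using \<Lambda> R by (simp add: local_order_axioms_def)
  moreover have "maximal_order_axioms av scale \<Lambda>'" using \<Lambda>'(1) R by (simp add: maximal_order_axioms_def)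
  moreover have "fin_gen \<Lambda> act L" using L by (simp add: is_full_lattice_def)
  ultimately interpret E: lattice_extension av scale \<Lambda>' \<Lambda> act L
    by unfold_locales (use \<Lambda>'(2) in \<open>auto simp: local_order_axioms_def maximal_order_axioms_def\<close>)
  have eqs: "E.conductor = I" "E.L' = L'" "E.J = ideal_mult act I L'" "E.outer M = outer"
    by (simp_all add: E.conductor_def I E.L'_def L' E.J_def outer E.outer_def)
  have quotient: "fps_quotient (partial_solomon_zeta q act \<Lambda> L M) (solomon_zeta q act \<Lambda>' L') =
      (\<Sum>X\<in>outer. norm_term q (quot_index L X) *
        Q_poly q act \<Lambda>' I L' (quot_set (gen_submodule \<Lambda>' act X) (ideal_mult act I L')))"
    using E.zeta_quotient[of M] unfolding eqs q .
  show ?thesis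
  proof (intro conjI ballI)
    show "finite (quot_set L' (ideal_mult act I L'))"
      using E.finite_L'_J unfolding eqs .
    show "fps_nth (solomon_zeta q act \<Lambda>' L') 0 = 1"
      using E.zeta_constant_term[OF E.L'_sm] unfolding eqs q .
    show "finite outer"
      using E.finite_outer[of M] unfolding eqs .
    show "fps_quotient (partial_solomon_zeta q act \<Lambda> L M) (solomon_zeta q act \<Lambda>' L')
        \<in> range fps_of_poly"
      unfolding quotient by (intro range_fps_of_poly_sum range_fps_of_poly_mult
          norm_term_in_range_fps_of_poly Q_poly_in_range_fps_of_poly)
  qed (rule quotient Q_poly_in_range_fps_of_poly)+
qed

end
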